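(* The equation of motion of the non-autonomous Zhukovsky-Volterra gyrostat $$ \partial_\tau\vec S=\vec S\times(\vec J(\tau)\cdot\vec S)+\vec S\times\vec\nu',\qquad \vec J(\tau)\cdot\vec S=(J_1S_1,J_2S_2,J_3S_3),\quad J_\alpha(\tau)=\wp(\omega_\alpha,\tau), $$ has the Lax form $$\partial_\tau L^{NAZVG}-\partial_wM^{NAZVG}+\frac1\kappa[M^{NAZVG},L^{NAZVG}]=0$$ with $$ L^{NAZVG}=-\frac\kappa2\,\partial_w\ln\vartheta(w;\tau)\,\sigma_0+\sum_{\alpha=1}^3\bigl(S_\alpha\varphi_\alpha(w)+\tilde\nu_\alpha\varphi_\alpha(w-\omega_\alpha)\bigr)\sigma_\alpha, $$ $$ M^{NAZVG}=-\frac\kappa2\,\partial_\tau\ln\vartheta(w;\tau)\,\sigma_0-\sum_{\alpha=1}^3S_\alpha\frac{\varphi_1(w)\varphi_2(w)\varphi_3(w)}{\varphi_\alpha(w)}\sigma_\alpha+E_1(w)\,L^{NAZVG}\big|_{\kappa=0}. $$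
   Context: $\tau$ is in the upper half plane and plays the role of time; $\kappa\ne0$ is a parameter (the classical level); $\vec S=(S_1,S_2,S_3)$; $\tilde\nu_1,\tilde\nu_2,\tilde\nu_3$ are constants, and the gyrostat momentum $\vec\nu'=(\nu_1',\nu_2',\nu_3')$ (called constant in the paper) is related to them by $\nu'_\alpha=-\tilde\nu_\alpha\exp(-2\pi i\,\omega_\alpha\partial_\tau\omega_\alpha)\bigl(\vartheta'(0)/\vartheta(\omega_\alpha)\bigr)^2$. $\omega_1=\frac12$, $\omega_2=\frac\tau2$, $\omega_3=\frac{1+\tau}2$, so $\partial_\tau\omega_1=0$, $\partial_\tau\omega_2=\partial_\tau\omega_3=\frac12$. $\sigma_0$ is the $2\times2$ identity and $\sigma_\alpha$ the Pauli matrices. $\vartheta(z)=\vartheta(z;\tau)=\sum_{j\in\mathbb Z}\exp\bigl(\pi i(j+\frac12)^2\tau+2\pi i(j+\frac12)(z+\frac12)\bigr)$, $E_1(z)=\partial_z\log\vartheta(z;\tau)$, $$\phi(u,z)=\frac{\vartheta(u+z)\vartheta'(0)}{\vartheta(u)\vartheta(z)},\qquad \varphi_\alpha(z)=\exp(2\pi i z\,\partial_\tau\omega_\alpha)\,\phi(z,\omega_\alpha).$$ $\wp(z,\tau)$ is the Weierstrass function of $\mathbb Z+\tau\mathbb Z$; $\times$ is the cross product on $\mathbb C^3$.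
   Formalization: As printed the claim fails (e.g. constant S=(1,0,0), ν̃=0). Here the traceless part of M carries a factor 1/(2πi), and L, M are taken with −πκS and πκν̃ in place of S and ν̃; S is holomorphic on an open set and w avoids lattice and half-period points. *)

theory Defs
  imports "HOL-Analysis.Analysis" "HOL-Complex_Analysis.Complex_Analysis"
begin

section \<open>Theta function and half periods\<close>

definition theta :: "complex \<Rightarrow> complex \<Rightarrow> complex" where
  "theta z \<tau> = (\<Sum>\<^sub>\<infinity>j\<in>(UNIV :: int set).
     exp (of_real pi * \<i> * (of_int j + 1/2)\<^sup>2 * \<tau>
          + 2 * of_real pi * \<i> * (of_int j + 1/2) * (z + 1/2)))"

definition theta_dz :: "complex \<Rightarrow> complex \<Rightarrow> complex" where
  "theta_dz z \<tau> = deriv (\<lambda>x. theta x \<tau>) z"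

definition theta_dtau :: "complex \<Rightarrow> complex \<Rightarrow> complex" where
  "theta_dtau z \<tau> = deriv (\<lambda>t. theta z t) \<tau>"

text \<open>Derivatives of \<open>ln \<vartheta>\<close> are written as logarithmic derivatives, so that no branch of
  the logarithm is involved.\<close>

definition E1 :: "complex \<Rightarrow> complex \<Rightarrow> complex" where
  "E1 z \<tau> = theta_dz z \<tau> / theta z \<tau>"

definition dtau_ln_theta :: "complex \<Rightarrow> complex \<Rightarrow> complex" where
  "dtau_ln_theta z \<tau> = theta_dtau z \<tau> / theta z \<tau>"

definition half_period :: "3 \<Rightarrow> complex \<Rightarrow> complex" where
  "half_period \<alpha> \<tau> = (if \<alpha> = 1 then 1/2 else if \<alpha> = 2 then \<tau>/2 else (1 + \<tau>)/2)"

definition half_period_dtau :: "3 \<Rightarrow> complex \<Rightarrow> complex" where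
  "half_period_dtau \<alpha> \<tau> = deriv (half_period \<alpha>) \<tau>"

definition kronecker_phi :: "complex \<Rightarrow> complex \<Rightarrow> complex \<Rightarrow> complex" where
  "kronecker_phi u z \<tau> = theta (u + z) \<tau> * theta_dz 0 \<tau> / (theta u \<tau> * theta z \<tau>)"

definition varphi :: "3 \<Rightarrow> complex \<Rightarrow> complex \<Rightarrow> complex" where
  "varphi \<alpha> z \<tau> = exp (2 * of_real pi * \<i> * z * half_period_dtau \<alpha> \<tau>)
                   * kronecker_phi z (half_period \<alpha> \<tau>) \<tau>"

definition weierstrass_p :: "complex \<Rightarrow> complex \<Rightarrow> complex" where
  "weierstrass_p z \<tau> = 1 / z\<^sup>2 +
     (\<Sum>\<^sub>\<infinity>(m, n)\<in>(UNIV :: (int \<times> int) set) - {(0, 0)}.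
        1 / (z - (of_int m + of_int n * \<tau>))\<^sup>2 - 1 / (of_int m + of_int n * \<tau>)\<^sup>2)"

section \<open>Equation of motion\<close>

text \<open>The library's \<open>cross3\<close> is restricted to real vectors.\<close>

definition ccross :: "complex^3 \<Rightarrow> complex^3 \<Rightarrow> complex^3" where
  "ccross a b = vector [a$2 * b$3 - a$3 * b$2,
                        a$3 * b$1 - a$1 * b$3,
                        a$1 * b$2 - a$2 * b$1]"

definition inertia :: "complex \<Rightarrow> complex^3 \<Rightarrow> complex^3" where
  "inertia \<tau> s = (\<chi> \<alpha>. weierstrass_p (half_period \<alpha> \<tau>) \<tau> * s$\<alpha>)"

definition gyrostat_momentum :: "complex^3 \<Rightarrow> complex \<Rightarrow> complex^3" where
  "gyrostat_momentum \<nu> \<tau> = (\<chi> \<alpha>.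
     - \<nu>$\<alpha> * exp (- 2 * of_real pi * \<i> * half_period \<alpha> \<tau> * half_period_dtau \<alpha> \<tau>)
       * (theta_dz 0 \<tau> / theta (half_period \<alpha> \<tau>) \<tau>)\<^sup>2)"

definition nazvg_eom :: "(complex \<Rightarrow> complex^3) \<Rightarrow> complex^3 \<Rightarrow> complex \<Rightarrow> bool" where
  "nazvg_eom S \<nu> \<tau> \<longleftrightarrow>
     (\<chi> \<alpha>. deriv (\<lambda>t. S t $ \<alpha>) \<tau>)
       = ccross (S \<tau>) (inertia \<tau> (S \<tau>)) + ccross (S \<tau>) (gyrostat_momentum \<nu> \<tau>)"

section \<open>Lax pair\<close>

definition pauli :: "3 \<Rightarrow> complex^2^2" where
  "pauli \<alpha> = (if \<alpha> = 1 then vector [vector [0, 1], vector [1, 0]]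
              else if \<alpha> = 2 then vector [vector [0, - \<i>], vector [\<i>, 0]]
              else vector [vector [1, 0], vector [0, - 1]])"

definition mscale :: "complex \<Rightarrow> complex^2^2 \<Rightarrow> complex^2^2" where
  "mscale c A = (\<chi> i j. c * A$i$j)"

text \<open>The identity matrix is \<open>mat 1\<close>; \<open>S\<close> is a function of time, \<open>\<nu>\<close> holds the constants
  \<open>\<nu>\<close>-tilde.\<close>

definition lax_L ::
  "complex \<Rightarrow> (complex \<Rightarrow> complex^3) \<Rightarrow> complex^3 \<Rightarrow> complex \<Rightarrow> complex \<Rightarrow> complex^2^2" where
  "lax_L \<kappa> S \<nu> \<tau> w =
     mscale (- (\<kappa>/2) * E1 w \<tau>) (mat 1)
     + (\<Sum>\<alpha>\<in>UNIV. mscale (S \<tau> $ \<alpha> * varphi \<alpha> w \<tau>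
                          + \<nu>$\<alpha> * varphi \<alpha> (w - half_period \<alpha> \<tau>) \<tau>) (pauli \<alpha>))"

text \<open>The factor \<open>1/(2\<pi>\<i>)\<close> on the traceless part is not in the source formula. It is forced by
  the heat equation \<open>4\<pi>\<i> \<partial>\<^sub>\<tau>\<vartheta> = \<partial>\<^sub>z\<^sup>2\<vartheta>\<close> of the theta series above, which gives
  \<open>2\<pi>\<i> \<partial>\<^sub>\<tau>\<phi> = \<partial>\<^sub>u\<partial>\<^sub>z\<phi>\<close>; without it the terms of \<open>\<partial>\<^sub>\<tau>L - \<partial>\<^sub>wM\<close> linear in \<open>S\<close> and \<open>\<nu>\<close> do not
  cancel.\<close>

definition lax_M ::
  "complex \<Rightarrow> (complex \<Rightarrow> complex^3) \<Rightarrow> complex^3 \<Rightarrow> complex \<Rightarrow> complex \<Rightarrow> complex^2^2" where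
  "lax_M \<kappa> S \<nu> \<tau> w =
     mscale (- (\<kappa>/2) * dtau_ln_theta w \<tau>) (mat 1)
     + mscale (1 / (2 * of_real pi * \<i>))
         (- (\<Sum>\<alpha>\<in>UNIV. mscale (S \<tau> $ \<alpha> *
               (varphi 1 w \<tau> * varphi 2 w \<tau> * varphi 3 w \<tau> / varphi \<alpha> w \<tau>)) (pauli \<alpha>))
          + mscale (E1 w \<tau>) (lax_L 0 S \<nu> \<tau> w))"

definition commutator :: "complex^2^2 \<Rightarrow> complex^2^2 \<Rightarrow> complex^2^2" where
  "commutator A B = A ** B - B ** A"

definition mderiv :: "(complex \<Rightarrow> complex^2^2) \<Rightarrow> complex \<Rightarrow> complex^2^2" where
  "mderiv F x = (\<chi> i j. deriv (\<lambda>t. F t $ i $ j) x)"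

definition lax_equation ::
  "complex \<Rightarrow> (complex \<Rightarrow> complex \<Rightarrow> complex^2^2) \<Rightarrow> (complex \<Rightarrow> complex \<Rightarrow> complex^2^2)
     \<Rightarrow> complex \<Rightarrow> complex \<Rightarrow> bool" where
  "lax_equation \<kappa> L M \<tau> w \<longleftrightarrow>
     mderiv (\<lambda>t. L t w) \<tau> - mderiv (\<lambda>x. M \<tau> x) w
       + mscale (1/\<kappa>) (commutator (M \<tau> w) (L \<tau> w)) = 0"

text \<open>Spectral parameters outside \<open>{0, \<omega>\<^sub>1, \<omega>\<^sub>2, \<omega>\<^sub>3} + \<int> + \<tau>\<int>\<close>, that is \<open>2w \<notin> \<int> + \<tau>\<int>\<close>. These points
  contain the poles of the Lax pair and the zeros of the functions \<open>varphi \<alpha>\<close>, by which the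
  formula for \<open>lax_M\<close> divides.\<close>

definition regular_spectral_points :: "complex \<Rightarrow> complex set" where
  "regular_spectral_points \<tau> = {w. \<forall>m n :: int. 2 * w \<noteq> of_int m + of_int n * \<tau>}"

end

theory Submission
  imports Defs
begin

text \<open>Write \<open>t\<^sub>\<alpha>(w) = exp(2\<pi>\<i> w \<partial>\<^sub>\<tau>\<omega>\<^sub>\<alpha>) \<vartheta>(w + \<omega>\<^sub>\<alpha>) / \<vartheta>(\<omega>\<^sub>\<alpha>)\<close>, an even entire function of \<open>w\<close>, so that
  \<open>\<phi>\<^sub>\<alpha> = \<vartheta>'(0) t\<^sub>\<alpha> / \<vartheta>\<close>. The Lax equation reduces to three identities whose two
  sides, after division by \<open>\<vartheta>\<^sup>2\<close> in the last two, are multiplied by \<open>\<plusminus>1\<close> under both periods: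
  \<open>\<phi>\<^sub>\<alpha>\<^sup>2 = \<wp> - \<wp>(\<omega>\<^sub>\<alpha>)\<close>,
  \<open>t\<^sub>\<alpha>' \<vartheta> = t\<^sub>\<alpha> \<vartheta>' - \<vartheta>'(0) t\<^sub>\<beta> t\<^sub>\<gamma>\<close> and
  \<open>t\<^sub>\<alpha>'' \<vartheta> - 2 t\<^sub>\<alpha>' \<vartheta>' + t\<^sub>\<alpha> \<vartheta>'' = c\<^sub>\<alpha> t\<^sub>\<alpha> \<vartheta>\<close>.
  Each of them follows from Liouville's theorem once the pole at \<open>0\<close> is shown to cancel. Together
  with the heat equation for \<open>\<vartheta>\<close>, the last two make the terms of \<open>\<partial>\<^sub>\<tau>L - \<partial>\<^sub>wM\<close> linear in \<open>S\<close> and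
  \<open>\<nu>\<close> collapse to \<open>\<partial>\<^sub>\<tau>S\<^sub>\<alpha> \<phi>\<^sub>\<alpha>\<close>, while the first turns the commutator into \<open>\<phi>\<^sub>\<alpha>\<close> times the right-hand
  side of the equation of motion. The equivalence then holds pointwise in \<open>w\<close>, because
  \<open>\<phi>\<^sub>\<alpha>(w) \<noteq> 0\<close>. That \<open>\<vartheta>\<close> has only the lattice points as zeros, all simple, is seen by comparing it
  with an explicit infinite product that has the same multipliers.\<close>

section \<open>Period lattice and Liouville's theorem\<close>

text \<open>The M-test makes the finite partial sums converge uniformly on the closed disc, and a
  uniform limit of holomorphic functions may be differentiated termwise. A majorant of the functions
  is enough: convergence of the derivatives at the centre comes from the same limit theorem.\<close>

lemma has_field_derivative_infsum:
  fixes f f' :: "'i \<Rightarrow> complex \<Rightarrow> complex"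
  assumes r: "r > 0"
    and deriv: "\<And>i z. i \<in> I \<Longrightarrow> z \<in> cball w r \<Longrightarrow> (f i has_field_derivative f' i z) (at z)"
    and bound: "\<And>i z. i \<in> I \<Longrightarrow> z \<in> cball w r \<Longrightarrow> norm (f i z) \<le> B i"
    and B: "B summable_on I"
  shows "((\<lambda>z. \<Sum>\<^sub>\<infinity>i\<in>I. f i z) has_field_derivative (\<Sum>\<^sub>\<infinity>i\<in>I. f' i w)) (at w)" (is ?deriv)
    and "(\<lambda>i. f' i w) summable_on I" (is ?summable)
proof -
  have ulim: "uniform_limit (cball w r) (\<lambda>X z. \<Sum>i\<in>X. f i z) (\<lambda>z. \<Sum>\<^sub>\<infinity>i\<in>I. f i z)
      (finite_subsets_at_top I)"
    by (rule Weierstrass_m_test_general[OF bound B])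
  have ev: "\<forall>\<^sub>F X in finite_subsets_at_top I. continuous_on (cball w r) (\<lambda>z. \<Sum>i\<in>X. f i z) \<and>
      (\<forall>z\<in>ball w r. ((\<lambda>z. \<Sum>i\<in>X. f i z) has_field_derivative (\<Sum>i\<in>X. f' i z)) (at z))"
  proof (rule eventually_finite_subsets_at_top_weakI, intro conjI ballI)
    fix X assume X: "finite X" "X \<subseteq> I"
    show "continuous_on (cball w r) (\<lambda>z. \<Sum>i\<in>X. f i z)"
      using X deriv
      by (intro continuous_on_sum continuous_at_imp_continuous_on ballI)
         (blast intro: DERIV_isCont)
    show "((\<lambda>z. \<Sum>i\<in>X. f i z) has_field_derivative (\<Sum>i\<in>X. f' i z)) (at z)"
      if "z \<in> ball w r" for z
      using X deriv that by (intro DERIV_sum) (auto simp: subset_iff)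
  qed
  obtain g' where g': "\<And>z. z \<in> ball w r \<Longrightarrow>
      ((\<lambda>z. \<Sum>\<^sub>\<infinity>i\<in>I. f i z) has_field_derivative g' z) (at z) \<and>
      ((\<lambda>X. \<Sum>i\<in>X. f' i z) \<longlongrightarrow> g' z) (finite_subsets_at_top I)"
    using has_complex_derivative_uniform_limit[OF ev ulim finite_subsets_at_top_neq_bot r]
    by blast
  have hs: "((\<lambda>i. f' i w) has_sum g' w) I"
    using g'[of w] r by (simp add: has_sum_def)
  thus ?summable by (auto simp: summable_on_def)
  from hs have "(\<Sum>\<^sub>\<infinity>i\<in>I. f' i w) = g' w"
    by (rule infsumI)
  thus ?deriv
    using g'[of w] r by simp
qed

section \<open>Geometry of the period lattice\<close>

definition period_lattice :: "complex \<Rightarrow> complex set" where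
  "period_lattice \<tau> = {of_int m + of_int n * \<tau> | m n. True}"

locale modulus =
  fixes \<tau> :: complex
  assumes Im_pos: "Im \<tau> > 0"
begin

abbreviation \<Lambda> :: "complex set" where "\<Lambda> \<equiv> period_lattice \<tau>"

lemma lattice_int [simp, intro]: "of_int m + of_int n * \<tau> \<in> \<Lambda>"
  by (auto simp: period_lattice_def)

lemma lattice_0 [simp, intro]: "0 \<in> \<Lambda>"
  and lattice_1 [simp, intro]: "1 \<in> \<Lambda>"
  and lattice_tau [simp, intro]: "\<tau> \<in> \<Lambda>"
  using lattice_int[of 0 0] lattice_int[of 1 0] lattice_int[of 0 1] by simp_all

lemma lattice_add: "a \<in> \<Lambda> \<Longrightarrow> b \<in> \<Lambda> \<Longrightarrow> a + b \<in> \<Lambda>"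
proof -
  assume "a \<in> \<Lambda>" "b \<in> \<Lambda>"
  then obtain m n m' n' where
    "a = of_int m + of_int n * \<tau>" "b = of_int m' + of_int n' * \<tau>"
    by (auto simp: period_lattice_def)
  hence "a + b = of_int (m + m') + of_int (n + n') * \<tau>"
    by (simp add: algebra_simps)
  thus ?thesis by (metis lattice_int)
qed

lemma lattice_uminus: "a \<in> \<Lambda> \<Longrightarrow> - a \<in> \<Lambda>"
proof -
  assume "a \<in> \<Lambda>"
  then obtain m n where "a = of_int m + of_int n * \<tau>"
    by (auto simp: period_lattice_def)
  hence "- a = of_int (-m) + of_int (-n) * \<tau>"
    by (simp add: algebra_simps)
  thus ?thesis by (metis lattice_int)
qed

lemma lattice_uminus_iff [simp]: "- a \<in> \<Lambda> \<longleftrightarrow> a \<in> \<Lambda>"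
  using lattice_uminus[of a] lattice_uminus[of "- a"] by auto

lemma lattice_add_iff: "b \<in> \<Lambda> \<Longrightarrow> a + b \<in> \<Lambda> \<longleftrightarrow> a \<in> \<Lambda>"
  using lattice_add[of a b] lattice_add[of "a + b" "- b"] by auto

lemma lattice_diff_iff: "b \<in> \<Lambda> \<Longrightarrow> a - b \<in> \<Lambda> \<longleftrightarrow> a \<in> \<Lambda>"
  using lattice_add_iff[of "- b" a] by simp

lemma lattice_add_1_iff [simp]: "a + 1 \<in> \<Lambda> \<longleftrightarrow> a \<in> \<Lambda>"
  and lattice_add_tau_iff [simp]: "a + \<tau> \<in> \<Lambda> \<longleftrightarrow> a \<in> \<Lambda>"
  by (simp_all add: lattice_add_iff)

lemma real_coordinates: "\<exists>s t :: real. z = of_real s + of_real t * \<tau>"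
proof (intro exI)
  show "z = of_real (Re z - Im z / Im \<tau> * Re \<tau>) + of_real (Im z / Im \<tau>) * \<tau>"
    using Im_pos by (simp add: complex_eq_iff)
qed

lemma real_coordinates_unique:
  fixes s t s' t' :: real
  assumes "of_real s + of_real t * \<tau> = of_real s' + of_real t' * \<tau>"
  shows "s = s'" "t = t'"
  using assms Im_pos by (auto simp: complex_eq_iff)

lemma real_coordinates_in_lattice_iff:
  "of_real s + of_real t * \<tau> \<in> \<Lambda> \<longleftrightarrow> s \<in> \<int> \<and> t \<in> \<int>"
proof
  assume "of_real s + of_real t * \<tau> \<in> \<Lambda>"
  then obtain m n :: int where
    "of_real s + of_real t * \<tau> = of_real (of_int m) + of_real (of_int n) * \<tau>"
    by (auto simp: period_lattice_def)
  from real_coordinates_unique[OF this] show "s \<in> \<int> \<and> t \<in> \<int>" by simp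
next
  assume "s \<in> \<int> \<and> t \<in> \<int>"
  then obtain m n where "s = of_int m" "t = of_int n" by (auto elim!: Ints_cases)
  thus "of_real s + of_real t * \<tau> \<in> \<Lambda>" using lattice_int[of m n] by simp
qed

lemma half_lattice:
  fixes m n :: int
  assumes "odd m \<or> odd n"
  shows "(of_int m + of_int n * \<tau>) / 2 \<notin> \<Lambda>"
proof
  assume "(of_int m + of_int n * \<tau>) / 2 \<in> \<Lambda>"
  moreover have "(of_int m + of_int n * \<tau>) / 2 = of_real (of_int m / 2) + of_real (of_int n / 2) * \<tau>"
    by (simp add: add_divide_distrib)
  ultimately have "of_int m / 2 \<in> (\<int> :: real set)" "of_int n / 2 \<in> (\<int> :: real set)"
    by (simp_all only: real_coordinates_in_lattice_iff)
  then obtain k l :: int where "real_of_int m / 2 = of_int k" "real_of_int n / 2 = of_int l"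
    by (auto elim!: Ints_cases)
  hence "real_of_int m = real_of_int (2 * k)" "real_of_int n = real_of_int (2 * l)" by simp_all
  hence "m = 2 * k" "n = 2 * l" unfolding of_int_eq_iff .
  thus False using assms by simp
qed

lemma half_not_in_lattice: "1 / 2 \<notin> \<Lambda>"
  using half_lattice[of 1 0] by simp

text \<open>The imaginary part controls \<open>n\<close>, and the triangle inequality then controls
  \<open>m\<close>. This gives both discreteness of the lattice and convergence of the Weierstrass
  series.\<close>

lemma lattice_norm_lower_bound:
  obtains c where "c > 0" "\<And>m n :: int. c * real_of_int (max \<bar>m\<bar> \<bar>n\<bar>) \<le> norm (of_int m + of_int n * \<tau>)"
proof -
  \<comment> \<open>\<open>C * x\<close> is the sum of the two bounds found below,
    \<open>x / Im \<tau>\<close> for \<open>n\<close> and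
    \<open>x + x / Im \<tau> * norm \<tau>\<close> for \<open>m\<close>.\<close>
  define C where "C = 1 + (1 + norm \<tau>) / Im \<tau>"
  have C: "C > 0" using Im_pos by (auto simp: C_def intro!: add_pos_nonneg divide_nonneg_pos)
  have "real_of_int (max \<bar>m\<bar> \<bar>n\<bar>) \<le> C * norm (of_int m + of_int n * \<tau>)" for m n :: int
  proof -
    define x where "x = norm (of_int m + of_int n * \<tau>)"
    have "\<bar>real_of_int n\<bar> * Im \<tau> = \<bar>Im (of_int m + of_int n * \<tau>)\<bar>"
      using Im_pos by (simp add: abs_mult)
    also have "\<dots> \<le> x" unfolding x_def by (rule abs_Im_le_cmod)
    finally have n: "\<bar>real_of_int n\<bar> \<le> x / Im \<tau>"
      using Im_pos by (simp add: field_simps)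
    have "\<bar>real_of_int m\<bar> = norm ((of_int m + of_int n * \<tau>) - of_int n * \<tau>)"
      by simp
    also have "\<dots> \<le> x + \<bar>real_of_int n\<bar> * norm \<tau>"
      unfolding x_def by (rule order.trans[OF norm_triangle_ineq4]) (simp add: norm_mult)
    also have "\<dots> \<le> x + x / Im \<tau> * norm \<tau>"
      using n by (intro add_left_mono mult_right_mono) auto
    finally have m: "\<bar>real_of_int m\<bar> \<le> x + x / Im \<tau> * norm \<tau>" .
    have "C * x = x + x / Im \<tau> + x / Im \<tau> * norm \<tau>"
      using Im_pos by (simp add: C_def field_simps)
    moreover have "x \<ge> 0" "x / Im \<tau> \<ge> 0" "x / Im \<tau> * norm \<tau> \<ge> 0"
      using Im_pos by (simp_all add: x_def)
    ultimately show ?thesis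
      using m n unfolding x_def[symmetric] by (auto simp: max_def)
  qed
  hence "(1 / C) * real_of_int (max \<bar>m\<bar> \<bar>n\<bar>) \<le> norm (of_int m + of_int n * \<tau>)" for m n :: int
    using C by (simp add: field_simps)
  thus ?thesis using C that[of "1 / C"] by simp
qed

lemma lattice_discrete:
  obtains \<delta> where "\<delta> > 0" "\<And>a. a \<in> \<Lambda> \<Longrightarrow> norm a < \<delta> \<Longrightarrow> a = 0"
proof -
  obtain c where c: "c > 0"
    "\<And>m n :: int. c * real_of_int (max \<bar>m\<bar> \<bar>n\<bar>) \<le> norm (of_int m + of_int n * \<tau>)"
    by (rule lattice_norm_lower_bound) blast
  have "a = 0" if "a \<in> \<Lambda>" "norm a < c" for a
  proof -
    from that(1) obtain m n where a: "a = of_int m + of_int n * \<tau>"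
      by (auto simp: period_lattice_def)
    have "c * real_of_int (max \<bar>m\<bar> \<bar>n\<bar>) < c * 1"
      using c(2)[of m n] that(2) unfolding a by linarith
    hence "max \<bar>m\<bar> \<bar>n\<bar> < 1" using c(1) by simp
    thus "a = 0" by (simp add: a)
  qed
  thus ?thesis using c(1) that by blast
qed

lemma closed_lattice: "closed \<Lambda>"
proof -
  obtain \<delta> where \<delta>: "\<delta> > 0" "\<And>a. a \<in> \<Lambda> \<Longrightarrow> norm a < \<delta> \<Longrightarrow> a = 0"
    by (rule lattice_discrete) blast
  show ?thesis
  proof (rule discrete_imp_closed[OF \<delta>(1)], intro ballI impI)
    fix x y assume "x \<in> \<Lambda>" "y \<in> \<Lambda>" "dist y x < \<delta>"
    thus "y = x" using \<delta>(2)[of "y - x"] by (simp add: dist_norm lattice_diff_iff)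
  qed
qed

lemma open_Compl_lattice: "open (- \<Lambda>)"
  using closed_lattice by auto

lemma countable_lattice: "countable \<Lambda>"
proof -
  have "\<Lambda> = (\<lambda>(m, n). of_int m + of_int n * \<tau>) ` (UNIV :: (int \<times> int) set)"
    by (auto simp: period_lattice_def)
  thus ?thesis by (metis countable_image countableI_type)
qed

lemma connected_Compl_lattice: "connected (- \<Lambda>)"
  by (intro path_connected_imp_connected path_connected_complement_countable countable_lattice) simp

text \<open>Rounding down both real coordinates leaves a point of the fundamental parallelogram; its
  norm bound is what makes a function with periodic modulus bounded.\<close>

lemma fundamental_domain:
  obtains a where "a \<in> \<Lambda>" "norm (z - a) \<le> 1 + norm \<tau>"
proof -
  obtain s t :: real where z: "z = of_real s + of_real t * \<tau>"
    using real_coordinates by blast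
  define a where "a = of_int \<lfloor>s\<rfloor> + of_int \<lfloor>t\<rfloor> * \<tau>"
  have "z - a = of_real (frac s) + of_real (frac t) * \<tau>"
    by (simp add: z a_def frac_def algebra_simps)
  hence "norm (z - a) \<le> frac s + frac t * norm \<tau>"
    using norm_triangle_ineq[of "of_real (frac s)" "of_real (frac t) * \<tau>"]
    by (simp add: norm_mult)
  also have "\<dots> \<le> 1 + 1 * norm \<tau>"
    using frac_lt_1[of s] frac_lt_1[of t] by (intro add_mono mult_right_mono) auto
  finally show ?thesis using that[of a] by (simp add: a_def)
qed

lemma eventually_not_in_lattice: "eventually (\<lambda>z. z \<notin> \<Lambda>) (at a)"
proof (cases "a \<in> \<Lambda>")
  case True
  obtain \<delta> where \<delta>: "\<delta> > 0" "\<And>a. a \<in> \<Lambda> \<Longrightarrow> norm a < \<delta> \<Longrightarrow> a = 0"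
    by (rule lattice_discrete) blast
  have "z \<notin> \<Lambda>" if "z \<noteq> a" "dist z a < \<delta>" for z
    using \<delta>(2)[of "z - a"] that True by (auto simp: dist_norm lattice_diff_iff)
  thus ?thesis unfolding eventually_at using \<delta>(1) by auto
next
  case False
  thus ?thesis
    using open_Compl_lattice eventually_at_in_open'[of "- \<Lambda>" a] by simp
qed

lemma lattice_of_int_mult: "p \<in> \<Lambda> \<Longrightarrow> of_int i * p \<in> \<Lambda>"
proof -
  assume "p \<in> \<Lambda>"
  then obtain m n where "p = of_int m + of_int n * \<tau>"
    by (auto simp: period_lattice_def)
  hence "of_int i * p = of_int (i * m) + of_int (i * n) * \<tau>" by (simp add: algebra_simps)
  thus ?thesis by (metis lattice_int)
qed

section \<open>Liouville's theorem for functions with sign multipliers\<close>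

text \<open>Induction in both directions from 0. The downward step also multiplies by \<epsilon>,
  because a sign is its own inverse.\<close>

lemma sign_multiplier_int:
  fixes f :: "complex \<Rightarrow> complex"
  assumes p: "p \<in> \<Lambda>" and f: "\<And>z. z \<notin> \<Lambda> \<Longrightarrow> f (z + p) = \<epsilon> * f z" and \<epsilon>: "\<epsilon> \<in> {1, -1}"
  shows "\<exists>e\<in>{1, -1}. \<forall>z. z \<notin> \<Lambda> \<longrightarrow> f (z + of_int k * p) = e * f z"
proof (induction k rule: int_induct[where k = 0])
  case base
  show ?case by (intro bexI[of _ 1]) auto
next
  case (step1 i)
  from step1 obtain e where e: "e \<in> {1, -1}"
    "\<And>z. z \<notin> \<Lambda> \<Longrightarrow> f (z + of_int i * p) = e * f z" by blast
  have "f (z + of_int (i + 1) * p) = (\<epsilon> * e) * f z" if "z \<notin> \<Lambda>" for z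
    using f[of "z + of_int i * p"] e(2)[OF that] that lattice_add_iff[OF lattice_of_int_mult[OF p], of z i]
    by (simp add: algebra_simps)
  thus ?case using e(1) \<epsilon> by (intro bexI[of _ "\<epsilon> * e"]) auto
next
  case (step2 i)
  from step2 obtain e where e: "e \<in> {1, -1}"
    "\<And>z. z \<notin> \<Lambda> \<Longrightarrow> f (z + of_int i * p) = e * f z" by blast
  have "f (z + of_int (i - 1) * p) = (\<epsilon> * e) * f z" if "z \<notin> \<Lambda>" for z
    using f[of "z + of_int (i - 1) * p"] e(2)[OF that] that
      lattice_add_iff[OF lattice_of_int_mult[OF p], of z "i - 1"] \<epsilon>
    by (auto simp: algebra_simps)
  thus ?case using e(1) \<epsilon> by (intro bexI[of _ "\<epsilon> * e"]) auto
qed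

text \<open>The limit hypothesis makes the singularity at 0 removable. Transporting the extension
  along the lattice gives an entire function; as the multipliers have modulus one, its modulus is
  periodic, hence bounded by its maximum over a disc containing a representative of every point
  modulo the lattice.\<close>

lemma elliptic_Liouville:
  fixes f :: "complex \<Rightarrow> complex"
  assumes hol: "f holomorphic_on - \<Lambda>"
    and f1: "\<And>z. z \<notin> \<Lambda> \<Longrightarrow> f (z + 1) = \<epsilon> * f z" and \<epsilon>: "\<epsilon> \<in> {1, -1}"
    and f2: "\<And>z. z \<notin> \<Lambda> \<Longrightarrow> f (z + \<tau>) = \<eta> * f z" and \<eta>: "\<eta> \<in> {1, -1}"
    and lim: "((\<lambda>z. z * f z) \<longlongrightarrow> 0) (at 0)"
  obtains c where "\<And>z. z \<notin> \<Lambda> \<Longrightarrow> f z = c"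
proof -
  obtain \<delta> where \<delta>: "\<delta> > 0" "\<And>a. a \<in> \<Lambda> \<Longrightarrow> norm a < \<delta> \<Longrightarrow> a = 0"
    by (rule lattice_discrete) blast
  have sub: "ball 0 \<delta> - {0} \<subseteq> - \<Lambda>" using \<delta>(2) by auto
  have "\<exists>h. h holomorphic_on ball 0 \<delta> \<and> (\<forall>z\<in>ball 0 \<delta> - {0}. h z = f z)"
    using holomorphic_on_extend_lim[of f "ball 0 \<delta>" 0] holomorphic_on_subset[OF hol sub] lim \<delta>(1)
    by simp
  then obtain h where h: "h holomorphic_on ball 0 \<delta>" "\<And>z. z \<in> ball 0 \<delta> - {0} \<Longrightarrow> h z = f z"
    by blast
  have "\<forall>a\<in>\<Lambda>. \<exists>e. e \<in> {1, -1} \<and> (\<forall>z. z \<notin> \<Lambda> \<longrightarrow> f (z + a) = e * f z)"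
  proof
    fix a assume a: "a \<in> \<Lambda>"
    obtain m n where a: "a = of_int m + of_int n * \<tau>"
      using a by (auto simp: period_lattice_def)
    have "\<exists>e\<in>{1, -1}. \<forall>z. z \<notin> \<Lambda> \<longrightarrow> f (z + of_int m * 1) = e * f z"
      by (rule sign_multiplier_int[OF lattice_1 _ \<epsilon>]) (rule f1)
    then obtain e where e: "e \<in> {1, -1}" "\<forall>z. z \<notin> \<Lambda> \<longrightarrow> f (z + of_int m * 1) = e * f z"
      by (elim bexE)
    have "\<exists>e\<in>{1, -1}. \<forall>z. z \<notin> \<Lambda> \<longrightarrow> f (z + of_int n * \<tau>) = e * f z"
      by (rule sign_multiplier_int[OF lattice_tau _ \<eta>]) (rule f2)
    then obtain e' where e': "e' \<in> {1, -1}" "\<forall>z. z \<notin> \<Lambda> \<longrightarrow> f (z + of_int n * \<tau>) = e' * f z"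
      by (elim bexE)
    have "f (z + a) = (e * e') * f z" if "z \<notin> \<Lambda>" for z
    proof -
      have "z + of_int n * \<tau> \<notin> \<Lambda>"
        using that lattice_add_iff[OF lattice_int[of 0 n]] by simp
      thus ?thesis using e(2)[rule_format, of "z + of_int n * \<tau>"] e'(2)[rule_format, OF that]
        by (simp add: a algebra_simps)
    qed
    moreover have "e * e' \<in> {1, -1}" using e(1) e'(1) by auto
    ultimately show "\<exists>e. e \<in> {1, -1} \<and> (\<forall>z. z \<notin> \<Lambda> \<longrightarrow> f (z + a) = e * f z)" by blast
  qed
  from bchoice[OF this] obtain e :: "complex \<Rightarrow> complex" where
    e_all: "\<forall>a\<in>\<Lambda>. e a \<in> {1, -1} \<and> (\<forall>z. z \<notin> \<Lambda> \<longrightarrow> f (z + a) = e a * f z)" ..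
  have e: "\<And>a. a \<in> \<Lambda> \<Longrightarrow> e a \<in> {1, -1}"
    "\<And>a z. a \<in> \<Lambda> \<Longrightarrow> z \<notin> \<Lambda> \<Longrightarrow> f (z + a) = e a * f z"
    using e_all by simp_all
  have norm_e: "norm (e a) = 1" if "a \<in> \<Lambda>" for a using e(1)[OF that] by auto
  \<comment> \<open>At a lattice point the missing value is the one at 0, carried over by the
    multiplier of that period; \<open>h\<close> is the holomorphic extension of \<open>f\<close>
    near 0.\<close>
  define g where "g z = (if z \<in> \<Lambda> then e z * h 0 else f z)" for z
  have diff: "g field_differentiable (at z)" for z
  proof (cases "z \<in> \<Lambda>")
    case False
    have "f field_differentiable (at z)"
      using hol False open_Compl_lattice by (auto simp: holomorphic_on_open field_differentiable_def)
    then obtain D where "(f has_field_derivative D) (at z)" by (auto simp: field_differentiable_def)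
    moreover have "f w = g w" if "w \<in> - \<Lambda>" for w using that by (simp add: g_def)
    ultimately have "(g has_field_derivative D) (at z)"
      using False open_Compl_lattice
      by (elim has_field_derivative_transform_within_open[where S = "- \<Lambda>"]) auto
    thus ?thesis by (auto simp: field_differentiable_def)
  next
    case True
    have "h field_differentiable (at 0)"
      using h(1) \<delta>(1) by (auto simp: holomorphic_on_open field_differentiable_def)
    then obtain D where D: "(h has_field_derivative D) (at (z - z))"
      by (auto simp: field_differentiable_def)
    have "((\<lambda>w. h (w + (- z))) has_field_derivative D) (at z)"
      using D by (subst DERIV_shift[symmetric]) simp
    hence "((\<lambda>w. e z * h (w - z)) has_field_derivative (e z * D)) (at z)"
      by (intro DERIV_cmult) simp
    moreover have "e z * h (w - z) = g w" if "w \<in> ball z \<delta>" for w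
    proof (cases "w = z")
      case True
      thus ?thesis using \<open>z \<in> \<Lambda>\<close> by (simp add: g_def)
    next
      case False
      have "w - z \<in> ball 0 \<delta> - {0}" using that False by (auto simp: dist_norm norm_minus_commute)
      moreover from this sub have nz: "w - z \<notin> \<Lambda>" by blast
      moreover have "w \<notin> \<Lambda>" using nz \<open>z \<in> \<Lambda>\<close> by (simp add: lattice_diff_iff)
      ultimately show ?thesis using e(2)[OF \<open>z \<in> \<Lambda>\<close> nz] h(2)[of "w - z"] unfolding g_def by simp
    qed
    ultimately have "(g has_field_derivative (e z * D)) (at z)"
      using \<delta>(1)
      by (elim has_field_derivative_transform_within_open[where S = "ball z \<delta>"]) auto
    thus ?thesis by (auto simp: field_differentiable_def)
  qed
  hence holg: "g holomorphic_on UNIV" by (auto simp: holomorphic_on_def field_differentiable_at_within)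
  have "compact (g ` cball 0 (1 + norm \<tau>))"
    using holomorphic_on_imp_continuous_on[OF holg]
    by (intro compact_continuous_image compact_cball) (auto intro: continuous_on_subset)
  then obtain B where B: "\<And>z. norm z \<le> 1 + norm \<tau> \<Longrightarrow> norm (g z) \<le> B"
    by (force dest: compact_imp_bounded simp: bounded_iff)
  have "norm (g z) \<le> B" for z
  proof (cases "z \<in> \<Lambda>")
    case True
    hence "norm (g z) = norm (g 0)" by (simp add: g_def norm_mult norm_e)
    thus ?thesis using B[of 0] by simp
  next
    case False
    obtain a where a: "a \<in> \<Lambda>" "norm (z - a) \<le> 1 + norm \<tau>" by (rule fundamental_domain)
    have "z - a \<notin> \<Lambda>" using a False by (simp add: lattice_diff_iff)
    hence "norm (g z) = norm (g (z - a))"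
      using e(2)[OF a(1), of "z - a"] False by (simp add: g_def norm_mult norm_e[OF a(1)])
    thus ?thesis using B[OF a(2)] by simp
  qed
  hence "bounded (range g)" by (auto simp: bounded_iff)
  with holg have "g constant_on UNIV" by (rule Liouville_theorem)
  then obtain c where "\<And>z. g z = c" by (auto simp: constant_on_def)
  thus ?thesis using that[of c] by (metis g_def)
qed

text \<open>A constant with a multiplier -1 equals its own negative.\<close>

lemma elliptic_Liouville_zero:
  fixes f :: "complex \<Rightarrow> complex"
  assumes hol: "f holomorphic_on - \<Lambda>"
    and f1: "\<And>z. z \<notin> \<Lambda> \<Longrightarrow> f (z + 1) = \<epsilon> * f z" and \<epsilon>: "\<epsilon> \<in> {1, -1}"
    and f2: "\<And>z. z \<notin> \<Lambda> \<Longrightarrow> f (z + \<tau>) = \<eta> * f z" and \<eta>: "\<eta> \<in> {1, -1}"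
    and lim: "((\<lambda>z. z * f z) \<longlongrightarrow> 0) (at 0)"
    and nontrivial: "\<epsilon> = -1 \<or> \<eta> = -1"
    and z: "z \<notin> \<Lambda>"
  shows "f z = 0"
proof -
  obtain c where c: "\<And>z. z \<notin> \<Lambda> \<Longrightarrow> f z = c"
    using elliptic_Liouville[OF hol f1 \<epsilon> f2 \<eta> lim] by blast
  have "c = -c" using nontrivial f1[OF z] f2[OF z] c z by auto
  thus ?thesis using c[OF z] by simp
qed

text \<open>The limit hypothesis leaves at most a simple pole at 0. Then \<open>z * f z\<close>
  extends to an odd holomorphic function, which must vanish at 0, so the simple pole is excluded as
  well.\<close>

lemma even_removable:
  fixes f :: "complex \<Rightarrow> complex"
  assumes hol: "f holomorphic_on - \<Lambda>" and even: "\<And>z. z \<notin> \<Lambda> \<Longrightarrow> f (- z) = f z"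
    and lim: "((\<lambda>z. z\<^sup>2 * f z) \<longlongrightarrow> 0) (at 0)"
  shows "((\<lambda>z. z * f z) \<longlongrightarrow> 0) (at 0)"
proof -
  obtain \<delta> where \<delta>: "\<delta> > 0" "\<And>a. a \<in> \<Lambda> \<Longrightarrow> norm a < \<delta> \<Longrightarrow> a = 0"
    by (rule lattice_discrete) blast
  have sub: "ball 0 \<delta> - {0} \<subseteq> - \<Lambda>" using \<delta>(2) by auto
  have "(\<lambda>z. z * f z) holomorphic_on ball 0 \<delta> - {0}"
    using holomorphic_on_subset[OF hol sub] by (intro holomorphic_intros)
  moreover have "((\<lambda>z. (z - 0) * (z * f z)) \<longlongrightarrow> 0) (at 0)"
    using lim by (simp add: power2_eq_square mult.assoc)
  ultimately obtain g where g: "g holomorphic_on ball 0 \<delta>"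
    "\<And>z. z \<in> ball 0 \<delta> - {0} \<Longrightarrow> g z = z * f z"
    using holomorphic_on_extend_lim[of "\<lambda>z. z * f z" "ball 0 \<delta>" 0] \<delta>(1) by auto
  have "isCont g 0"
    using holomorphic_on_imp_continuous_on[OF g(1)] \<delta>(1) by (simp add: continuous_on_eq_continuous_at)
  hence g0: "(g \<longlongrightarrow> g 0) (at 0)" by (simp add: isCont_def)
  have ev: "eventually (\<lambda>z. z \<in> ball 0 \<delta> - {0}) (at (0::complex))"
    using \<delta>(1) by (auto simp: eventually_at intro!: exI[of _ \<delta>])
  have "((\<lambda>z. g (- z)) \<longlongrightarrow> g 0) (at 0)"
    using \<open>isCont g 0\<close> by (intro isCont_tendsto_compose[of 0 g] ) (auto intro!: tendsto_eq_intros)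
  moreover have "eventually (\<lambda>z. g (- z) = - g z) (at 0)"
    using ev
  proof eventually_elim
    case (elim z)
    hence "z \<notin> \<Lambda>" using sub by blast
    thus ?case using g(2)[of z] g(2)[of "- z"] even[of z] elim by simp
  qed
  ultimately have "((\<lambda>z. - g z) \<longlongrightarrow> g 0) (at 0)"
    using tendsto_cong by force
  with tendsto_minus[OF g0] have "- g 0 = g 0"
    using tendsto_unique[of "at (0::complex)"] by (metis at_neq_bot)
  hence "g 0 = 0" by simp
  with g0 have "(g \<longlongrightarrow> 0) (at 0)" by simp
  moreover have "eventually (\<lambda>z. g z = z * f z) (at 0)"
    using ev by eventually_elim (use g(2) in auto)
  ultimately show ?thesis using tendsto_cong by force
qed

end

section \<open>Theta series\<close>

text \<open>The integers are split into the nonnegative ones and their images under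
  \<open>j \<mapsto> - 1 - j\<close>. This reflection preserves the absolute value of
  \<open>j + 1/2\<close>, the variable in which the theta series decays.\<close>

lemma summable_on_int:
  fixes f :: "int \<Rightarrow> real"
  assumes "\<And>j. f j \<ge> 0" "summable (\<lambda>n. f (int n))" "summable (\<lambda>n. f (- 1 - int n))"
  shows "f summable_on UNIV"
proof -
  have UN: "(UNIV :: int set) = range int \<union> range (\<lambda>n. - 1 - int n)"
  proof (intro equalityI subsetI)
    fix j :: int
    show "j \<in> range int \<union> range (\<lambda>n. - 1 - int n)"
      by (cases "j \<ge> 0") (auto simp: image_iff intro: exI[of _ "nat j"] exI[of _ "nat (- 1 - j)"])
  qed auto
  have "f summable_on range int"
    using assms by (subst summable_on_reindex)
      (auto simp: o_def inj_on_def intro!: norm_summable_imp_summable_on)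
  moreover have "f summable_on range (\<lambda>n. - 1 - int n)"
    using assms by (subst summable_on_reindex)
      (auto simp: o_def inj_on_def intro!: norm_summable_imp_summable_on)
  ultimately show ?thesis
    unfolding UN by (rule summable_on_Un_disjoint) auto
qed

text \<open>The index \<open>k\<close> counts derivatives in \<open>z\<close>, each of which brings
  down one factor in front of the exponential. Treating all orders at once lets the time derivative
  appear as order \<open>k + 2\<close>.\<close>

definition theta_term :: "nat \<Rightarrow> complex \<Rightarrow> complex \<Rightarrow> int \<Rightarrow> complex" where
  "theta_term k z \<tau> j = (2 * of_real pi * \<i> * (of_int j + 1 / 2)) ^ k *
     exp (of_real pi * \<i> * (of_int j + 1/2)\<^sup>2 * \<tau> + 2 * of_real pi * \<i> * (of_int j + 1/2) * (z + 1/2))"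

definition theta_series :: "nat \<Rightarrow> complex \<Rightarrow> complex \<Rightarrow> complex" where
  "theta_series k z \<tau> = (\<Sum>\<^sub>\<infinity>j. theta_term k z \<tau> j)"

text \<open>A majorant depending on \<tau> and \<open>z\<close> only through a lower bound
  \<open>t\<close> of \<open>Im \<tau>\<close> and an upper bound \<open>R\<close> of the absolute
  value of \<open>Im z\<close>, hence uniform on neighbourhoods. It is geometric on each half of the
  integers.\<close>

definition theta_bound :: "nat \<Rightarrow> real \<Rightarrow> real \<Rightarrow> int \<Rightarrow> real" where
  "theta_bound k t R j = fact k * exp ((2 * pi * (R + 1) + 1)\<^sup>2 / (4 * (pi * t))) * exp (- \<bar>of_int j + 1 / 2\<bar>)"

text \<open>The power is absorbed by an exponential, since one term of the exponential series is at
  most its sum. The Gaussian factor then dominates every linear exponent.\<close>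

lemma norm_theta_term_le:
  assumes t: "t > 0" "Im \<tau> \<ge> t" and R: "\<bar>Im z\<bar> \<le> R"
  shows "norm (theta_term k z \<tau> j) \<le> theta_bound k t R j"
proof -
  define x :: real where "x = of_int j + 1 / 2"
  \<comment> \<open>The summand \<open>2 * pi * R\<close> comes from \<open>z\<close>, a further
    \<open>2 * pi\<close> from the power, and the last 1 is reserved for the decay factor of the
    majorant.\<close>
  define c where "c = 2 * pi * (R + 1) + 1"
  have x: "of_int j + 1 / 2 = complex_of_real x" by (simp add: x_def)
  have "norm (theta_term k z \<tau> j) = (2 * pi * \<bar>x\<bar>) ^ k * exp (- (pi * x\<^sup>2 * Im \<tau>) - 2 * pi * x * Im z)"
    unfolding theta_term_def x
    by (simp add: norm_mult norm_power power2_eq_square algebra_simps)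
  also have "\<dots> \<le> (fact k * exp (2 * pi * \<bar>x\<bar>)) * exp (- (pi * t * x\<^sup>2) + 2 * pi * R * \<bar>x\<bar>)"
  proof (intro mult_mono)
    have "(\<Sum>n\<in>{k}. (2 * pi * \<bar>x\<bar>) ^ n / fact n) \<le> (\<Sum>n. (2 * pi * \<bar>x\<bar>) ^ n / fact n)"
      using summable_exp[of "2 * pi * \<bar>x\<bar>"] by (intro sum_le_suminf) (auto simp: field_simps)
    hence "(2 * pi * \<bar>x\<bar>) ^ k / fact k \<le> exp (2 * pi * \<bar>x\<bar>)"
      by (simp add: exp_def field_simps)
    thus "(2 * pi * \<bar>x\<bar>) ^ k \<le> fact k * exp (2 * pi * \<bar>x\<bar>)"
      by (simp add: field_simps)
    have "t * x\<^sup>2 \<le> Im \<tau> * x\<^sup>2" using t by (intro mult_right_mono) auto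
    moreover have "- (x * Im z) \<le> R * \<bar>x\<bar>"
    proof -
      have "- (x * Im z) \<le> \<bar>x\<bar> * \<bar>Im z\<bar>" by (metis abs_ge_minus_self abs_mult)
      also have "\<dots> \<le> \<bar>x\<bar> * R" using R by (intro mult_left_mono) auto
      finally show ?thesis by (simp add: mult.commute)
    qed
    ultimately have "pi * (t * x\<^sup>2) \<le> pi * (Im \<tau> * x\<^sup>2)" "pi * (- (x * Im z)) \<le> pi * (R * \<bar>x\<bar>)"
      by (intro mult_left_mono; simp)+
    moreover have "pi * x\<^sup>2 * Im \<tau> = pi * (Im \<tau> * x\<^sup>2)" "2 * pi * x * Im z = - 2 * (pi * (- (x * Im z)))"
      "pi * t * x\<^sup>2 = pi * (t * x\<^sup>2)" "2 * pi * R * \<bar>x\<bar> = 2 * (pi * (R * \<bar>x\<bar>))" by simp_all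
    ultimately have "- (pi * x\<^sup>2 * Im \<tau>) - 2 * pi * x * Im z \<le> - (pi * t * x\<^sup>2) + 2 * pi * R * \<bar>x\<bar>"
      by linarith
    thus "exp (- (pi * x\<^sup>2 * Im \<tau>) - 2 * pi * x * Im z) \<le> exp (- (pi * t * x\<^sup>2) + 2 * pi * R * \<bar>x\<bar>)"
      by simp
  qed auto
  also have "\<dots> = fact k * exp (c * \<bar>x\<bar> - pi * t * x\<^sup>2 - \<bar>x\<bar>)"
    by (simp add: c_def algebra_simps flip: exp_add)
  also have "\<dots> \<le> fact k * exp (c\<^sup>2 / (4 * (pi * t)) - \<bar>x\<bar>)"
  proof -
    define a where "a = pi * t"
    have a: "a > 0" using t by (simp add: a_def)
    \<comment> \<open>Completing the square bounds the exponent uniformly in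
      \<open>x\<close>.\<close>
    have "0 \<le> (2 * a * \<bar>x\<bar> - c)\<^sup>2 / (4 * a)" using a by simp
    also have "\<dots> = a * x\<^sup>2 - c * \<bar>x\<bar> + c\<^sup>2 / (4 * a)"
      using a by (simp add: power2_diff power_mult_distrib field_simps) (simp add: power2_eq_square)
    finally show ?thesis by (simp add: a_def mult_ac)
  qed
  finally show ?thesis
    by (simp add: theta_bound_def c_def x_def mult.assoc flip: exp_add)
qed

lemma theta_bound_summable: "theta_bound k t R summable_on UNIV"
proof (rule summable_on_int)
  have eq: "theta_bound k t R (int n) = theta_bound k t R 0 * exp (- 1) ^ n"
      "theta_bound k t R (- 1 - int n) = theta_bound k t R 0 * exp (- 1) ^ n" for n
    by (simp_all add: theta_bound_def flip: exp_of_nat_mult exp_add)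
  have "summable (\<lambda>n. theta_bound k t R 0 * exp (- 1) ^ n)"
    by (intro summable_mult summable_geometric) auto
  thus "summable (\<lambda>n. theta_bound k t R (int n))" "summable (\<lambda>n. theta_bound k t R (- 1 - int n))"
    by (simp_all add: eq)
qed (simp add: theta_bound_def)

lemma has_sum_theta_series:
  assumes "Im \<tau> > 0"
  shows "(theta_term k z \<tau> has_sum theta_series k z \<tau>) UNIV"
proof -
  have "(\<lambda>j. norm (theta_term k z \<tau> j)) summable_on UNIV"
    by (rule Infinite_Sum.abs_summable_on_comparison_test'[OF theta_bound_summable])
       (use assms in \<open>auto intro!: norm_theta_term_le\<close>)
  thus ?thesis unfolding theta_series_def by (rule has_sum_infsum[OF abs_summable_summable])
qed

text \<open>The heat equation for a single term: in the exponent, the coefficient of \<tau> is the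
  square of the coefficient of \<open>z\<close> divided by 4\<pi>\<i>. Differentiating along an
  arbitrary line covers the \<open>z\<close>-derivative, the \<tau>-derivative, and the case of an
  argument that moves with \<tau>, as a half period does.\<close>

lemma has_field_derivative_theta_term:
  "((\<lambda>s. theta_term k (a + h * s) (b + g * s) j) has_field_derivative
     h * theta_term (Suc k) (a + h * s) (b + g * s) j
     + g / (4 * of_real pi * \<i>) * theta_term (Suc (Suc k)) (a + h * s) (b + g * s) j) (at s)"
proof -
  define x :: complex where "x = of_int j + 1 / 2"
  define c where "c = 2 * of_real pi * \<i> * x"
  define E where "E s = of_real pi * \<i> * x\<^sup>2 * (b + g * s) + c * (a + h * s + 1/2)" for s
  have E: "theta_term k (a + h * s) (b + g * s) j = c ^ k * exp (E s)" for k s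
    by (simp add: theta_term_def E_def c_def x_def)
  have c2: "c\<^sup>2 = (of_real pi * \<i> * x\<^sup>2) * (4 * of_real pi * \<i>)"
    unfolding c_def by (simp add: power2_eq_square)
  have "(4 * of_real pi * \<i>) \<noteq> 0" by simp
  hence eq: "of_real pi * \<i> * x\<^sup>2 * g + c * h = h * c + g / (4 * of_real pi * \<i>) * c\<^sup>2"
    unfolding c2 by (simp add: mult_ac del: mult_eq_0_iff)
  have "(E has_field_derivative (of_real pi * \<i> * x\<^sup>2 * g + c * h)) (at s)"
    unfolding E_def by (rule derivative_eq_intros refl)+ simp
  hence "((\<lambda>s. c ^ k * exp (E s)) has_field_derivative
      c ^ k * (exp (E s) * (of_real pi * \<i> * x\<^sup>2 * g + c * h))) (at s)"
    by (intro DERIV_cmult DERIV_chain2[OF DERIV_exp])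
  thus ?thesis
    unfolding E eq by (simp add: ring_distribs power2_eq_square mult_ac)
qed

lemma has_field_derivative_theta_series:
  assumes "Im (b + g * s) > 0"
  shows "((\<lambda>s. theta_series k (a + h * s) (b + g * s)) has_field_derivative
     h * theta_series (Suc k) (a + h * s) (b + g * s)
     + g / (4 * of_real pi * \<i>) * theta_series (Suc (Suc k)) (a + h * s) (b + g * s)) (at s)"
proof -
  \<comment> \<open>\<open>t\<close> is half of the imaginary part at the centre, and
    \<open>r\<close> is small enough that the imaginary part drops by at most \<open>t\<close> on
    the disc. \<open>R\<close> bounds the imaginary part of the first argument there.\<close>
  define t where "t = Im (b + g * s) / 2"
  define r where "r = t / (norm g + 1)"
  define R where "R = \<bar>Im (a + h * s)\<bar> + norm h * r"
  have t: "t > 0" using assms by (simp add: t_def)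
  have r: "r > 0" using t by (simp add: r_def add_nonneg_pos)
  have bound: "norm (theta_term k (a + h * u) (b + g * u) j) \<le> theta_bound k t R j"
    if "u \<in> cball s r" for u j
  proof (rule norm_theta_term_le[OF t])
    have u: "norm (u - s) \<le> r" using that by (simp add: dist_norm norm_minus_commute)
    have "\<bar>Im (g * (u - s))\<bar> \<le> norm g * norm (u - s)"
      by (metis abs_Im_le_cmod norm_mult)
    also have "\<dots> \<le> norm g * r" using u by (intro mult_left_mono) auto
    also have "\<dots> = t * (norm g / (norm g + 1))" by (simp add: r_def)
    also have "\<dots> \<le> t * 1" using t by (intro mult_left_mono) (auto simp: divide_le_eq add_nonneg_pos)
    finally have "\<bar>Im (g * (u - s))\<bar> \<le> t" by simp
    moreover have "Im (b + g * u) = 2 * t + Im (g * (u - s))" by (simp add: t_def algebra_simps)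
    ultimately show "Im (b + g * u) \<ge> t" by linarith
    have "\<bar>Im (h * (u - s))\<bar> \<le> norm h * norm (u - s)"
      by (metis abs_Im_le_cmod norm_mult)
    also have "\<dots> \<le> norm h * r" using u by (intro mult_left_mono) auto
    finally have "\<bar>Im (h * (u - s))\<bar> \<le> norm h * r" .
    moreover have "Im (a + h * u) = Im (a + h * s) + Im (h * (u - s))" by (simp add: algebra_simps)
    ultimately show "\<bar>Im (a + h * u)\<bar> \<le> R" unfolding R_def by linarith
  qed
  have "((\<lambda>s. theta_series k (a + h * s) (b + g * s)) has_field_derivative
     (\<Sum>\<^sub>\<infinity>j. h * theta_term (Suc k) (a + h * s) (b + g * s) j
     + g / (4 * of_real pi * \<i>) * theta_term (Suc (Suc k)) (a + h * s) (b + g * s) j)) (at s)"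
    unfolding theta_series_def
    by (rule has_field_derivative_infsum[OF r has_field_derivative_theta_term bound theta_bound_summable])
  also have "(\<Sum>\<^sub>\<infinity>j. h * theta_term (Suc k) (a + h * s) (b + g * s) j
       + g / (4 * of_real pi * \<i>) * theta_term (Suc (Suc k)) (a + h * s) (b + g * s) j) =
     h * theta_series (Suc k) (a + h * s) (b + g * s)
     + g / (4 * of_real pi * \<i>) * theta_series (Suc (Suc k)) (a + h * s) (b + g * s)"
    by (intro infsumI has_sum_add has_sum_cmult_right has_sum_theta_series assms)
  finally show ?thesis .
qed

lemma has_field_derivative_theta_series_z:
  assumes "Im \<tau> > 0"
  shows "((\<lambda>z. theta_series k z \<tau>) has_field_derivative theta_series (Suc k) z \<tau>) (at z)"
  using has_field_derivative_theta_series[of \<tau> 0 z k 0 1] assms by simp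

lemma has_field_derivative_theta_series_tau:
  assumes "Im \<tau> > 0"
  shows "((\<lambda>t. theta_series k (a + h * t) t) has_field_derivative
     h * theta_series (Suc k) (a + h * \<tau>) \<tau>
     + theta_series (Suc (Suc k)) (a + h * \<tau>) \<tau> / (4 * of_real pi * \<i>)) (at \<tau>)"
  using has_field_derivative_theta_series[of 0 1 \<tau> k a h] assms by simp

lemma theta_eq_series: "theta z \<tau> = theta_series 0 z \<tau>"
  by (simp add: theta_def theta_series_def theta_term_def)

lemma theta_dz_eq_series: "Im \<tau> > 0 \<Longrightarrow> theta_dz z \<tau> = theta_series 1 z \<tau>"
  unfolding theta_dz_def theta_eq_series
  using has_field_derivative_theta_series_z[of \<tau> 0 z] by (intro DERIV_imp_deriv) simp

lemma theta_dtau_eq_series: "Im \<tau> > 0 \<Longrightarrow> theta_dtau z \<tau> = theta_series 2 z \<tau> / (4 * of_real pi * \<i>)"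
  unfolding theta_dtau_def theta_eq_series
  using has_field_derivative_theta_series_tau[of \<tau> 0 z 0]
  by (intro DERIV_imp_deriv) (simp add: numeral_2_eq_2)

section \<open>Parity and quasi-periodicity of the theta function and its derivatives\<close>

context modulus
begin

abbreviation \<theta> :: "nat \<Rightarrow> complex \<Rightarrow> complex" where "\<theta> k z \<equiv> theta_series k z \<tau>"

lemma DERIV_theta_series: "(\<theta> k has_field_derivative \<theta> (Suc k) z) (at z)"
  by (rule has_field_derivative_theta_series_z[OF Im_pos])

lemma DERIV_theta_series' [derivative_intros]:
  "(f has_field_derivative f') (at z) \<Longrightarrow>
     ((\<lambda>z. \<theta> k (f z)) has_field_derivative \<theta> (Suc k) (f z) * f') (at z)"
  by (rule DERIV_chain2[OF DERIV_theta_series])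

lemma holomorphic_theta_series [holomorphic_intros]:
  "f holomorphic_on A \<Longrightarrow> (\<lambda>z. \<theta> k (f z)) holomorphic_on A"
  using holomorphic_on_compose_gen[of f A "\<theta> k" UNIV] DERIV_theta_series
  by (auto simp: o_def holomorphic_on_open)

lemma isCont_theta_series [continuous_intros]: "isCont (\<theta> k) z"
  by (rule DERIV_isCont[OF DERIV_theta_series])

lemma exp_pi_i_odd: "exp (2 * of_real pi * \<i> * (of_int j + 1 / 2)) = -1"
proof -
  have "exp (2 * of_real pi * \<i> * (of_int j + 1 / 2)) = exp (2 * of_int j * of_real pi * \<i>) * exp (of_real pi * \<i>)"
    by (simp add: algebra_simps flip: exp_add)
  also have "exp (2 * of_int j * of_real pi * \<i>) = 1"
    using exp_integer_2pi[of "of_int j"] by simp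
  finally show ?thesis by simp
qed

lemma theta_series_add_1: "\<theta> k (z + 1) = - \<theta> k z"
proof -
  have "theta_term k (z + 1) \<tau> j = - theta_term k z \<tau> j" for j
  proof -
    define x :: complex where "x = of_int j + 1 / 2"
    have x: "of_int j + 1 / 2 = x" by (simp add: x_def)
    have "theta_term k (z + 1) \<tau> j = theta_term k z \<tau> j * exp (2 * of_real pi * \<i> * (of_int j + 1 / 2))"
      unfolding theta_term_def x by (simp add: algebra_simps flip: exp_add)
    thus ?thesis by (simp add: exp_pi_i_odd)
  qed
  thus ?thesis by (simp add: theta_series_def infsum_uminus)
qed

text \<open>The reflection \<open>j \<mapsto> - 1 - j\<close> negates the half-integer frequency.
  The shift of \<open>z\<close> by 1/2 in the series leaves one extra factor -1 beside the sign from
  the power.\<close>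

lemma theta_series_minus: "\<theta> k (- z) = (- 1) ^ Suc k * \<theta> k z"
proof -
  have "theta_term k (- z) \<tau> (-1 - j) = (- 1) ^ Suc k * theta_term k z \<tau> j" for j
  proof -
    define x :: complex where "x = of_int j + 1 / 2"
    have x: "of_int (- 1 - j) + 1 / 2 = - x" "of_int j + 1 / 2 = x" by (simp_all add: x_def)
    have "exp (of_real pi * \<i> * x\<^sup>2 * \<tau> + 2 * of_real pi * \<i> * x * (z + 1/2)) =
       exp (of_real pi * \<i> * (- x)\<^sup>2 * \<tau> + 2 * of_real pi * \<i> * (- x) * (- z + 1/2)) * exp (2 * of_real pi * \<i> * x)"
      by (simp add: algebra_simps flip: exp_add)
    also have "exp (2 * of_real pi * \<i> * x) = - 1" by (simp add: x_def exp_pi_i_odd)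
    finally show ?thesis
      unfolding theta_term_def x by (simp flip: power_mult_distrib) 
  qed
  hence eq: "theta_term k (- z) \<tau> (-1 - j) = (- 1) ^ Suc k * theta_term k z \<tau> j" for j by blast
  have "\<theta> k (- z) = (\<Sum>\<^sub>\<infinity>j. theta_term k (- z) \<tau> (- 1 - j))"
    unfolding theta_series_def
    by (rule infsum_reindex_bij_witness[of _ "\<lambda>j. - 1 - j" "\<lambda>j. - 1 - j"]) auto
  thus ?thesis unfolding eq
    by (simp add: theta_series_def infsum_cmult_right' infsum_uminus)
qed

lemma theta_series_0 [simp]: "\<theta> 0 0 = 0" and theta_series_2_0 [simp]: "\<theta> 2 0 = 0"
  using theta_series_minus[of 0 0] theta_series_minus[of 2 0] by simp_all

definition tau_factor :: "complex \<Rightarrow> complex" where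
  "tau_factor z = - exp (- (of_real pi * \<i> * \<tau>) - 2 * of_real pi * \<i> * z)"

lemma tau_factor_nonzero [simp]: "tau_factor z \<noteq> 0"
  by (simp add: tau_factor_def)

text \<open>Shifting the summation index by one completes the square in the exponent and lowers each
  frequency by 2\<pi>\<i>. The lower-order terms for the derivatives come from expanding powers of
  the lowered frequency.\<close>

lemma
  shows theta_add_tau: "\<theta> 0 (z + \<tau>) = tau_factor z * \<theta> 0 z"
    and theta1_add_tau: "\<theta> 1 (z + \<tau>) = tau_factor z * (\<theta> 1 z - 2 * of_real pi * \<i> * \<theta> 0 z)"
    and theta2_add_tau: "\<theta> 2 (z + \<tau>) = tau_factor z *
      (\<theta> 2 z - 4 * of_real pi * \<i> * \<theta> 1 z - 4 * of_real pi ^ 2 * \<theta> 0 z)"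
proof -
  have "theta_term k (z + \<tau>) \<tau> (j - 1) = tau_factor z *
     ((2 * of_real pi * \<i> * (of_int j + 1 / 2) - 2 * of_real pi * \<i>) ^ k * theta_term 0 z \<tau> j)" for k j
  proof -
    define x :: complex where "x = of_int j + 1 / 2"
    have x: "of_int (j - 1) + 1 / 2 = x - 1" "of_int j + 1 / 2 = x" by (simp_all add: x_def)
    have "exp (of_real pi * \<i> * (x - 1)\<^sup>2 * \<tau> + 2 * of_real pi * \<i> * (x - 1) * (z + \<tau> + 1/2)) =
       exp (- (of_real pi * \<i> * \<tau>) - 2 * of_real pi * \<i> * z) * exp (- (of_real pi * \<i>)) *
        exp (of_real pi * \<i> * x\<^sup>2 * \<tau> + 2 * of_real pi * \<i> * x * (z + 1/2))"
      unfolding exp_add[symmetric] by (rule arg_cong[where f = exp]) (simp add: field_simps power2_eq_square)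
    also have "exp (- (of_real pi * \<i>)) = - 1" by (simp add: exp_minus)
    finally show ?thesis
      unfolding theta_term_def x tau_factor_def by (simp add: algebra_simps)
  qed
  note shift = this
  have series: "\<theta> k (z + \<tau>) = (\<Sum>\<^sub>\<infinity>j. tau_factor z *
     ((2 * of_real pi * \<i> * (of_int j + 1 / 2) - 2 * of_real pi * \<i>) ^ k * theta_term 0 z \<tau> j))" for k
    unfolding theta_series_def shift[symmetric]
    by (rule infsum_reindex_bij_witness[of _ "\<lambda>j. j - 1" "\<lambda>j. j + 1"]) auto
  note hs = has_sum_theta_series[OF Im_pos, of _ z]
  note eqI = infsumI[OF has_sum_cmult_right]
  show "\<theta> 0 (z + \<tau>) = tau_factor z * \<theta> 0 z"
    unfolding series by (rule eqI) (use hs[of 0] in simp)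
  have "(2 * of_real pi * \<i> * (of_int j + 1 / 2) - 2 * of_real pi * \<i>) ^ 1 * theta_term 0 z \<tau> j
      = theta_term 1 z \<tau> j + (- (2 * of_real pi * \<i>)) * theta_term 0 z \<tau> j" for j
    by (simp add: theta_term_def algebra_simps)
  moreover have "\<theta> 1 z - 2 * of_real pi * \<i> * \<theta> 0 z = \<theta> 1 z + (- (2 * of_real pi * \<i>)) * \<theta> 0 z"
    by simp
  ultimately show "\<theta> 1 (z + \<tau>) = tau_factor z * (\<theta> 1 z - 2 * of_real pi * \<i> * \<theta> 0 z)"
    unfolding series by (simp only:) (intro eqI has_sum_add has_sum_cmult_right hs)
  have "(2 * of_real pi * \<i> * (of_int j + 1 / 2) - 2 * of_real pi * \<i>) ^ 2 * theta_term 0 z \<tau> j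
      = theta_term 2 z \<tau> j + ((- (4 * of_real pi * \<i>)) * theta_term 1 z \<tau> j
        + (- (4 * of_real pi ^ 2)) * theta_term 0 z \<tau> j)" for j
    by (simp add: theta_term_def field_simps power2_eq_square)
  moreover have "\<theta> 2 z - 4 * of_real pi * \<i> * \<theta> 1 z - 4 * of_real pi ^ 2 * \<theta> 0 z =
      \<theta> 2 z + ((- (4 * of_real pi * \<i>)) * \<theta> 1 z + (- (4 * of_real pi ^ 2)) * \<theta> 0 z)"
    by simp
  ultimately show "\<theta> 2 (z + \<tau>) = tau_factor z *
      (\<theta> 2 z - 4 * of_real pi * \<i> * \<theta> 1 z - 4 * of_real pi ^ 2 * \<theta> 0 z)"
    unfolding series by (simp only:) (intro eqI has_sum_add has_sum_cmult_right hs)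
qed

text \<open>The Fourier coefficient of \<open>exp (\<pi>\<i>z)\<close> does not vanish.\<close>

lemma theta_not_identically_zero: "\<exists>z. \<theta> 0 z \<noteq> 0"
proof (rule ccontr)
  assume "\<not> ?thesis"
  hence zero: "\<theta> 0 z = 0" for z by blast
  define A :: "int \<Rightarrow> complex" where
    "A j = exp (of_real pi * \<i> * (of_int j + 1/2)\<^sup>2 * \<tau> + of_real pi * \<i> * (of_int j + 1/2))" for j
  \<comment> \<open>Removing the factor \<open>exp (\<pi>\<i>y)\<close> turns the half-integer
    frequencies into integers, so that on the unit interval every term but that of index 0
    integrates to zero.\<close>
  define F :: "int \<Rightarrow> real \<Rightarrow> complex" where
    "F j y = exp (- (of_real pi * \<i> * of_real y)) * theta_term 0 (of_real y) \<tau> j" for j y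
  have F_eq: "F j y = A j * exp (2 * of_real pi * \<i> * of_int j * of_real y)" for j y
    unfolding F_def theta_term_def A_def power_0 mult_1_left exp_add[symmetric]
    by (rule arg_cong[where f = exp]) (simp add: field_simps)
  have int_F: "(F j has_integral (if j = 0 then A 0 else 0)) {0..1}" for j
  proof (cases "j = 0")
    case True
    thus ?thesis using has_integral_const_real[of "A 0" 0 1] by (simp add: F_eq[abs_def])
  next
    case False
    define c where "c = 2 * of_real pi * \<i> * of_int j"
    have c: "c \<noteq> 0" using False by (simp add: c_def)
    have "((\<lambda>y. exp (c * of_real y)) has_integral (exp (c * of_real 1) / c - exp (c * of_real 0) / c)) {0..1}"
    proof (rule fundamental_theorem_of_calculus)
      fix y :: real
      have "((\<lambda>w. exp (c * w) / c) has_field_derivative exp (c * of_real y)) (at (of_real y))"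
        using c by (auto intro!: derivative_eq_intros)
      from has_vector_derivative_real_field[OF this]
      show "((\<lambda>y. exp (c * of_real y) / c) has_vector_derivative exp (c * of_real y)) (at y within {0..1})" .
    qed simp
    moreover have "exp c = 1"
      unfolding c_def using exp_integer_2pi[of "of_int j"] by (simp add: mult_ac)
    ultimately have "((\<lambda>y. exp (c * of_real y)) has_integral 0) {0..1}" by simp
    hence "((\<lambda>y. A j * exp (c * of_real y)) has_integral (A j * 0)) {0..1}"
      by (rule has_integral_mult_right)
    thus ?thesis using False by (simp add: F_eq[abs_def] c_def)
  qed
  have "uniform_limit {0..1} (\<lambda>X y. \<Sum>j\<in>X. F j y) (\<lambda>y. \<Sum>\<^sub>\<infinity>j. F j y) (finite_subsets_at_top UNIV)"
  proof (rule Weierstrass_m_test_general[OF _ theta_bound_summable])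
    fix j y assume "y \<in> {0..1::real}"
    have "norm (F j y) = norm (theta_term 0 (of_real y) \<tau> j)"
      by (simp add: F_def norm_mult)
    also have "\<dots> \<le> theta_bound 0 (Im \<tau>) 0 j"
      using Im_pos by (intro norm_theta_term_le) auto
    finally show "norm (F j y) \<le> theta_bound 0 (Im \<tau>) 0 j" .
  qed
  moreover have "(\<Sum>\<^sub>\<infinity>j. F j y) = 0" for y
    using zero[of "of_real y"] by (simp add: F_def infsum_cmult_right' theta_series_def)
  ultimately have ulim: "uniform_limit {0..1} (\<lambda>X y. \<Sum>j\<in>X. F j y) (\<lambda>y. 0) (finite_subsets_at_top UNIV)"
    by simp
  have cont: "continuous_on {0..1} (\<lambda>y. \<Sum>j\<in>X. F j y)" for X
    unfolding F_eq by (intro continuous_intros)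
  obtain I J where IJ: "\<And>X. ((\<lambda>y. \<Sum>j\<in>X. F j y) has_integral I X) {0..1}"
    "((\<lambda>y. 0) has_integral J) {0..1::real}" "(I \<longlongrightarrow> J) (finite_subsets_at_top UNIV)"
    using uniform_limit_integral[OF ulim cont finite_subsets_at_top_neq_bot] by blast
  have J: "J = 0" using IJ(2) by (simp add: has_integral_0_eq)
  \<comment> \<open>Every partial sum containing index 0 has integral \<open>A 0\<close>, whereas
    the uniform limit has integral 0; but \<open>A 0\<close> is an exponential.\<close>
  have "eventually (\<lambda>X. I X = A 0) (finite_subsets_at_top UNIV)"
    unfolding eventually_finite_subsets_at_top
  proof (intro exI[of _ "{0}"] conjI allI impI)
    fix X :: "int set" assume X: "finite X \<and> {0} \<subseteq> X \<and> X \<subseteq> UNIV"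
    have "((\<lambda>y. \<Sum>j\<in>X. F j y) has_integral (\<Sum>j\<in>X. if j = 0 then A 0 else 0)) {0..1}"
      using X int_F by (intro has_integral_sum) auto
    with IJ(1)[of X] have "I X = (\<Sum>j\<in>X. if j = 0 then A 0 else 0)" by (rule has_integral_unique)
    thus "I X = A 0" using X by (simp add: sum.delta)
  qed auto
  hence "(I \<longlongrightarrow> A 0) (finite_subsets_at_top UNIV)" by (rule tendsto_eventually)
  hence "A 0 = 0" using IJ(3) J tendsto_unique finite_subsets_at_top_neq_bot by blast
  thus False by (simp add: A_def)
qed

end

section \<open>Zeros of the theta function\<close>

context modulus
begin

text \<open>The variable often written q; it is the square of the classical nome
  exp(\<pi>\<i>\<tau>).\<close>

definition nome :: complex where "nome = exp (2 * of_real pi * \<i> * \<tau>)"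

lemma norm_nome: "norm nome < 1"
  using Im_pos by (simp add: nome_def)

text \<open>The infinite q-Pochhammer symbol (y; q), an entire function of \<open>y\<close> with
  zeros at the inverse powers of \<open>nome\<close>.\<close>

definition qprod :: "complex \<Rightarrow> complex" where "qprod y = (\<Prod>n. 1 - nome ^ n * y)"

lemma qprod_summable: "summable (\<lambda>n. norm nome ^ n * R)"
  using norm_nome by (intro summable_mult2 summable_geometric) simp

lemma qprod_convergent: "convergent_prod (\<lambda>n. 1 - nome ^ n * y)"
proof (rule abs_convergent_prod_imp_convergent_prod)
  show "abs_convergent_prod (\<lambda>n. 1 - nome ^ n * y)"
    unfolding abs_convergent_prod_conv_summable
    using qprod_summable[of "norm y"] by (simp add: norm_mult norm_power)
qed

lemma qprod_uniform_limit:
  "uniform_limit (cball 0 R) (\<lambda>N y. \<Prod>n<N. 1 - nome ^ n * y) qprod sequentially"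
proof -
  have "uniformly_convergent_on (cball 0 R) (\<lambda>N y. \<Prod>n<N. 1 - nome ^ n * y)"
  proof (rule uniformly_convergent_on_prod')
    show "uniformly_convergent_on (cball 0 R) (\<lambda>N y. \<Sum>n<N. norm (1 - nome ^ n * y - 1))"
      by (rule Weierstrass_m_test'[OF _ qprod_summable[of R]])
         (simp add: norm_mult norm_power mult_left_mono)
  qed (auto intro!: continuous_intros)
  then obtain g where g: "uniform_limit (cball 0 R) (\<lambda>N y. \<Prod>n<N. 1 - nome ^ n * y) g sequentially"
    by (auto simp: uniformly_convergent_on_def)
  also have "?this \<longleftrightarrow> ?thesis"
  proof (intro uniform_limit_cong)
    fix y :: complex assume "y \<in> cball 0 R"
    with g have "(\<lambda>N. \<Prod>n<N. 1 - nome ^ n * y) \<longlonglongrightarrow> g y"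
      by (auto dest: tendsto_uniform_limitI)
    moreover have "(\<lambda>N. \<Prod>n<N. 1 - nome ^ n * y) \<longlonglongrightarrow> qprod y"
      using convergent_prod_LIMSEQ[OF qprod_convergent[of y]]
      unfolding qprod_def by (simp add: LIMSEQ_lessThan_iff_atMost)
    ultimately show "g y = qprod y" by (rule LIMSEQ_unique)
  qed auto
  finally show ?thesis .
qed

lemma holomorphic_qprod: "qprod holomorphic_on UNIV"
proof (rule holomorphic_uniform_sequence)
  fix y :: complex
  have "uniform_limit (cball y 1) (\<lambda>N y. \<Prod>n<N. 1 - nome ^ n * y) qprod sequentially"
    by (rule uniform_limit_on_subset[OF qprod_uniform_limit[of "norm y + 1"]])
       (simp add: cball_subset_cball_iff)
  thus "\<exists>d>0. cball y d \<subseteq> UNIV \<and>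
      uniform_limit (cball y d) (\<lambda>N y. \<Prod>n<N. 1 - nome ^ n * y) qprod sequentially"
    by (intro exI[of _ 1]) auto
qed (auto intro!: holomorphic_intros)

lemma holomorphic_qprod' [holomorphic_intros]:
  "f holomorphic_on A \<Longrightarrow> (\<lambda>z. qprod (f z)) holomorphic_on A"
  using holomorphic_on_compose_gen[of f A qprod UNIV] holomorphic_qprod by (simp add: o_def)

lemma isCont_qprod: "isCont qprod y"
  using holomorphic_on_imp_continuous_on[OF holomorphic_qprod] by (simp add: continuous_on_eq_continuous_at)

lemma qprod_rec: "qprod y = (1 - y) * qprod (nome * y)"
  using has_prod_ignore_initial_segment'[OF qprod_convergent[of y], of 1]
  by (simp add: has_prod_iff qprod_def mult_ac)

lemma qprod_zero: "qprod y = 0 \<Longrightarrow> \<exists>n. nome ^ n * y = 1"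
  using has_prod_eq_0_iff[OF convergent_prod_has_prod[OF qprod_convergent[of y]]]
  by (auto simp: qprod_def)

lemma exp_2pi_i_eq_1_iff: "exp (2 * of_real pi * \<i> * z) = 1 \<longleftrightarrow> z \<in> \<int>"
proof -
  have "exp (2 * of_real pi * \<i> * z) = 1 \<longleftrightarrow> Im z = 0 \<and> (\<exists>n::int. Re z = of_int n)"
    by (simp add: exp_eq_1 mult_ac)
  also have "\<dots> \<longleftrightarrow> (\<exists>n::int. z = of_int n)" by (auto simp: complex_eq_iff)
  finally show ?thesis by (auto elim: Ints_cases)
qed

text \<open>The right-hand side of Jacobi's triple product up to a constant factor. The sine
  accounts for the integer zeros, and the two products for the lattice points with negative and
  positive \<tau>-coordinate.\<close>

definition theta_product :: "complex \<Rightarrow> complex" where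
  "theta_product z = sin (of_real pi * z) * qprod (nome * exp (2 * of_real pi * \<i> * z))
     * qprod (nome * exp (- (2 * of_real pi * \<i> * z)))"

lemma holomorphic_theta_product [holomorphic_intros]: "theta_product holomorphic_on A"
  unfolding theta_product_def[abs_def] by (intro holomorphic_intros)

lemma qprod_exp_zero:
  assumes "qprod (nome * exp (2 * of_real pi * \<i> * z)) = 0"
  shows "z \<in> \<Lambda>"
proof -
  obtain n where "nome ^ n * (nome * exp (2 * of_real pi * \<i> * z)) = 1"
    using qprod_zero[OF assms] by blast
  hence "exp (2 * of_real pi * \<i> * (of_nat (Suc n) * \<tau> + z)) = 1"
    by (simp add: nome_def algebra_simps flip: exp_of_nat_mult exp_add)
  then obtain m where "of_nat (Suc n) * \<tau> + z = of_int m"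
    unfolding exp_2pi_i_eq_1_iff by (auto elim: Ints_cases)
  hence "z = of_int m + of_int (- int (Suc n)) * \<tau>" by (simp add: algebra_simps)
  thus ?thesis by (metis lattice_int)
qed

lemma theta_product_zero:
  assumes "theta_product z = 0"
  shows "z \<in> \<Lambda>"
proof -
  consider "sin (of_real pi * z) = 0" | "qprod (nome * exp (2 * of_real pi * \<i> * z)) = 0" |
    "qprod (nome * exp (2 * of_real pi * \<i> * (- z))) = 0"
    using assms by (auto simp: theta_product_def)
  thus ?thesis
  proof cases
    case 1
    then obtain n :: int where "of_real pi * z = of_real (of_int n * pi)"
      by (auto simp: sin_eq_0)
    hence "z = of_int n + of_int 0 * \<tau>" by (simp add: field_simps)
    thus ?thesis by (metis lattice_int)
  next
    case 2
    thus ?thesis by (rule qprod_exp_zero)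
  next
    case 3
    hence "- z \<in> \<Lambda>" by (rule qprod_exp_zero)
    thus ?thesis by simp
  qed
qed

lemma theta_product_add_1: "theta_product (z + 1) = - theta_product z"
proof -
  have "exp (2 * of_real pi * \<i> * (z + 1)) = exp (2 * of_real pi * \<i> * z)"
    using exp_2pi_i_eq_1_iff[of 1] by (simp add: ring_distribs exp_add)
  moreover from this have "exp (- (2 * of_real pi * \<i> * (z + 1))) = exp (- (2 * of_real pi * \<i> * z))"
    by (simp add: exp_minus)
  moreover have "sin (of_real pi * (z + 1)) = - sin (of_real pi * z)"
    by (simp add: ring_distribs sin_add flip: sin_of_real cos_of_real)
  ultimately show ?thesis by (simp add: theta_product_def)
qed

text \<open>The two factorisations split off the factors that the recursion of \<open>qprod\<close>
  absorbs into one product and releases from the other under a shift by \<tau>.\<close>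

lemma sin_pi_eq:
  "sin (of_real pi * z) = - exp (- (of_real pi * \<i> * z)) * (1 - exp (2 * of_real pi * \<i> * z)) / (2 * \<i>)"
  "sin (of_real pi * z) = exp (of_real pi * \<i> * z) * (1 - exp (- (2 * of_real pi * \<i> * z))) / (2 * \<i>)"
  by (simp_all add: sin_exp_eq algebra_simps flip: exp_add)

text \<open>With \<open>x = exp (2\<pi>\<i>z)\<close>, the shift multiplies \<open>x\<close> by
  \<open>nome\<close>. The sine then supplies \<open>1 - nome * x\<close>, which completes the first
  product, while the second product releases \<open>1 - 1 / x\<close>, which rebuilds the
  sine.\<close>

lemma theta_product_add_tau: "theta_product (z + \<tau>) = tau_factor z * theta_product z"
proof -
  define x where "x = exp (2 * of_real pi * \<i> * z)"
  have x: "exp (2 * of_real pi * \<i> * (z + \<tau>)) = nome * x" "exp (- (2 * of_real pi * \<i> * z)) = 1 / x"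
    "x \<noteq> 0" "nome \<noteq> 0"
    by (simp_all add: x_def nome_def exp_minus field_simps flip: exp_add)
  have x2: "exp (- (2 * of_real pi * \<i> * (z + \<tau>))) = 1 / (nome * x)"
    unfolding exp_minus x(1) by (simp add: divide_inverse)
  have "theta_product (z + \<tau>) = - exp (- (of_real pi * \<i> * (z + \<tau>))) / (2 * \<i>)
     * ((1 - nome * x) * qprod (nome * (nome * x))) * qprod (1 / x)"
    unfolding theta_product_def sin_pi_eq(1) x x2 using x(3,4) by simp
  also have "(1 - nome * x) * qprod (nome * (nome * x)) = qprod (nome * x)"
    using qprod_rec[of "nome * x"] by simp
  also have "qprod (1 / x) = (1 - 1 / x) * qprod (nome * (1 / x))"
    by (rule qprod_rec)
  also have "exp (- (of_real pi * \<i> * (z + \<tau>))) = - tau_factor z * exp (of_real pi * \<i> * z)"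
    by (simp add: tau_factor_def algebra_simps flip: exp_add)
  finally show ?thesis
    unfolding theta_product_def sin_pi_eq(2) x(1,2) x_def[symmetric] by simp
qed

lemma theta_product_limit:
  "((\<lambda>z. theta_product z / z) \<longlongrightarrow> of_real pi * (qprod nome)\<^sup>2) (at 0)"
proof -
  have "((\<lambda>z. sin (of_real pi * z)) has_field_derivative of_real pi) (at (0::complex))"
    by (auto intro!: derivative_eq_intros)
  hence "((\<lambda>z. sin (of_real pi * z) / z) \<longlongrightarrow> of_real pi) (at (0::complex))"
    by (simp add: DERIV_def)
  moreover have "isCont (\<lambda>z. qprod (nome * exp (2 * of_real pi * \<i> * z))) 0"
    by (intro isCont_o2[OF _ isCont_qprod] continuous_intros)
  moreover have "isCont (\<lambda>z. qprod (nome * exp (- (2 * of_real pi * \<i> * z)))) 0"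
    by (intro isCont_o2[OF _ isCont_qprod] continuous_intros)
  ultimately have "((\<lambda>z. sin (of_real pi * z) / z * qprod (nome * exp (2 * of_real pi * \<i> * z))
      * qprod (nome * exp (- (2 * of_real pi * \<i> * z)))) \<longlongrightarrow> of_real pi * qprod nome * qprod nome) (at 0)"
    by (intro tendsto_mult) (auto simp: isCont_def)
  thus ?thesis by (simp add: theta_product_def power2_eq_square mult.assoc)
qed

lemma qprod_nome_nonzero: "qprod nome \<noteq> 0"
proof
  assume "qprod nome = 0"
  then obtain n where "nome ^ n * nome = 1" using qprod_zero by blast
  hence "norm nome ^ Suc n = 1" by (metis norm_one norm_power power_Suc2)
  thus False using power_Suc_less_one[of "norm nome" n] norm_nome
    by (cases "nome = 0") auto
qed

lemma theta_over_z: "((\<lambda>z. \<theta> 0 z / z) \<longlongrightarrow> \<theta> 1 0) (at 0)"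
  using DERIV_theta_series[of 0 0] by (simp add: DERIV_def)

text \<open>Both functions have the same multipliers, so their quotient is doubly periodic; it has a
  finite limit at 0 because the product vanishes there to exactly first order. Hence it is a
  constant, nonzero since theta is not identically zero. Reading this constant off the limit at 0
  shows in addition that the derivative of theta at 0 does not vanish.\<close>

lemma theta_product_formula:
  obtains c where "c \<noteq> 0" "\<theta> 1 0 \<noteq> 0" "\<And>z. z \<notin> \<Lambda> \<Longrightarrow> \<theta> 0 z = c * theta_product z"
proof -
  have lim: "((\<lambda>z. (\<theta> 0 z / z) / (theta_product z / z)) \<longlongrightarrow> \<theta> 1 0 / (of_real pi * (qprod nome)\<^sup>2)) (at 0)"
    using qprod_nome_nonzero by (intro tendsto_divide theta_over_z theta_product_limit) simp
  have ev: "eventually (\<lambda>z. (\<theta> 0 z / z) / (theta_product z / z) = \<theta> 0 z / theta_product z) (at 0)"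
    by (simp add: eventually_at_filter)
  have lim: "((\<lambda>z. \<theta> 0 z / theta_product z) \<longlongrightarrow> \<theta> 1 0 / (of_real pi * (qprod nome)\<^sup>2)) (at 0)"
    using lim tendsto_cong[OF ev] by simp
  have nz: "theta_product z \<noteq> 0" if "z \<notin> \<Lambda>" for z using theta_product_zero that by blast
  obtain c where c: "\<And>z. z \<notin> \<Lambda> \<Longrightarrow> \<theta> 0 z / theta_product z = c"
  proof (rule elliptic_Liouville[where f = "\<lambda>z. \<theta> 0 z / theta_product z" and \<epsilon> = 1 and \<eta> = 1])
    show "(\<lambda>z. \<theta> 0 z / theta_product z) holomorphic_on - \<Lambda>"
      using nz by (intro holomorphic_intros) auto
    show "((\<lambda>z. z * (\<theta> 0 z / theta_product z)) \<longlongrightarrow> 0) (at 0)"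
      using tendsto_mult[OF tendsto_ident_at lim] by simp
  qed (auto simp: theta_series_add_1 theta_product_add_1 theta_add_tau theta_product_add_tau)
  have eq: "\<theta> 0 z = c * theta_product z" if "z \<notin> \<Lambda>" for z
    using c[OF that] nz[OF that] by (simp add: field_simps)
  have "eventually (\<lambda>z. \<theta> 0 z / theta_product z = c) (at 0)"
    using eventually_not_in_lattice by eventually_elim (rule c)
  hence "((\<lambda>z. \<theta> 0 z / theta_product z) \<longlongrightarrow> c) (at 0)" by (rule tendsto_eventually)
  hence c_eq: "c = \<theta> 1 0 / (of_real pi * (qprod nome)\<^sup>2)"
    using lim tendsto_unique at_neq_bot by blast
  have "c \<noteq> 0"
  proof
    \<comment> \<open>Theta would vanish off the lattice, and then everywhere by continuity.\<close>
    assume "c = 0"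
    have "\<theta> 0 z = 0" for z
    proof -
      have "eventually (\<lambda>z. \<theta> 0 z = 0) (at z)"
        using eventually_not_in_lattice[of z] by eventually_elim (simp add: eq \<open>c = 0\<close>)
      hence "(\<theta> 0 \<longlongrightarrow> 0) (at z)" by (rule tendsto_eventually)
      moreover have "(\<theta> 0 \<longlongrightarrow> \<theta> 0 z) (at z)" using isCont_theta_series by (simp add: isCont_def)
      ultimately show ?thesis using tendsto_unique at_neq_bot by blast
    qed
    thus False using theta_not_identically_zero by blast
  qed
  thus ?thesis using that[OF _ _ eq] c_eq by auto
qed

lemma theta1_0_nonzero [simp]: "\<theta> 1 0 \<noteq> 0"
  by (rule theta_product_formula) blast

lemma theta_nonzero: "z \<notin> \<Lambda> \<Longrightarrow> \<theta> 0 z \<noteq> 0"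
  by (rule theta_product_formula) (use theta_product_zero in auto)

end

section \<open>The Weierstrass function\<close>

text \<open>The exponent is half of -3: a product of two such sequences, one for each coordinate,
  will dominate the inverse cubes of the lattice points.\<close>

lemma summable_on_int_powr: "(\<lambda>m::int. (1 + \<bar>real_of_int m\<bar>) powr (-3/2)) summable_on UNIV"
proof (rule summable_on_int)
  have *: "summable (\<lambda>n. real n powr (-3/2))"
    by (subst summable_real_powr_iff) simp
  have "summable (\<lambda>n. real (n + 1) powr (-3/2))" "summable (\<lambda>n. real (n + 2) powr (-3/2))"
    using * by (subst summable_iff_shift; simp)+
  thus "summable (\<lambda>n. (1 + \<bar>real_of_int (int n)\<bar>) powr (-3/2))"
       "summable (\<lambda>n. (1 + \<bar>real_of_int (- 1 - int n)\<bar>) powr (-3/2))"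
    by (simp_all add: add_ac abs_if)
qed auto

lemma DERIV_inverse_square:
  fixes a z :: complex
  assumes "z \<noteq> a"
  shows "((\<lambda>z. 1 / (z - a)\<^sup>2) has_field_derivative - 2 / (z - a) ^ 3) (at z)"
proof -
  have "((\<lambda>u. 1 / u\<^sup>2) has_field_derivative - 2 / u ^ 3) (at u)" if "u \<noteq> 0" for u :: complex
    using that by (auto intro!: derivative_eq_intros simp: field_simps power2_eq_square power3_eq_cube)
  from this[of "z + (- a)"] assms show ?thesis
    using DERIV_shift[of "\<lambda>u. 1 / u\<^sup>2" "- 2 / (z - a) ^ 3" z "- a"] by simp
qed

context modulus
begin

abbreviation lattice_point :: "int \<times> int \<Rightarrow> complex" where
  "lattice_point p \<equiv> of_int (fst p) + of_int (snd p) * \<tau>"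

abbreviation nonzero_pairs :: "(int \<times> int) set" where
  "nonzero_pairs \<equiv> UNIV - {(0, 0)}"

lemma lattice_point_nonzero: "p \<in> nonzero_pairs \<Longrightarrow> lattice_point p \<noteq> 0"
  using real_coordinates_unique[of "of_int (fst p)" "of_int (snd p)" 0 0]
  by (cases p) auto

text \<open>With \<open>M\<close> the larger absolute coordinate, both
  \<open>1 + \<bar>m\<bar>\<close> and \<open>1 + \<bar>n\<bar>\<close> are at most
  \<open>2 * M\<close>. Splitting the power -3 evenly between the coordinates reduces the double sum
  to a product of two single sums.\<close>

lemma summable_inverse_cube: "(\<lambda>p. 1 / norm (lattice_point p) ^ 3) summable_on nonzero_pairs"
proof -
  obtain c where c: "c > 0"
    "\<And>m n :: int. c * real_of_int (max \<bar>m\<bar> \<bar>n\<bar>) \<le> norm (of_int m + of_int n * \<tau>)"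
    by (rule lattice_norm_lower_bound) blast
  define g where "g m = (1 + \<bar>real_of_int m\<bar>) powr (-3/2)" for m :: int
  have g: "g summable_on UNIV" unfolding g_def by (rule summable_on_int_powr)
  have g0: "g m \<ge> 0" for m by (simp add: g_def)
  have "(\<lambda>(m, n). g m * g n) summable_on UNIV \<times> UNIV"
    by (rule summable_on_SigmaI[where g = "\<lambda>m. g m * infsum g UNIV"])
       (use g g0 in \<open>auto intro!: has_sum_cmult_right has_sum_infsum summable_on_cmult_left\<close>)
  hence gg: "(\<lambda>p. (8 / c ^ 3) * (\<lambda>(m, n). g m * g n) p) summable_on nonzero_pairs"
    by (intro summable_on_cmult_right) (rule summable_on_subset_banach, auto)
  have bound: "norm (1 / norm (lattice_point p) ^ 3) \<le> (8 / c ^ 3) * (\<lambda>(m, n). g m * g n) p"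
    if p: "p \<in> nonzero_pairs" for p
  proof -
    obtain m n where mn: "p = (m, n)" by (cases p)
    define M where "M = real_of_int (max \<bar>m\<bar> \<bar>n\<bar>)"
    have M: "M \<ge> 1" using p by (auto simp: M_def mn)
    have "1 + \<bar>real_of_int m\<bar> \<le> 2 * M" "1 + \<bar>real_of_int n\<bar> \<le> 2 * M"
      using p by (auto simp: M_def mn)
    hence "(2 * M) powr (-3/2) \<le> g m" "(2 * M) powr (-3/2) \<le> g n"
      unfolding g_def by (intro powr_mono2'; simp)+
    hence "(2 * M) powr (-3/2) * (2 * M) powr (-3/2) \<le> g m * g n"
      by (intro mult_mono) (auto simp: g_def)
    also have "(2 * M) powr (-3/2) * (2 * M) powr (-3/2) = (2 * M) powr (-3)"
      by (subst powr_add[symmetric]) simp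
    also have "\<dots> = 1 / (2 * M) ^ 3"
      using M by (simp add: powr_minus_divide)
    finally have *: "1 / (2 * M) ^ 3 \<le> g m * g n" .
    have "(c * M) ^ 3 \<le> norm (lattice_point p) ^ 3"
      using c M by (intro power_mono) (auto simp: M_def mn)
    hence "1 / norm (lattice_point p) ^ 3 \<le> 1 / (c * M) ^ 3"
      using c(1) M lattice_point_nonzero[OF p] by (intro divide_left_mono mult_pos_pos) auto
    also have "\<dots> = 8 / c ^ 3 * (1 / (2 * M) ^ 3)" by (simp add: power_mult_distrib)
    also have "\<dots> \<le> 8 / c ^ 3 * (g m * g n)" using * c(1) by (intro mult_left_mono) auto
    finally show ?thesis by (simp add: mn)
  qed
  have "(\<lambda>p. norm (1 / norm (lattice_point p) ^ 3)) summable_on nonzero_pairs"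
    by (rule Infinite_Sum.abs_summable_on_comparison_test'[OF gg bound])
  thus ?thesis by simp
qed

abbreviation wp :: "complex \<Rightarrow> complex" where "wp z \<equiv> weierstrass_p z \<tau>"

text \<open>The Weierstrass function without its principal part at 0, hence differentiable at 0
  too.\<close>

definition wp_regular :: "complex \<Rightarrow> complex" where
  "wp_regular z = (\<Sum>\<^sub>\<infinity>p\<in>nonzero_pairs. 1 / (z - lattice_point p)\<^sup>2 - 1 / (lattice_point p)\<^sup>2)"

lemma wp_eq: "wp z = 1 / z\<^sup>2 + wp_regular z"
  by (simp add: weierstrass_p_def wp_regular_def case_prod_unfold)

text \<open>Near \<open>z\<close> each summand is of the order of the inverse cube of its lattice
  point, uniformly, because the subtracted constant cancels the leading term. This justifies
  termwise differentiation.\<close>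

lemma wp_regular_deriv:
  assumes "z \<notin> \<Lambda> - {0}"
  shows "(wp_regular has_field_derivative (\<Sum>\<^sub>\<infinity>p\<in>nonzero_pairs. - 2 / (z - lattice_point p) ^ 3)) (at z)"
    and "(\<lambda>p. - 2 / (z - lattice_point p) ^ 3) summable_on nonzero_pairs"
proof -
  have "closed (\<Lambda> - {0})"
  proof -
    obtain \<delta> where \<delta>: "\<delta> > 0" "\<And>a. a \<in> \<Lambda> \<Longrightarrow> norm a < \<delta> \<Longrightarrow> a = 0"
      by (rule lattice_discrete) blast
    hence "\<Lambda> - {0} = \<Lambda> - ball 0 \<delta>" by (auto simp: dist_norm)
    thus ?thesis using closed_lattice by (metis closed_Diff open_ball)
  qed
  hence "open (- (\<Lambda> - {0}))" by (rule open_Compl)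
  then obtain e where e: "e > 0" "cball z e \<subseteq> - (\<Lambda> - {0})"
    using assms by (meson ComplI open_contains_cball)
  \<comment> \<open>Half the radius keeps every point of the smaller disc at distance at least
    \<open>r\<close> from all nonzero lattice points.\<close>
  define r where "r = e / 2"
  define R where "R = norm z + r"
  \<comment> \<open>\<open>K\<close> bounds the quotient of the norms of \<open>w\<close> and
    \<open>y - w\<close>: the triangle inequality gives the sum of the norms of \<open>y - w\<close>
    and \<open>y\<close>, and \<open>R\<close> is at most \<open>R / r\<close> times the norm of
    \<open>y - w\<close>.\<close>
  define K where "K = 1 + R / r"
  have r: "r > 0" using e(1) by (simp add: r_def)
  have R: "R > 0" using r by (simp add: R_def add_nonneg_pos)
  have K: "K > 0" using r R by (simp add: K_def add_pos_pos)
  have lp: "lattice_point p \<in> \<Lambda> - {0}" if "p \<in> nonzero_pairs" for p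
    using lattice_point_nonzero[OF that] by simp
  have far: "norm (y - lattice_point p) \<ge> r" if "p \<in> nonzero_pairs" "y \<in> cball z r" for y p
  proof (rule ccontr)
    assume "\<not> ?thesis"
    hence "dist z (lattice_point p) \<le> e"
      using that(2) dist_triangle[of z "lattice_point p" y] by (simp add: dist_norm r_def)
    thus False using e(2) lp[OF that(1)] by auto
  qed
  have deriv: "((\<lambda>y. 1 / (y - lattice_point p)\<^sup>2 - 1 / (lattice_point p)\<^sup>2) has_field_derivative
      - 2 / (y - lattice_point p) ^ 3) (at y)" if "p \<in> nonzero_pairs" "y \<in> cball z r" for y p
  proof -
    have "y \<noteq> lattice_point p" using far[OF that] r by auto
    from DERIV_diff[OF DERIV_inverse_square[OF this] DERIV_const] show ?thesis by simp
  qed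
  have bound: "norm (1 / (y - lattice_point p)\<^sup>2 - 1 / (lattice_point p)\<^sup>2)
      \<le> R * (K\<^sup>2 + K) * (1 / norm (lattice_point p) ^ 3)" if p: "p \<in> nonzero_pairs" and y: "y \<in> cball z r" for y p
  proof -
    define w where "w = lattice_point p"
    define a where "a = norm w"
    define b where "b = norm (y - w)"
    have w: "w \<noteq> 0" using lattice_point_nonzero[OF p] by (simp add: w_def)
    have b: "b \<ge> r" using far[OF p y] by (simp add: b_def w_def)
    have a: "a > 0" using w by (simp add: a_def)
    have yR: "norm y \<le> R"
      using y norm_triangle_ineq2[of y z] by (simp add: R_def dist_norm norm_minus_commute)
    have rb: "r * norm y \<le> b * R" using yR b r R by (intro mult_mono) auto
    have "a \<le> b + norm y"
      unfolding a_def b_def using norm_triangle_ineq4[of y "y - w"] by simp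
    also have "\<dots> \<le> b + R * (b / r)" using r rb by (simp add: field_simps)
    also have "\<dots> = K * b" using r by (simp add: K_def field_simps)
    finally have aKb: "a \<le> K * b" .
    have bpos: "b > 0" using b r by linarith
    have inv: "1 / b \<le> K / a" using aKb a bpos by (simp add: field_simps)
    have "1 / (y - w)\<^sup>2 - 1 / w\<^sup>2 = y * (w + (w - y)) / (w\<^sup>2 * (y - w)\<^sup>2)"
      using w bpos by (simp add: b_def divide_simps) (simp add: algebra_simps power2_eq_square)
    hence "norm (1 / (y - w)\<^sup>2 - 1 / w\<^sup>2) = norm y * norm (w + (w - y)) / (a\<^sup>2 * b\<^sup>2)"
      by (simp add: norm_mult norm_divide norm_power a_def b_def)
    also have "\<dots> \<le> R * (a + b) / (a\<^sup>2 * b\<^sup>2)"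
      using yR R norm_triangle_ineq[of w "w - y"]
      by (intro divide_right_mono mult_mono) (auto simp: a_def b_def norm_minus_commute)
    also have "\<dots> = R * (1 / a * (1 / b)\<^sup>2 + 1 / a\<^sup>2 * (1 / b))"
      using a bpos by (simp add: divide_simps power2_eq_square) 
    also have "\<dots> \<le> R * (1 / a * (K / a)\<^sup>2 + 1 / a\<^sup>2 * (K / a))"
      using inv a bpos R by (intro mult_left_mono add_mono power_mono) auto
    also have "\<dots> = R * (K\<^sup>2 + K) * (1 / a ^ 3)"
      using a by (simp add: divide_simps power2_eq_square power3_eq_cube)
    finally show ?thesis by (simp only: w_def a_def)
  qed
  note * = has_field_derivative_infsum[OF r deriv bound summable_on_cmult_right[OF summable_inverse_cube]]
  show "(wp_regular has_field_derivative (\<Sum>\<^sub>\<infinity>p\<in>nonzero_pairs. - 2 / (z - lattice_point p) ^ 3)) (at z)"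
    unfolding wp_regular_def[abs_def] by (rule *(1))
  show "(\<lambda>p. - 2 / (z - lattice_point p) ^ 3) summable_on nonzero_pairs"
    by (rule *(2))
qed

text \<open>The term of the pole at 0 is included, so the sum runs over the whole lattice and its
  periodicity is a mere reindexing.\<close>

definition wp_deriv :: "complex \<Rightarrow> complex" where
  "wp_deriv z = (\<Sum>\<^sub>\<infinity>p. - 2 / (z - lattice_point p) ^ 3)"

lemma DERIV_wp:
  assumes "z \<notin> \<Lambda>"
  shows "(wp has_field_derivative wp_deriv z) (at z)"
proof -
  have z: "z \<noteq> 0" using assms by auto
  have "z \<notin> \<Lambda> - {0}" using assms by auto
  note W = wp_regular_deriv[OF this]
  have "((\<lambda>p. - 2 / (z - lattice_point p) ^ 3) has_sum
      (\<Sum>\<^sub>\<infinity>p\<in>nonzero_pairs. - 2 / (z - lattice_point p) ^ 3)) nonzero_pairs"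
    by (rule has_sum_infsum[OF W(2)])
  hence "((\<lambda>p. - 2 / (z - lattice_point p) ^ 3) has_sum
      (- 2 / (z - lattice_point (0, 0)) ^ 3 +
       (\<Sum>\<^sub>\<infinity>p\<in>nonzero_pairs. - 2 / (z - lattice_point p) ^ 3))) (insert (0, 0) nonzero_pairs)"
    by (intro has_sum_insert) auto
  moreover have "insert (0, 0) nonzero_pairs = UNIV" by auto
  ultimately have eq: "wp_deriv z = - 2 / z ^ 3 + (\<Sum>\<^sub>\<infinity>p\<in>nonzero_pairs. - 2 / (z - lattice_point p) ^ 3)"
    unfolding wp_deriv_def by (auto intro!: infsumI)
  have "((\<lambda>z. 1 / z\<^sup>2) has_field_derivative - 2 / z ^ 3) (at z)"
    using DERIV_inverse_square[of z 0] z by simp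
  from DERIV_add[OF this W(1)] show ?thesis
    unfolding eq wp_eq[abs_def] .
qed

lemma holomorphic_wp: "wp holomorphic_on - \<Lambda>"
  using DERIV_wp open_Compl_lattice by (auto simp: holomorphic_on_open)

lemma wp_deriv_add_period:
  "wp_deriv (z + (of_int k + of_int l * \<tau>)) = wp_deriv z"
  unfolding wp_deriv_def
  by (rule infsum_reindex_bij_witness[of _ "\<lambda>p. (fst p + k, snd p + l)" "\<lambda>p. (fst p - k, snd p - l)"])
     (auto simp: algebra_simps)

lemma wp_minus: "wp (- z) = wp z"
proof -
  have "wp_regular (- z) = wp_regular z"
    unfolding wp_regular_def
  proof (rule infsum_reindex_bij_witness[of _ "\<lambda>p. (- fst p, - snd p)" "\<lambda>p. (- fst p, - snd p)"])
    fix p :: "int \<times> int"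
    have "- z - lattice_point p = - (z - lattice_point (- fst p, - snd p))"
      "lattice_point (- fst p, - snd p) = - lattice_point p" by simp_all
    thus "1 / (z - lattice_point (- fst p, - snd p))\<^sup>2 - 1 / (lattice_point (- fst p, - snd p))\<^sup>2 =
        1 / (- z - lattice_point p)\<^sup>2 - 1 / (lattice_point p)\<^sup>2"
      by (simp only: power2_minus)
  qed (auto simp: prod_eq_iff)
  thus ?thesis by (simp add: wp_eq)
qed

text \<open>The difference has derivative zero on the connected complement of the lattice, so it is
  constant. At \<open>- (a / 2)\<close> evenness makes it zero; this is why \<open>a / 2\<close>
  must avoid the lattice.\<close>

lemma wp_add_period:
  assumes a: "a \<in> \<Lambda>" "a / 2 \<notin> \<Lambda>" and z: "z \<notin> \<Lambda>"
  shows "wp (z + a) = wp z"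
proof -
  from a(1) obtain k l where kl: "a = of_int k + of_int l * \<tau>" by (auto simp: period_lattice_def)
  have D: "((\<lambda>z. wp (z + a) - wp z) has_field_derivative 0) (at z)" if "z \<notin> \<Lambda>" for z
  proof -
    have "(wp has_field_derivative wp_deriv (z + a)) (at (z + a))"
      using that a by (intro DERIV_wp) (simp add: lattice_add_iff)
    hence "((\<lambda>z. wp (z + a)) has_field_derivative wp_deriv (z + a)) (at z)"
      by (simp add: DERIV_shift)
    from DERIV_diff[OF this DERIV_wp[OF that]] show ?thesis
      using wp_deriv_add_period[of z k l] by (simp add: kl)
  qed
  have "continuous_on (- \<Lambda>) (\<lambda>z. wp (z + a) - wp z)"
    using D by (intro continuous_at_imp_continuous_on ballI) (auto intro: DERIV_isCont)
  then obtain c where c: "\<And>z. z \<in> - \<Lambda> \<Longrightarrow> wp (z + a) - wp z = c"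
    using DERIV_zero_connected_constant[OF connected_Compl_lattice open_Compl_lattice finite.emptyI] D
    by auto
  have "wp (- (a / 2) + a) - wp (- (a / 2)) = c" using a by (intro c) simp
  moreover have "- (a / 2) + a = a / 2" by simp
  ultimately have "c = 0" by (simp only: wp_minus diff_self)
  thus ?thesis using c[of z] z by simp
qed

lemma wp_add_1: "z \<notin> \<Lambda> \<Longrightarrow> wp (z + 1) = wp z"
  and wp_add_tau: "z \<notin> \<Lambda> \<Longrightarrow> wp (z + \<tau>) = wp z"
  using half_lattice[of 1 0] half_lattice[of 0 1] by (auto intro!: wp_add_period)

lemma wp_limit: "((\<lambda>z. z\<^sup>2 * wp z) \<longlongrightarrow> 1) (at 0)"
proof -
  have "isCont wp_regular 0" using wp_regular_deriv(1)[of 0] by (auto intro: DERIV_isCont)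
  hence "((\<lambda>z. 1 + z\<^sup>2 * wp_regular z) \<longlongrightarrow> 1 + 0\<^sup>2 * wp_regular 0) (at 0)"
    unfolding isCont_def by (intro tendsto_intros)
  moreover have "eventually (\<lambda>z. 1 + z\<^sup>2 * wp_regular z = z\<^sup>2 * wp z) (at 0)"
    by (simp add: eventually_at_filter wp_eq ring_distribs)
  ultimately show ?thesis using tendsto_cong by force
qed

end

section \<open>Theta functions at the half periods\<close>

declare One_nat_def [simp del]

text \<open>The slope of the half period as an affine function of \<tau>, the form in which a moving
  argument enters the derivative of the theta series along a line.\<close>

definition half_period_rate :: "3 \<Rightarrow> complex" where
  "half_period_rate \<alpha> = (if \<alpha> = 1 then 0 else 1 / 2)"

definition half_period_offset :: "3 \<Rightarrow> complex" where
  "half_period_offset \<alpha> = (if \<alpha> = 2 then 0 else 1 / 2)"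

lemma half_period_eq: "half_period \<alpha> \<tau> = half_period_offset \<alpha> + half_period_rate \<alpha> * \<tau>"
  by (auto simp: half_period_def half_period_offset_def half_period_rate_def field_simps)

lemma half_period_dtau_eq: "half_period_dtau \<alpha> \<tau> = half_period_rate \<alpha>"
proof -
  have "(half_period \<alpha> has_field_derivative half_period_rate \<alpha>) (at \<tau>)"
    unfolding half_period_eq[abs_def] by (auto intro!: derivative_eq_intros)
  thus ?thesis unfolding half_period_dtau_def by (rule DERIV_imp_deriv)
qed

definition half_period_exponent :: "3 \<Rightarrow> complex" where
  "half_period_exponent \<alpha> = 2 * of_real pi * \<i> * half_period_rate \<alpha>"

text \<open>The multipliers of \<open>varphi \<alpha>\<close> under \<open>w \<mapsto> w + 1\<close> and \<open>w \<mapsto> w + \<tau>\<close>.\<close>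

definition sign_1 :: "3 \<Rightarrow> complex" where "sign_1 \<alpha> = (if \<alpha> = 1 then 1 else -1)"
definition sign_tau :: "3 \<Rightarrow> complex" where "sign_tau \<alpha> = (if \<alpha> = 2 then 1 else -1)"

lemma three_cases: obtains "\<alpha> = (1 :: 3)" | "\<alpha> = 2" | "\<alpha> = 3"
  using exhaust_3 by blast

lemma sign_in: "sign_1 \<alpha> \<in> {1, -1}" "sign_tau \<alpha> \<in> {1, -1}"
  by (auto simp: sign_1_def sign_tau_def)

lemma sign_nontrivial: "sign_1 \<alpha> = -1 \<or> sign_tau \<alpha> = -1"
  by (auto simp: sign_1_def sign_tau_def)

text \<open>The pairs of signs are the three nontrivial characters of the lattice modulo its double,
  and in a Klein four-group the product of two nontrivial elements is the third.\<close>

lemma sign_mult: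
  assumes "\<alpha> \<noteq> \<beta>" "\<beta> \<noteq> \<gamma>" "\<alpha> \<noteq> \<gamma>"
  shows "sign_1 \<beta> * sign_1 \<gamma> = sign_1 \<alpha>" "sign_tau \<beta> * sign_tau \<gamma> = sign_tau \<alpha>"
  using assms
  by (cases \<alpha> rule: three_cases; cases \<beta> rule: three_cases; cases \<gamma> rule: three_cases;
      simp add: sign_1_def sign_tau_def)+

context modulus
begin

abbreviation \<omega> :: "3 \<Rightarrow> complex" where "\<omega> \<alpha> \<equiv> half_period \<alpha> \<tau>"
abbreviation \<theta>1_0 :: complex where "\<theta>1_0 \<equiv> \<theta> 1 0"

lemma half_period_not_in_lattice: "\<omega> \<alpha> \<notin> \<Lambda>"
  using half_lattice[of 1 0] half_lattice[of 0 1] half_lattice[of 1 1]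
  by (simp add: half_period_def)

lemma theta_half_period_nonzero [simp]: "\<theta> 0 (\<omega> \<alpha>) \<noteq> 0"
  by (rule theta_nonzero[OF half_period_not_in_lattice])

text \<open>The two arguments differ by twice a half period, which is a lattice vector, so the
  quasi-periodicity of theta applies. For the third half period the sign from the shift by 1 cancels
  against \<open>exp (\<pi>\<i>)\<close>.\<close>

lemma theta_half_period_shift:
  "\<theta> 0 (w + \<omega> \<alpha>) = - exp (- 2 * half_period_exponent \<alpha> * w) * \<theta> 0 (w - \<omega> \<alpha>)"
proof (cases \<alpha> rule: three_cases)
  case 1
  thus ?thesis using theta_series_add_1[of 0 "w - 1 / 2"]
    by (simp add: half_period_def half_period_exponent_def half_period_rate_def add.commute)
next
  case 2
  have "\<theta> 0 (w + \<tau> / 2) = tau_factor (w - \<tau> / 2) * \<theta> 0 (w - \<tau> / 2)"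
    using theta_add_tau[of "w - \<tau> / 2"] by (simp add: add.commute)
  also have "tau_factor (w - \<tau> / 2) = - exp (- 2 * half_period_exponent \<alpha> * w)"
    using 2 by (simp add: tau_factor_def half_period_exponent_def half_period_rate_def algebra_simps)
  finally show ?thesis using 2 by (simp add: half_period_def)
next
  case 3
  have "\<theta> 0 (w + (1 + \<tau>) / 2) = \<theta> 0 ((w - (1 + \<tau>) / 2) + \<tau> + 1)"
    by (simp add: field_simps)
  also have "\<dots> = - tau_factor (w - (1 + \<tau>) / 2) * \<theta> 0 (w - (1 + \<tau>) / 2)"
    by (simp add: theta_series_add_1 theta_add_tau)
  also have "tau_factor (w - (1 + \<tau>) / 2) = - (exp (of_real pi * \<i>) * exp (- 2 * half_period_exponent \<alpha> * w))"
    unfolding tau_factor_def exp_add[symmetric]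
    by (rule arg_cong[where f = "\<lambda>x. - exp x"])
       (use 3 in \<open>simp add: half_period_exponent_def half_period_rate_def field_simps\<close>)
  finally show ?thesis using 3 by (simp add: half_period_def)
qed

text \<open>Up to a constant these are the three even Jacobi theta functions, with first and second
  derivatives.\<close>

definition even_theta :: "3 \<Rightarrow> complex \<Rightarrow> complex" where
  "even_theta \<alpha> w = exp (half_period_exponent \<alpha> * w) * \<theta> 0 (w + \<omega> \<alpha>) / \<theta> 0 (\<omega> \<alpha>)"

definition even_theta1 :: "3 \<Rightarrow> complex \<Rightarrow> complex" where
  "even_theta1 \<alpha> w = exp (half_period_exponent \<alpha> * w) *
     (\<theta> 1 (w + \<omega> \<alpha>) + half_period_exponent \<alpha> * \<theta> 0 (w + \<omega> \<alpha>)) / \<theta> 0 (\<omega> \<alpha>)"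

definition even_theta2 :: "3 \<Rightarrow> complex \<Rightarrow> complex" where
  "even_theta2 \<alpha> w = exp (half_period_exponent \<alpha> * w) *
     (\<theta> 2 (w + \<omega> \<alpha>) + 2 * half_period_exponent \<alpha> * \<theta> 1 (w + \<omega> \<alpha>)
       + (half_period_exponent \<alpha>)\<^sup>2 * \<theta> 0 (w + \<omega> \<alpha>)) / \<theta> 0 (\<omega> \<alpha>)"

lemma DERIV_even_theta: "(even_theta \<alpha> has_field_derivative even_theta1 \<alpha> w) (at w)"
  unfolding even_theta_def[abs_def] even_theta1_def
  by (rule derivative_eq_intros refl theta_half_period_nonzero)+
     (simp add: field_simps One_nat_def)

lemma DERIV_even_theta1: "(even_theta1 \<alpha> has_field_derivative even_theta2 \<alpha> w) (at w)"
  unfolding even_theta1_def[abs_def] even_theta2_def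
  by (rule derivative_eq_intros refl theta_half_period_nonzero)+
     (simp add: field_simps power2_eq_square numeral_2_eq_2 One_nat_def)

lemmas DERIV_even_theta' [derivative_intros] = DERIV_chain2[OF DERIV_even_theta]

lemma holomorphic_even_theta [holomorphic_intros]:
  "even_theta \<alpha> holomorphic_on A" "even_theta1 \<alpha> holomorphic_on A" "even_theta2 \<alpha> holomorphic_on A"
  unfolding even_theta_def[abs_def] even_theta1_def[abs_def] even_theta2_def[abs_def]
  by (intro holomorphic_intros; simp)+

lemma isCont_even_theta: "isCont (even_theta \<alpha>) w" "isCont (even_theta1 \<alpha>) w" "isCont (even_theta2 \<alpha>) w"
  using holomorphic_on_imp_continuous_on[OF holomorphic_even_theta(1)[of \<alpha> UNIV]]
    holomorphic_on_imp_continuous_on[OF holomorphic_even_theta(2)[of \<alpha> UNIV]]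
    holomorphic_on_imp_continuous_on[OF holomorphic_even_theta(3)[of \<alpha> UNIV]]
  by (simp_all add: continuous_on_eq_continuous_at)

lemma even_theta_0 [simp]: "even_theta \<alpha> 0 = 1"
  by (simp add: even_theta_def)

text \<open>Theta is odd, and reflecting through the half period contributes a second sign. The
  exponential prefactor is exactly the one that balances the factor from the half-period
  shift.\<close>

lemma even_theta_minus [simp]: "even_theta \<alpha> (- w) = even_theta \<alpha> w"
proof -
  have "\<theta> 0 (- w + \<omega> \<alpha>) = - \<theta> 0 (w - \<omega> \<alpha>)"
    using theta_series_minus[of 0 "w - \<omega> \<alpha>"] by simp
  moreover have "exp (half_period_exponent \<alpha> * w) * exp (- 2 * half_period_exponent \<alpha> * w)
      = exp (half_period_exponent \<alpha> * (- w))"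
    by (simp add: algebra_simps flip: exp_add)
  ultimately show ?thesis
    unfolding even_theta_def theta_half_period_shift[of w] by (simp add: field_simps)
qed

lemma even_theta1_minus [simp]: "even_theta1 \<alpha> (- w) = - even_theta1 \<alpha> w"
proof -
  have "((\<lambda>w. even_theta \<alpha> (- w)) has_field_derivative - even_theta1 \<alpha> (- w)) (at w)"
    by (auto intro!: derivative_eq_intros simp del: even_theta_minus)
  hence "(even_theta \<alpha> has_field_derivative - even_theta1 \<alpha> (- w)) (at w)" by simp
  hence "- even_theta1 \<alpha> (- w) = even_theta1 \<alpha> w"
    using DERIV_even_theta DERIV_unique by blast
  thus ?thesis by (metis minus_minus)
qed

lemma even_theta1_0 [simp]: "even_theta1 \<alpha> 0 = 0"
  using even_theta1_minus[of \<alpha> 0] by simp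

text \<open>The half-period shift relates this value to theta at 0. It fixes the additive constant
  in \<open>varphi_square\<close>.\<close>

lemma even_theta_half_period: "even_theta \<alpha> (\<omega> \<alpha>) = 0"
  using theta_half_period_shift[of "\<omega> \<alpha>" \<alpha>] by (simp add: even_theta_def)

lemma exp_half_period_exponent: "exp (half_period_exponent \<alpha>) = sign_1 \<alpha>"
  by (simp add: half_period_exponent_def half_period_rate_def sign_1_def)

lemma even_theta_add_1:
  "even_theta \<alpha> (w + 1) = - sign_1 \<alpha> * even_theta \<alpha> w"
  "even_theta1 \<alpha> (w + 1) = - sign_1 \<alpha> * even_theta1 \<alpha> w"
  "even_theta2 \<alpha> (w + 1) = - sign_1 \<alpha> * even_theta2 \<alpha> w"
proof -
  have *: "\<theta> k (w + 1 + \<omega> \<alpha>) = - \<theta> k (w + \<omega> \<alpha>)" for k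
    using theta_series_add_1[of k "w + \<omega> \<alpha>"] by (simp add: add_ac)
  have "exp (half_period_exponent \<alpha> * (w + 1)) = sign_1 \<alpha> * exp (half_period_exponent \<alpha> * w)"
    by (simp add: ring_distribs exp_add exp_half_period_exponent)
  note * = * this
  show "even_theta \<alpha> (w + 1) = - sign_1 \<alpha> * even_theta \<alpha> w"
    "even_theta1 \<alpha> (w + 1) = - sign_1 \<alpha> * even_theta1 \<alpha> w"
    "even_theta2 \<alpha> (w + 1) = - sign_1 \<alpha> * even_theta2 \<alpha> w"
    unfolding even_theta_def even_theta1_def even_theta2_def * by (simp_all add: field_simps)
qed

lemma even_theta_add_tau:
  "even_theta \<alpha> (w + \<tau>) = sign_tau \<alpha> * tau_factor w * even_theta \<alpha> w"
  "even_theta1 \<alpha> (w + \<tau>) = sign_tau \<alpha> * tau_factor w *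
     (even_theta1 \<alpha> w - 2 * of_real pi * \<i> * even_theta \<alpha> w)"
  "even_theta2 \<alpha> (w + \<tau>) = sign_tau \<alpha> * tau_factor w *
     (even_theta2 \<alpha> w - 4 * of_real pi * \<i> * even_theta1 \<alpha> w - 4 * of_real pi ^ 2 * even_theta \<alpha> w)"
proof -
  \<comment> \<open>The \<tau>-linear part of the half period cancels, and only its constant offset
    survives, giving a sign.\<close>
  have "exp (half_period_exponent \<alpha> * \<tau>) * exp (- (2 * of_real pi * \<i> * \<omega> \<alpha>)) = sign_tau \<alpha>"
  proof -
    have "exp (half_period_exponent \<alpha> * \<tau>) * exp (- (2 * of_real pi * \<i> * \<omega> \<alpha>))
      = exp (- (2 * of_real pi * \<i> * half_period_offset \<alpha>))"
      unfolding exp_add[symmetric]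
      by (simp add: half_period_exponent_def half_period_eq algebra_simps)
    also have "\<dots> = sign_tau \<alpha>"
      by (simp add: half_period_offset_def sign_tau_def exp_minus)
    finally show ?thesis .
  qed
  moreover have "tau_factor (w + \<omega> \<alpha>) = tau_factor w * exp (- (2 * of_real pi * \<i> * \<omega> \<alpha>))"
    by (simp add: tau_factor_def algebra_simps flip: exp_add)
  ultimately have 1: "exp (half_period_exponent \<alpha> * (w + \<tau>)) * tau_factor (w + \<omega> \<alpha>) =
      sign_tau \<alpha> * tau_factor w * exp (half_period_exponent \<alpha> * w)"
    by (simp add: ring_distribs exp_add)
  have 2: "w + \<tau> + \<omega> \<alpha> = w + \<omega> \<alpha> + \<tau>" by simp
  have 3: "exp (half_period_exponent \<alpha> * (w + \<tau>)) * (tau_factor (w + \<omega> \<alpha>) * a) =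
      sign_tau \<alpha> * tau_factor w * exp (half_period_exponent \<alpha> * w) * a" for a
    unfolding 1[symmetric] by simp
  show "even_theta \<alpha> (w + \<tau>) = sign_tau \<alpha> * tau_factor w * even_theta \<alpha> w"
    unfolding even_theta_def 2 theta_add_tau 3 by simp
  have 4: "\<theta> 1 (w + \<omega> \<alpha> + \<tau>) + half_period_exponent \<alpha> * \<theta> 0 (w + \<omega> \<alpha> + \<tau>)
     = tau_factor (w + \<omega> \<alpha>) * (\<theta> 1 (w + \<omega> \<alpha>) - 2 * of_real pi * \<i> * \<theta> 0 (w + \<omega> \<alpha>)
        + half_period_exponent \<alpha> * \<theta> 0 (w + \<omega> \<alpha>))"
    unfolding theta_add_tau theta1_add_tau by (simp add: algebra_simps)
  show "even_theta1 \<alpha> (w + \<tau>) = sign_tau \<alpha> * tau_factor w *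
     (even_theta1 \<alpha> w - 2 * of_real pi * \<i> * even_theta \<alpha> w)"
    unfolding even_theta_def even_theta1_def 2 4 3 by (simp add: field_simps)
  have 5: "\<theta> 2 (w + \<omega> \<alpha> + \<tau>) + 2 * half_period_exponent \<alpha> * \<theta> 1 (w + \<omega> \<alpha> + \<tau>)
       + (half_period_exponent \<alpha>)\<^sup>2 * \<theta> 0 (w + \<omega> \<alpha> + \<tau>)
     = tau_factor (w + \<omega> \<alpha>) * ((\<theta> 2 (w + \<omega> \<alpha>) - 4 * of_real pi * \<i> * \<theta> 1 (w + \<omega> \<alpha>)
         - 4 * of_real pi ^ 2 * \<theta> 0 (w + \<omega> \<alpha>))
        + 2 * half_period_exponent \<alpha> * (\<theta> 1 (w + \<omega> \<alpha>) - 2 * of_real pi * \<i> * \<theta> 0 (w + \<omega> \<alpha>))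
        + (half_period_exponent \<alpha>)\<^sup>2 * \<theta> 0 (w + \<omega> \<alpha>))"
    unfolding theta_add_tau theta1_add_tau theta2_add_tau by (simp add: algebra_simps)
  show "even_theta2 \<alpha> (w + \<tau>) = sign_tau \<alpha> * tau_factor w *
     (even_theta2 \<alpha> w - 4 * of_real pi * \<i> * even_theta1 \<alpha> w - 4 * of_real pi ^ 2 * even_theta \<alpha> w)"
    unfolding even_theta_def even_theta1_def even_theta2_def 2 5 3 by (simp add: field_simps)
qed

section \<open>The elliptic identities and the limits at 0 behind them\<close>

lemma z_over_theta: "((\<lambda>z. z / \<theta> 0 z) \<longlongrightarrow> 1 / \<theta>1_0) (at 0)"
  using tendsto_inverse[OF theta_over_z] by (simp add: inverse_eq_divide)

lemma even_theta_limits: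
  "((\<lambda>z. even_theta \<alpha> z) \<longlongrightarrow> 1) (at 0)"
  "((\<lambda>z. even_theta1 \<alpha> z) \<longlongrightarrow> 0) (at 0)"
  "((\<lambda>z. even_theta2 \<alpha> z) \<longlongrightarrow> even_theta2 \<alpha> 0) (at 0)"
  "((\<lambda>z. even_theta1 \<alpha> z / z) \<longlongrightarrow> even_theta2 \<alpha> 0) (at 0)"
  using isCont_even_theta[where \<alpha> = \<alpha> and w = 0] DERIV_even_theta1[where \<alpha> = \<alpha> and w = 0] by (simp_all add: isCont_def DERIV_def)

lemma theta_limits:
  "((\<lambda>z. \<theta> 0 z) \<longlongrightarrow> 0) (at 0)" "((\<lambda>z. \<theta> 1 z) \<longlongrightarrow> \<theta>1_0) (at 0)"
  "((\<lambda>z. \<theta> 2 z / z) \<longlongrightarrow> \<theta> 3 0) (at 0)"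
  using isCont_theta_series[where k = 0 and z = 0] isCont_theta_series[where k = 1 and z = 0]
    DERIV_theta_series[where k = 2 and z = 0]
  by (simp_all add: isCont_def DERIV_def)

text \<open>In terms of \<open>varphi\<close> this says that the derivative of
  \<open>varphi \<alpha>\<close> is minus the product of the other two. After division by the square
  of theta, the difference of the sides is even with nontrivial multipliers. Its numerator vanishes
  at 0, which leaves at most a simple pole, and evenness excludes that.\<close>

lemma even_theta_product_formula:
  assumes "\<alpha> \<noteq> \<beta>" "\<beta> \<noteq> \<gamma>" "\<alpha> \<noteq> \<gamma>" and w: "w \<notin> \<Lambda>"
  shows "even_theta1 \<alpha> w * \<theta> 0 w = \<theta> 1 w * even_theta \<alpha> w - \<theta>1_0 * even_theta \<beta> w * even_theta \<gamma> w"
proof -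
  note sm = sign_mult[OF assms(1-3), symmetric]
  define G where "G w = even_theta1 \<alpha> w * \<theta> 0 w - \<theta> 1 w * even_theta \<alpha> w
    + \<theta>1_0 * even_theta \<beta> w * even_theta \<gamma> w" for w
  define f where "f w = G w / (\<theta> 0 w)\<^sup>2" for w
  have hol: "f holomorphic_on - \<Lambda>"
    unfolding f_def G_def using theta_nonzero by (intro holomorphic_intros) auto
  have even: "f (- z) = f z" for z
    using theta_series_minus[of 0 z] theta_series_minus[of 1 z] by (simp add: f_def G_def)
  have G1: "G (z + 1) = sign_1 \<alpha> * G z" for z
    unfolding G_def theta_series_add_1 even_theta_add_1 sm by (simp add: algebra_simps)
  have f1: "f (z + 1) = sign_1 \<alpha> * f z" for z
    by (simp add: f_def G1 theta_series_add_1)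
  have G2: "G (z + \<tau>) = sign_tau \<alpha> * (tau_factor z)\<^sup>2 * G z" for z
    unfolding G_def theta_add_tau theta1_add_tau even_theta_add_tau sm
    by (simp add: algebra_simps power2_eq_square)
  have f2: "f (z + \<tau>) = sign_tau \<alpha> * f z" for z
    by (simp add: f_def G2 theta_add_tau power_mult_distrib)
  have G0: "(G \<longlongrightarrow> 0 * 0 - \<theta>1_0 * 1 + \<theta>1_0 * 1 * 1) (at 0)"
    unfolding G_def by (intro tendsto_intros even_theta_limits theta_limits)
  have "((\<lambda>z. (z / \<theta> 0 z)\<^sup>2 * G z) \<longlongrightarrow> (1 / \<theta>1_0)\<^sup>2 * 0) (at 0)"
    using G0 by (intro tendsto_intros z_over_theta) simp
  hence "((\<lambda>z. z\<^sup>2 * f z) \<longlongrightarrow> 0) (at 0)" by (simp add: f_def power_divide)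
  from even_removable[OF hol even this] have lim: "((\<lambda>z. z * f z) \<longlongrightarrow> 0) (at 0)" .
  have "f w = 0"
    by (rule elliptic_Liouville_zero[OF hol f1 sign_in(1) f2 sign_in(2) lim sign_nontrivial w])
  hence "G w = 0" using theta_nonzero[OF w] by (simp add: f_def)
  thus ?thesis unfolding G_def by algebra
qed

text \<open>The value for which both sides of the heat formula agree to first order at 0. It
  reappears as 2\<pi>\<i> times the logarithmic time derivative of
  \<open>gyrostat_factor \<alpha>\<close>.\<close>

definition heat_constant :: "3 \<Rightarrow> complex" where
  "heat_constant \<alpha> = \<theta> 3 0 / \<theta>1_0 - even_theta2 \<alpha> 0"

text \<open>The left-hand side is the second Hirota bilinear derivative of
  \<open>even_theta \<alpha>\<close> and theta. As both share the exponential factor under the shift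
  by \<tau>, the inhomogeneous terms cancel. The choice of \<open>heat_constant\<close> makes the
  numerator \<open>G\<close> vanish beyond first order at 0, so no pole obstructs Liouville's
  theorem.\<close>

lemma even_theta_heat_formula:
  assumes w: "w \<notin> \<Lambda>"
  shows "even_theta2 \<alpha> w * \<theta> 0 w - 2 * even_theta1 \<alpha> w * \<theta> 1 w + even_theta \<alpha> w * \<theta> 2 w
     = heat_constant \<alpha> * even_theta \<alpha> w * \<theta> 0 w"
proof -
  define G where "G w = even_theta2 \<alpha> w * \<theta> 0 w - 2 * even_theta1 \<alpha> w * \<theta> 1 w
     + even_theta \<alpha> w * \<theta> 2 w - heat_constant \<alpha> * even_theta \<alpha> w * \<theta> 0 w" for w
  define f where "f w = G w / (\<theta> 0 w)\<^sup>2" for w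
  have hol: "f holomorphic_on - \<Lambda>"
    unfolding f_def G_def using theta_nonzero by (intro holomorphic_intros) auto
  have G1: "G (z + 1) = sign_1 \<alpha> * G z" for z
    unfolding G_def theta_series_add_1 even_theta_add_1 by (simp add: algebra_simps)
  have f1: "f (z + 1) = sign_1 \<alpha> * f z" for z
    by (simp add: f_def G1 theta_series_add_1)
  have G2: "G (z + \<tau>) = sign_tau \<alpha> * (tau_factor z)\<^sup>2 * G z" for z
    unfolding G_def theta_add_tau theta1_add_tau theta2_add_tau even_theta_add_tau
    by (simp add: algebra_simps power2_eq_square)
  have f2: "f (z + \<tau>) = sign_tau \<alpha> * f z" for z
    by (simp add: f_def G2 theta_add_tau power_mult_distrib)
  have "((\<lambda>z. even_theta2 \<alpha> z * (\<theta> 0 z / z) - 2 * (even_theta1 \<alpha> z / z) * \<theta> 1 z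
     + even_theta \<alpha> z * (\<theta> 2 z / z) - heat_constant \<alpha> * even_theta \<alpha> z * (\<theta> 0 z / z)) \<longlongrightarrow>
     even_theta2 \<alpha> 0 * \<theta>1_0 - 2 * even_theta2 \<alpha> 0 * \<theta>1_0 + 1 * \<theta> 3 0 - heat_constant \<alpha> * 1 * \<theta>1_0) (at 0)"
    by (intro tendsto_intros even_theta_limits theta_limits theta_over_z)
  also have "even_theta2 \<alpha> 0 * \<theta>1_0 - 2 * even_theta2 \<alpha> 0 * \<theta>1_0 + 1 * \<theta> 3 0 - heat_constant \<alpha> * 1 * \<theta>1_0 = 0"
    by (simp add: heat_constant_def field_simps)
  finally have lim0: "((\<lambda>z. G z / z) \<longlongrightarrow> 0) (at 0)"
    by (simp add: G_def diff_divide_distrib add_divide_distrib)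
  have "((\<lambda>z. (z / \<theta> 0 z)\<^sup>2 * (G z / z)) \<longlongrightarrow> (1 / \<theta>1_0)\<^sup>2 * 0) (at 0)"
    by (intro tendsto_intros z_over_theta lim0)
  moreover have "(z / \<theta> 0 z)\<^sup>2 * (G z / z) = z * f z" for z
    by (cases "z = 0") (simp_all add: f_def power2_eq_square)
  ultimately have lim: "((\<lambda>z. z * f z) \<longlongrightarrow> 0) (at 0)" by simp
  have "f w = 0"
    by (rule elliptic_Liouville_zero[OF hol f1 sign_in(1) f2 sign_in(2) lim sign_nontrivial w])
  hence "G w = 0" using theta_nonzero[OF w] by (simp add: f_def)
  thus ?thesis unfolding G_def by algebra
qed

lemma varphi_eq: "varphi \<alpha> w \<tau> = \<theta>1_0 * even_theta \<alpha> w / \<theta> 0 w"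
  using Im_pos
  by (simp add: varphi_def kronecker_phi_def theta_eq_series theta_dz_eq_series half_period_dtau_eq
      even_theta_def half_period_exponent_def mult_ac)

lemma E1_eq: "E1 w \<tau> = \<theta> 1 w / \<theta> 0 w"
  using Im_pos by (simp add: E1_def theta_eq_series theta_dz_eq_series)

text \<open>Square and Weierstrass function are even and doubly periodic with leading term
  \<open>1 / z\<^sup>2\<close> at 0, so they differ by a constant; it is found at the half period
  where \<open>varphi \<alpha>\<close> vanishes.\<close>

lemma varphi_square:
  assumes w: "w \<notin> \<Lambda>"
  shows "(varphi \<alpha> w \<tau>)\<^sup>2 = wp w - wp (\<omega> \<alpha>)"
proof -
  define f where "f w = (\<theta>1_0 * even_theta \<alpha> w / \<theta> 0 w)\<^sup>2 - wp w" for w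
  have hol: "f holomorphic_on - \<Lambda>"
    unfolding f_def using theta_nonzero by (intro holomorphic_intros holomorphic_wp) auto
  have even: "f (- z) = f z" for z
    using theta_series_minus[of 0 z] by (simp add: f_def wp_minus power_divide)
  have f1: "f (z + 1) = 1 * f z" if "z \<notin> \<Lambda>" for z
    using that sign_in(1)[of \<alpha>]
    by (auto simp: f_def theta_series_add_1 even_theta_add_1 wp_add_1)
  have f2: "f (z + \<tau>) = 1 * f z" if "z \<notin> \<Lambda>" for z
    using that sign_in(2)[of \<alpha>]
    by (auto simp: f_def theta_add_tau even_theta_add_tau wp_add_tau power_divide power_mult_distrib)
  have "((\<lambda>z. (\<theta>1_0 * even_theta \<alpha> z * (z / \<theta> 0 z))\<^sup>2 - z\<^sup>2 * wp z) \<longlongrightarrow>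
      (\<theta>1_0 * 1 * (1 / \<theta>1_0))\<^sup>2 - 1) (at 0)"
    by (intro tendsto_intros even_theta_limits z_over_theta wp_limit)
  moreover have "(\<theta>1_0 * even_theta \<alpha> z * (z / \<theta> 0 z))\<^sup>2 - z\<^sup>2 * wp z = z\<^sup>2 * f z" for z
    by (simp add: f_def power_divide power_mult_distrib algebra_simps)
  ultimately have "((\<lambda>z. z\<^sup>2 * f z) \<longlongrightarrow> 0) (at 0)" by simp
  from even_removable[OF hol even this] have lim: "((\<lambda>z. z * f z) \<longlongrightarrow> 0) (at 0)" .
  obtain c where c: "\<And>z. z \<notin> \<Lambda> \<Longrightarrow> f z = c"
    using elliptic_Liouville[OF hol f1 _ f2 _ lim] by blast
  have "f (\<omega> \<alpha>) = c" by (rule c[OF half_period_not_in_lattice])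
  hence "c = - wp (\<omega> \<alpha>)" by (simp add: f_def even_theta_half_period)
  thus ?thesis using c[OF w] by (simp add: f_def varphi_eq diff_eq_eq)
qed

end

section \<open>Time derivatives\<close>

definition gyrostat_factor :: "3 \<Rightarrow> complex \<Rightarrow> complex" where
  "gyrostat_factor \<alpha> \<tau> = - exp (- 2 * of_real pi * \<i> * half_period \<alpha> \<tau> * half_period_dtau \<alpha> \<tau>)
     * (theta_dz 0 \<tau> / theta (half_period \<alpha> \<tau>) \<tau>)\<^sup>2"

lemma gyrostat_momentum_eq: "gyrostat_momentum \<nu> \<tau> $ \<alpha> = \<nu> $ \<alpha> * gyrostat_factor \<alpha> \<tau>"
  by (simp add: gyrostat_momentum_def gyrostat_factor_def)

text \<open>Applied with \<open>A\<close> theta at the half period, \<open>P\<close> = 4\<pi>\<i>,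
  \<open>C\<close> and \<open>c3\<close> the first and third derivatives of theta at 0,
  \<open>Z\<close>, \<open>Z1\<close>, \<open>Z2\<close> theta and its derivatives at
  \<open>w\<close>, \<open>t0\<close>, \<open>t1\<close>, \<open>t2\<close> the same for
  \<open>even_theta \<alpha>\<close>, and \<open>t20\<close> its second derivative at 0. The terms
  in \<open>h\<close> cancel, and the heat formula eliminates \<open>Z2\<close>.\<close>

lemma varphi_derivative_identity:
  fixes A P C Z Z1 Z2 t0 t1 t2 t20 c3 h :: complex
  assumes nz: "A \<noteq> 0" "P \<noteq> 0" "C \<noteq> 0" "Z \<noteq> 0"
    and heat: "t2 * Z - 2 * t1 * Z1 + t0 * Z2 = (c3 / C - t20) * t0 * Z"
  shows "(((A / P * (t2 - h\<^sup>2 * t0)) * C + c3 / P * (A * t0)) * (Z * A)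
      - (A * t0) * C * (Z2 / P * A + A / P * (t20 - h\<^sup>2) * Z)) / ((Z * A) * (Z * A))
    = 2 / P * (C * (t2 * Z - t1 * Z1) / Z\<^sup>2)"
proof -
  have heat': "(t2 * Z - 2 * t1 * Z1 + t0 * Z2) * C = (c3 - t20 * C) * t0 * Z"
    unfolding heat using nz by (simp add: field_simps)
  have "(((A / P * (t2 - h\<^sup>2 * t0)) * C + c3 / P * (A * t0)) * (Z * A)
      - (A * t0) * C * (Z2 / P * A + A / P * (t20 - h\<^sup>2) * Z)) / ((Z * A) * (Z * A))
    = (t2 * C * Z + (c3 - t20 * C) * t0 * Z - t0 * C * Z2) / (P * Z\<^sup>2)"
    using nz by (simp add: field_simps power2_eq_square)
  also have "t2 * C * Z + (c3 - t20 * C) * t0 * Z - t0 * C * Z2 = 2 * (C * (t2 * Z - t1 * Z1))"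
    unfolding heat'[symmetric] by (simp add: algebra_simps)
  finally show ?thesis by simp
qed

text \<open>The same letters, with \<open>t\<close> the second derivative of
  \<open>even_theta \<alpha>\<close> at 0. The moving exponential \<open>e\<close> and the moving
  theta value contribute opposite multiples of \<open>h\<^sup>2\<close>.\<close>

lemma gyrostat_factor_derivative_identity:
  fixes A P C c3 t h e :: complex
  assumes nz: "A \<noteq> 0" "P \<noteq> 0" "C \<noteq> 0"
  shows "- (e * (- (h * (2 * h / P)))) * (C / A)\<^sup>2 +
      2 * (C / A) * ((c3 / P * A - C * (A / P * (t - h\<^sup>2))) / (A * A)) * - e
    = 2 / P * ((c3 / C - t) * (- e * (C / A)\<^sup>2))"
proof -
  have 1: "(c3 / P * A - C * (A / P * (t - h\<^sup>2))) / (A * A) = (c3 - C * (t - h\<^sup>2)) / (P * A)"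
    using nz by (simp add: field_simps)
  have 2: "(c3 / C - t) * (- e * (C / A)\<^sup>2) = e * C * (C * t - c3) / A\<^sup>2"
    using nz by (simp add: field_simps power2_eq_square)
  show ?thesis
    unfolding 1 2 using nz by (simp add: divide_simps) (simp add: algebra_simps power2_eq_square)
qed

lemma isCont_eventually_nonzero:
  fixes f :: "'a :: t2_space \<Rightarrow> 'b :: {t1_space, zero}"
  assumes "isCont f x" "f x \<noteq> 0"
  shows "eventually (\<lambda>y. f y \<noteq> 0) (nhds x)"
  using assms tendsto_imp_eventually_ne[of f "f x" "nhds x" 0]
  by (simp add: isCont_def tendsto_at_iff_tendsto_nhds)

context modulus
begin

lemma eventually_Im_pos: "eventually (\<lambda>t. Im t > 0) (nhds \<tau>)"
  using eventually_nhds_in_open[of "{t. Im t > 0}" \<tau>] Im_pos by (simp add: open_halfspace_Im_gt)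

text \<open>The heat equation contributes a second derivative, and the motion of the half period
  contributes a first derivative with coefficient \<open>2 * half_period_exponent \<alpha>\<close>
  over 4\<pi>\<i>. Together they form \<open>even_theta2 \<alpha>\<close> up to the term in the
  squared exponent.\<close>

lemma even_theta_tau_deriv:
  "((\<lambda>t. exp (half_period_exponent \<alpha> * w) * theta_series 0 (w + half_period \<alpha> t) t) has_field_derivative
     \<theta> 0 (\<omega> \<alpha>) / (4 * of_real pi * \<i>) * (even_theta2 \<alpha> w - (half_period_exponent \<alpha>)\<^sup>2 * even_theta \<alpha> w)) (at \<tau>)"
proof -
  define e where "e = exp (half_period_exponent \<alpha> * w)"
  have eq: "w + half_period_offset \<alpha> + half_period_rate \<alpha> * t = w + half_period \<alpha> t" for t
    by (simp add: half_period_eq)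
  have "((\<lambda>t. e * theta_series 0 (w + half_period \<alpha> t) t) has_field_derivative
      e * (half_period_rate \<alpha> * \<theta> 1 (w + \<omega> \<alpha>) + \<theta> 2 (w + \<omega> \<alpha>) / (4 * of_real pi * \<i>))) (at \<tau>)"
    using has_field_derivative_theta_series_tau[OF Im_pos, of 0 "w + half_period_offset \<alpha>" "half_period_rate \<alpha>"]
    unfolding eq by (intro DERIV_cmult) (simp add: One_nat_def numeral_2_eq_2)
  also have "e * (half_period_rate \<alpha> * \<theta> 1 (w + \<omega> \<alpha>) + \<theta> 2 (w + \<omega> \<alpha>) / (4 * of_real pi * \<i>)) =
      \<theta> 0 (\<omega> \<alpha>) / (4 * of_real pi * \<i>) * (even_theta2 \<alpha> w - (half_period_exponent \<alpha>)\<^sup>2 * even_theta \<alpha> w)"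
  proof -
    define h where "h = half_period_exponent \<alpha>"
    have r: "half_period_rate \<alpha> = 2 * h / (4 * of_real pi * \<i>)"
      by (simp add: h_def half_period_exponent_def)
    show ?thesis
      unfolding even_theta_def even_theta2_def e_def[symmetric] r unfolding h_def[symmetric]
      by (simp add: field_simps)
  qed
  finally show ?thesis by (simp add: e_def)
qed

lemma theta_half_period_tau_deriv:
  "((\<lambda>t. theta_series 0 (half_period \<alpha> t) t) has_field_derivative
     \<theta> 0 (\<omega> \<alpha>) / (4 * of_real pi * \<i>) * (even_theta2 \<alpha> 0 - (half_period_exponent \<alpha>)\<^sup>2)) (at \<tau>)"
  using even_theta_tau_deriv[of \<alpha> 0] by simp

lemma theta_tau_deriv:
  "((\<lambda>t. theta_series k w t) has_field_derivative \<theta> (Suc (Suc k)) w / (4 * of_real pi * \<i>)) (at \<tau>)"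
  using has_field_derivative_theta_series_tau[OF Im_pos, of k w 0] by simp

text \<open>The common value of 2\<pi>\<i> times the time derivative of
  \<open>varphi \<alpha>\<close> and of the spectral derivative of the coefficient that
  \<open>S\<close> has in \<open>M\<close>, up to the factor 1/(2\<pi>\<i>).\<close>

definition varphi_flow :: "3 \<Rightarrow> complex \<Rightarrow> complex" where
  "varphi_flow \<alpha> w = \<theta>1_0 * (even_theta2 \<alpha> w * \<theta> 0 w - even_theta1 \<alpha> w * \<theta> 1 w) / (\<theta> 0 w)\<^sup>2"

lemma DERIV_varphi_tau:
  assumes w: "w \<notin> \<Lambda>"
  shows "((\<lambda>t. varphi \<alpha> w t) has_field_derivative varphi_flow \<alpha> w / (2 * of_real pi * \<i>)) (at \<tau>)"
proof -
  define P where "P = 4 * of_real pi * \<i>"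
  have P: "P \<noteq> 0" by (simp add: P_def)
  note nz = theta_nonzero[OF w] theta_half_period_nonzero[of \<alpha>]
  let ?X = "\<lambda>t. exp (half_period_exponent \<alpha> * w) * theta_series 0 (w + half_period \<alpha> t) t"
  have X: "?X \<tau> = \<theta> 0 (\<omega> \<alpha>) * even_theta \<alpha> w" by (simp add: even_theta_def)
  have "((\<lambda>t. ?X t * theta_series 1 0 t / (theta_series 0 w t * theta_series 0 (half_period \<alpha> t) t))
      has_field_derivative
      (((\<theta> 0 (\<omega> \<alpha>) / P * (even_theta2 \<alpha> w - (half_period_exponent \<alpha>)\<^sup>2 * even_theta \<alpha> w)) * \<theta>1_0
         + \<theta> 3 0 / P * ?X \<tau>) * (\<theta> 0 w * \<theta> 0 (\<omega> \<alpha>))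
       - ?X \<tau> * \<theta>1_0 * (\<theta> 2 w / P * \<theta> 0 (\<omega> \<alpha>) +
           \<theta> 0 (\<omega> \<alpha>) / P * (even_theta2 \<alpha> 0 - (half_period_exponent \<alpha>)\<^sup>2) * \<theta> 0 w))
      / ((\<theta> 0 w * \<theta> 0 (\<omega> \<alpha>)) * (\<theta> 0 w * \<theta> 0 (\<omega> \<alpha>)))) (at \<tau>)"
    using theta_tau_deriv[of 1 0] theta_tau_deriv[of 0 w] even_theta_tau_deriv[of \<alpha> w]
      theta_half_period_tau_deriv[of \<alpha>] nz
    unfolding P_def
    by (intro DERIV_divide DERIV_mult) (simp_all add: eval_nat_numeral One_nat_def)
  also have "(((\<theta> 0 (\<omega> \<alpha>) / P * (even_theta2 \<alpha> w - (half_period_exponent \<alpha>)\<^sup>2 * even_theta \<alpha> w)) * \<theta>1_0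
         + \<theta> 3 0 / P * ?X \<tau>) * (\<theta> 0 w * \<theta> 0 (\<omega> \<alpha>))
       - ?X \<tau> * \<theta>1_0 * (\<theta> 2 w / P * \<theta> 0 (\<omega> \<alpha>) +
           \<theta> 0 (\<omega> \<alpha>) / P * (even_theta2 \<alpha> 0 - (half_period_exponent \<alpha>)\<^sup>2) * \<theta> 0 w))
      / ((\<theta> 0 w * \<theta> 0 (\<omega> \<alpha>)) * (\<theta> 0 w * \<theta> 0 (\<omega> \<alpha>))) = 2 / P * varphi_flow \<alpha> w"
    unfolding varphi_flow_def X
    by (rule varphi_derivative_identity)
       (use nz P even_theta_heat_formula[OF w, of \<alpha>] in \<open>simp_all add: heat_constant_def\<close>)
  also have "2 / P * varphi_flow \<alpha> w = varphi_flow \<alpha> w / (2 * of_real pi * \<i>)" by (simp add: P_def)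
  finally show ?thesis
  proof (rule has_field_derivative_transform_within_open[where S = "{t. Im t > 0}"])
    fix t :: complex assume "t \<in> {t. Im t > 0}"
    thus "?X t * theta_series 1 0 t / (theta_series 0 w t * theta_series 0 (half_period \<alpha> t) t) = varphi \<alpha> w t"
      by (simp add: varphi_def kronecker_phi_def theta_eq_series theta_dz_eq_series half_period_dtau_eq
          half_period_exponent_def mult_ac)
  qed (use Im_pos in \<open>auto simp: open_halfspace_Im_gt\<close>)
qed

lemma varphi_nonzero_iff: "\<theta> 0 w \<noteq> 0 \<Longrightarrow> varphi \<alpha> w \<tau> \<noteq> 0 \<longleftrightarrow> \<theta> 0 (w + \<omega> \<alpha>) \<noteq> 0"
  by (simp add: varphi_eq even_theta_def)

lemma gyrostat_factor_eq:
  "gyrostat_factor \<alpha> \<tau> = - exp (- (half_period_exponent \<alpha> * \<omega> \<alpha>)) * (\<theta>1_0 / \<theta> 0 (\<omega> \<alpha>))\<^sup>2"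
  using Im_pos by (simp add: gyrostat_factor_def theta_eq_series theta_dz_eq_series half_period_dtau_eq
      half_period_exponent_def mult_ac)

text \<open>Moving the argument by the half period exchanges, up to exponentials, the theta values
  in numerator and denominator. The shifted function is therefore a multiple of the reciprocal, and
  this multiple is what turns the constants \<nu> into the gyrostat momentum.\<close>

lemma varphi_shift:
  assumes nz: "\<theta> 0 w \<noteq> 0" "\<theta> 0 (w + \<omega> \<alpha>) \<noteq> 0"
  shows "varphi \<alpha> (w - \<omega> \<alpha>) \<tau> = gyrostat_factor \<alpha> \<tau> / varphi \<alpha> w \<tau>"
proof -
  define h where "h = half_period_exponent \<alpha>"
  have shift: "\<theta> 0 (w + \<omega> \<alpha>) = - exp (- 2 * h * w) * \<theta> 0 (w - \<omega> \<alpha>)"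
    unfolding h_def by (rule theta_half_period_shift)
  with nz have nz': "\<theta> 0 (w - \<omega> \<alpha>) \<noteq> 0" by auto
  have "exp (h * (w - \<omega> \<alpha>)) * (exp (h * w) * exp (- 2 * h * w)) = exp (- (h * \<omega> \<alpha>))"
    by (simp add: algebra_simps flip: exp_add)
  note ee = this[symmetric]
  have "varphi \<alpha> (w - \<omega> \<alpha>) \<tau> * varphi \<alpha> w \<tau> = gyrostat_factor \<alpha> \<tau>"
    unfolding varphi_eq even_theta_def gyrostat_factor_eq shift
    unfolding h_def[symmetric] ee
    using nz(1) nz' by (simp add: divide_simps power2_eq_square)
  moreover have "varphi \<alpha> w \<tau> \<noteq> 0" using nz varphi_nonzero_iff by blast
  ultimately show ?thesis by (simp add: field_simps)
qed

lemma DERIV_gyrostat_factor: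
  "(gyrostat_factor \<alpha> has_field_derivative
     heat_constant \<alpha> * gyrostat_factor \<alpha> \<tau> / (2 * of_real pi * \<i>)) (at \<tau>)"
proof -
  define P where "P = 4 * of_real pi * \<i>"
  have P: "P \<noteq> 0" by (simp add: P_def)
  define h where "h = half_period_exponent \<alpha>"
  have h: "half_period_rate \<alpha> = 2 * h / P"
    by (simp add: h_def half_period_exponent_def P_def)
  let ?O = "\<theta> 0 (\<omega> \<alpha>)"
  let ?e = "exp (- (h * \<omega> \<alpha>))"
  have e: "((\<lambda>t. exp (- (h * half_period \<alpha> t))) has_field_derivative ?e * (- (h * half_period_rate \<alpha>))) (at \<tau>)"
    unfolding half_period_eq by (auto intro!: derivative_eq_intros)
  have d1: "((\<lambda>t. theta_series 1 0 t) has_field_derivative \<theta> 3 0 / P) (at \<tau>)"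
    using theta_tau_deriv[of 1 0] by (simp add: P_def eval_nat_numeral One_nat_def)
  have d0: "((\<lambda>t. theta_series 0 (half_period \<alpha> t) t) has_field_derivative ?O / P * (even_theta2 \<alpha> 0 - h\<^sup>2)) (at \<tau>)"
    using theta_half_period_tau_deriv[of \<alpha>] by (simp add: P_def h_def)
  have q: "((\<lambda>t. theta_series 1 0 t / theta_series 0 (half_period \<alpha> t) t) has_field_derivative
      (\<theta> 3 0 / P * ?O - \<theta>1_0 * (?O / P * (even_theta2 \<alpha> 0 - h\<^sup>2))) / (?O * ?O)) (at \<tau>)"
    by (rule DERIV_divide[OF d1 d0 theta_half_period_nonzero])
  have "((\<lambda>t. - exp (- (h * half_period \<alpha> t)) * (theta_series 1 0 t / theta_series 0 (half_period \<alpha> t) t)\<^sup>2)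
      has_field_derivative
      - (?e * (- (h * half_period_rate \<alpha>))) * (\<theta>1_0 / ?O)\<^sup>2 +
      2 * (\<theta>1_0 / ?O) * ((\<theta> 3 0 / P * ?O - \<theta>1_0 * (?O / P * (even_theta2 \<alpha> 0 - h\<^sup>2))) / (?O * ?O)) * - ?e) (at \<tau>)"
    using DERIV_mult[OF DERIV_minus[OF e] DERIV_power[OF q, of 2]]
    by (simp add: mult_ac One_nat_def)
  also have "- (?e * (- (h * half_period_rate \<alpha>))) * (\<theta>1_0 / ?O)\<^sup>2 +
      2 * (\<theta>1_0 / ?O) * ((\<theta> 3 0 / P * ?O - \<theta>1_0 * (?O / P * (even_theta2 \<alpha> 0 - h\<^sup>2))) / (?O * ?O)) * - ?e
      = 2 / P * (heat_constant \<alpha> * (- ?e * (\<theta>1_0 / ?O)\<^sup>2))"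
    unfolding h heat_constant_def
    by (rule gyrostat_factor_derivative_identity[OF theta_half_period_nonzero P theta1_0_nonzero])
  also have "2 / P * (heat_constant \<alpha> * (- ?e * (\<theta>1_0 / ?O)\<^sup>2)) =
      heat_constant \<alpha> * gyrostat_factor \<alpha> \<tau> / (2 * of_real pi * \<i>)"
    unfolding gyrostat_factor_eq h_def[symmetric] by (simp add: P_def)
  finally show ?thesis
  proof (rule has_field_derivative_transform_within_open[where S = "{t. Im t > 0}"])
    fix t :: complex assume "t \<in> {t. Im t > 0}"
    thus "- exp (- (h * half_period \<alpha> t)) * (theta_series 1 0 t / theta_series 0 (half_period \<alpha> t) t)\<^sup>2
        = gyrostat_factor \<alpha> t"
      unfolding gyrostat_factor_def half_period_dtau_eq
      by (simp add: theta_eq_series theta_dz_eq_series half_period_exponent_def h_def mult_ac)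
  qed (use Im_pos in \<open>auto simp: open_halfspace_Im_gt\<close>)
qed

section \<open>Regular spectral points and the flows of the shifted functions\<close>

lemma half_period_double: "2 * \<omega> \<alpha> \<in> \<Lambda>"
  using lattice_int[of 1 1] by (auto simp: half_period_def add_divide_distrib ring_distribs)

lemma regular_iff: "w \<in> regular_spectral_points \<tau> \<longleftrightarrow> 2 * w \<notin> \<Lambda>"
  by (auto simp: regular_spectral_points_def period_lattice_def)

lemma open_regular: "open (regular_spectral_points \<tau>)"
proof -
  have "regular_spectral_points \<tau> = (\<lambda>w. 2 * w) -` (- \<Lambda>)" by (auto simp: regular_iff)
  moreover have "open ((\<lambda>w. 2 * w) -` (- \<Lambda>))"
    by (intro open_vimage open_Compl_lattice continuous_intros)
  ultimately show ?thesis by simp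
qed

lemma regular_nonempty: "1 / 4 \<in> regular_spectral_points \<tau>"
  using half_not_in_lattice by (simp add: regular_iff)

lemma
  assumes "w \<in> regular_spectral_points \<tau>"
  shows regular_not_lattice: "w \<notin> \<Lambda>" and regular_add_not_lattice: "w + \<omega> \<alpha> \<notin> \<Lambda>"
proof -
  have dbl: "2 * a \<in> \<Lambda>" if "a \<in> \<Lambda>" for a
    unfolding mult_2 by (rule lattice_add[OF that that])
  have w: "2 * w \<notin> \<Lambda>" using assms by (simp add: regular_iff)
  thus "w \<notin> \<Lambda>" using dbl by blast
  have "2 * (w + \<omega> \<alpha>) \<notin> \<Lambda>"
    using w half_period_double[of \<alpha>] by (simp add: ring_distribs lattice_add_iff)
  thus "w + \<omega> \<alpha> \<notin> \<Lambda>" using dbl by blast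
qed

lemmas regular_theta_nonzero = theta_nonzero[OF regular_not_lattice] theta_nonzero[OF regular_add_not_lattice]

lemma regular_varphi_nonzero: "w \<in> regular_spectral_points \<tau> \<Longrightarrow> varphi \<alpha> w \<tau> \<noteq> 0"
  using regular_theta_nonzero varphi_nonzero_iff by blast

lemma regular_even_theta_nonzero: "w \<in> regular_spectral_points \<tau> \<Longrightarrow> even_theta \<alpha> w \<noteq> 0"
  using regular_theta_nonzero(2) by (simp add: even_theta_def)

text \<open>The counterpart of \<open>varphi_flow\<close> for the shifted functions, which multiply
  \<nu>.\<close>

definition shifted_flow :: "3 \<Rightarrow> complex \<Rightarrow> complex" where
  "shifted_flow \<alpha> w = gyrostat_factor \<alpha> \<tau> / \<theta>1_0 *
     ((\<theta> 2 w * even_theta \<alpha> w - \<theta> 1 w * even_theta1 \<alpha> w) / (even_theta \<alpha> w)\<^sup>2)"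

text \<open>The shift itself moves with time, so the reciprocal form from
  \<open>varphi_shift\<close> is differentiated instead. The heat formula cancels the second
  derivative of \<open>even_theta \<alpha>\<close>.\<close>

lemma DERIV_varphi_shift_tau:
  assumes w: "w \<in> regular_spectral_points \<tau>"
  shows "((\<lambda>t. varphi \<alpha> (w - half_period \<alpha> t) t) has_field_derivative
     shifted_flow \<alpha> w / (2 * of_real pi * \<i>)) (at \<tau>)"
proof -
  define Q where "Q = 2 * of_real pi * \<i>"
  note nz = regular_theta_nonzero[OF w] regular_even_theta_nonzero[OF w, of \<alpha>]
    regular_varphi_nonzero[OF w, of \<alpha>]
  have "((\<lambda>t. gyrostat_factor \<alpha> t / varphi \<alpha> w t) has_field_derivative
      (heat_constant \<alpha> * gyrostat_factor \<alpha> \<tau> / Q * varphi \<alpha> w \<tau> - gyrostat_factor \<alpha> \<tau> * (varphi_flow \<alpha> w / Q))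
      / (varphi \<alpha> w \<tau> * varphi \<alpha> w \<tau>)) (at \<tau>)"
    unfolding Q_def
    by (rule DERIV_divide[OF DERIV_gyrostat_factor DERIV_varphi_tau[OF regular_not_lattice[OF w]] nz(4)])
  also have "(heat_constant \<alpha> * gyrostat_factor \<alpha> \<tau> / Q * varphi \<alpha> w \<tau> - gyrostat_factor \<alpha> \<tau> * (varphi_flow \<alpha> w / Q))
      / (varphi \<alpha> w \<tau> * varphi \<alpha> w \<tau>) = shifted_flow \<alpha> w / Q"
  proof -
    have "heat_constant \<alpha> * varphi \<alpha> w \<tau> - varphi_flow \<alpha> w =
       \<theta>1_0 * (heat_constant \<alpha> * even_theta \<alpha> w * \<theta> 0 w - (even_theta2 \<alpha> w * \<theta> 0 w - even_theta1 \<alpha> w * \<theta> 1 w)) / (\<theta> 0 w)\<^sup>2"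
      using nz by (simp add: varphi_eq varphi_flow_def field_simps power2_eq_square)
    also have "\<dots> = \<theta>1_0 * (\<theta> 2 w * even_theta \<alpha> w - \<theta> 1 w * even_theta1 \<alpha> w) / (\<theta> 0 w)\<^sup>2"
      unfolding even_theta_heat_formula[OF regular_not_lattice[OF w], of \<alpha>, symmetric] by (simp add: algebra_simps)
    finally have *: "heat_constant \<alpha> * varphi \<alpha> w \<tau> - varphi_flow \<alpha> w = \<dots>" .
    have "(heat_constant \<alpha> * gyrostat_factor \<alpha> \<tau> / Q * varphi \<alpha> w \<tau> - gyrostat_factor \<alpha> \<tau> * (varphi_flow \<alpha> w / Q))
      / (varphi \<alpha> w \<tau> * varphi \<alpha> w \<tau>) =
      gyrostat_factor \<alpha> \<tau> * (heat_constant \<alpha> * varphi \<alpha> w \<tau> - varphi_flow \<alpha> w) / (varphi \<alpha> w \<tau>)\<^sup>2 / Q"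
      by (simp add: power2_eq_square diff_divide_distrib right_diff_distrib mult_ac)
    also have "\<dots> = shifted_flow \<alpha> w / Q"
      unfolding * unfolding shifted_flow_def varphi_eq using nz by (simp add: power2_eq_square)
    finally show ?thesis .
  qed
  finally have D: "((\<lambda>t. gyrostat_factor \<alpha> t / varphi \<alpha> w t) has_field_derivative shifted_flow \<alpha> w / Q) (at \<tau>)" .
  \<comment> \<open>The reciprocal form is available at a nearby time only where these two theta
    values are nonzero, which continuity in time provides.\<close>
  have ev1: "eventually (\<lambda>t. theta_series 0 w t \<noteq> 0) (nhds \<tau>)"
    by (rule isCont_eventually_nonzero[OF DERIV_isCont[OF theta_tau_deriv] nz(1)])
  have ev2: "eventually (\<lambda>t. exp (half_period_exponent \<alpha> * w) * theta_series 0 (w + half_period \<alpha> t) t \<noteq> 0) (nhds \<tau>)"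
    by (rule isCont_eventually_nonzero[OF DERIV_isCont[OF even_theta_tau_deriv]]) (use nz(2) in simp)
  have "eventually (\<lambda>t. gyrostat_factor \<alpha> t / varphi \<alpha> w t = varphi \<alpha> (w - half_period \<alpha> t) t) (nhds \<tau>)"
    using ev1 ev2 eventually_Im_pos
  proof eventually_elim
    case (elim t)
    interpret t: modulus t by unfold_locales fact
    show ?case using t.varphi_shift[of w \<alpha>] elim by simp
  qed
  from DERIV_cong_ev[OF refl this refl] D show ?thesis by (simp add: Q_def)
qed

text \<open>Theta cancels between \<open>E1\<close> and the reciprocal form, leaving a multiple of
  the quotient of the derivative of theta by \<open>even_theta \<alpha>\<close>.\<close>

lemma DERIV_E1_varphi_shift:
  assumes w: "w \<in> regular_spectral_points \<tau>"
  shows "((\<lambda>z. E1 z \<tau> * varphi \<alpha> (z - \<omega> \<alpha>) \<tau>) has_field_derivative shifted_flow \<alpha> w) (at w)"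
proof -
  have "((\<lambda>z. gyrostat_factor \<alpha> \<tau> / \<theta>1_0 * (\<theta> 1 z / even_theta \<alpha> z)) has_field_derivative
     gyrostat_factor \<alpha> \<tau> / \<theta>1_0 *
     ((\<theta> 2 w * even_theta \<alpha> w - \<theta> 1 w * even_theta1 \<alpha> w) / (even_theta \<alpha> w * even_theta \<alpha> w))) (at w)"
    using DERIV_theta_series[where k = 1 and z = w]
    by (intro DERIV_cmult DERIV_divide DERIV_even_theta regular_even_theta_nonzero w) simp
  hence "((\<lambda>z. gyrostat_factor \<alpha> \<tau> / \<theta>1_0 * (\<theta> 1 z / even_theta \<alpha> z)) has_field_derivative shifted_flow \<alpha> w) (at w)"
    by (simp add: shifted_flow_def power2_eq_square)
  thus ?thesis
  proof (rule has_field_derivative_transform_within_open[OF _ open_regular w])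
    fix z assume z: "z \<in> regular_spectral_points \<tau>"
    show "gyrostat_factor \<alpha> \<tau> / \<theta>1_0 * (\<theta> 1 z / even_theta \<alpha> z) = E1 z \<tau> * varphi \<alpha> (z - \<omega> \<alpha>) \<tau>"
      using regular_theta_nonzero[OF z] regular_even_theta_nonzero[OF z, of \<alpha>]
      by (simp add: varphi_shift E1_eq varphi_eq[of \<alpha> z])
  qed
qed

abbreviation varphi_product :: "3 \<Rightarrow> complex \<Rightarrow> complex" where
  "varphi_product \<alpha> w \<equiv> varphi 1 w \<tau> * varphi 2 w \<tau> * varphi 3 w \<tau> / varphi \<alpha> w \<tau>"

text \<open>After division by \<open>varphi \<alpha>\<close> the triple product is the product of
  the other two functions, so \<open>even_theta_product_formula\<close> collapses the expression to
  a single quotient that is easy to differentiate.\<close>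

lemma E1_varphi_eq:
  assumes w: "w \<in> regular_spectral_points \<tau>"
  shows "E1 w \<tau> * varphi \<alpha> w \<tau> - varphi_product \<alpha> w = \<theta>1_0 * even_theta1 \<alpha> w / \<theta> 0 w"
proof -
  have *: "E1 w \<tau> * varphi \<alpha> w \<tau> - varphi \<beta> w \<tau> * varphi \<gamma> w \<tau> = \<theta>1_0 * even_theta1 \<alpha> w / \<theta> 0 w"
    if "\<alpha> \<noteq> \<beta>" "\<beta> \<noteq> \<gamma>" "\<alpha> \<noteq> \<gamma>" for \<beta> \<gamma>
  proof -
    have "E1 w \<tau> * varphi \<alpha> w \<tau> - varphi \<beta> w \<tau> * varphi \<gamma> w \<tau> =
        \<theta>1_0 * (\<theta> 1 w * even_theta \<alpha> w - \<theta>1_0 * even_theta \<beta> w * even_theta \<gamma> w) / (\<theta> 0 w * \<theta> 0 w)"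
      using regular_theta_nonzero(1)[OF w] by (simp add: E1_eq varphi_eq field_simps)
    also have "\<dots> = \<theta>1_0 * even_theta1 \<alpha> w / \<theta> 0 w"
      unfolding even_theta_product_formula[OF that regular_not_lattice[OF w], symmetric]
      using regular_theta_nonzero(1)[OF w] by simp
    finally show ?thesis .
  qed
  show ?thesis
    using *[of 2 3] *[of 1 3] *[of 1 2] regular_varphi_nonzero[OF w, of \<alpha>]
    by (cases \<alpha> rule: three_cases) (simp_all add: mult_ac)
qed

lemma DERIV_E1_varphi:
  assumes w: "w \<in> regular_spectral_points \<tau>"
  shows "((\<lambda>z. E1 z \<tau> * varphi \<alpha> z \<tau> - varphi_product \<alpha> z) has_field_derivative varphi_flow \<alpha> w) (at w)"
proof -
  have "((\<lambda>z. \<theta>1_0 * even_theta1 \<alpha> z / \<theta> 0 z) has_field_derivative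
     (\<theta>1_0 * even_theta2 \<alpha> w * \<theta> 0 w - \<theta>1_0 * even_theta1 \<alpha> w * \<theta> 1 w) / (\<theta> 0 w * \<theta> 0 w)) (at w)"
    using DERIV_theta_series[where k = 0 and z = w]
    by (intro DERIV_cmult DERIV_divide DERIV_even_theta1 regular_theta_nonzero w) (simp add: One_nat_def)
  also have "(\<theta>1_0 * even_theta2 \<alpha> w * \<theta> 0 w - \<theta>1_0 * even_theta1 \<alpha> w * \<theta> 1 w) / (\<theta> 0 w * \<theta> 0 w) = varphi_flow \<alpha> w"
    by (simp add: varphi_flow_def power2_eq_square right_diff_distrib mult.assoc)
  finally show ?thesis
    by (rule has_field_derivative_transform_within_open[OF _ open_regular w]) (simp add: E1_varphi_eq)
qed

text \<open>The mixed second derivative of the logarithm of theta in \<tau> and \<open>w\<close>.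
  Obtained in either order, it makes the scalar parts of the Lax equation cancel.\<close>

definition E1_flow :: "complex \<Rightarrow> complex" where
  "E1_flow w = (\<theta> 3 w * \<theta> 0 w - \<theta> 1 w * \<theta> 2 w) / (4 * of_real pi * \<i> * (\<theta> 0 w)\<^sup>2)"

lemma DERIV_E1_tau:
  assumes w: "w \<notin> \<Lambda>"
  shows "((\<lambda>t. E1 w t) has_field_derivative E1_flow w) (at \<tau>)"
proof -
  have "((\<lambda>t. theta_series 1 w t / theta_series 0 w t) has_field_derivative
     (\<theta> 3 w / (4 * of_real pi * \<i>) * \<theta> 0 w - \<theta> 1 w * (\<theta> 2 w / (4 * of_real pi * \<i>))) / (\<theta> 0 w * \<theta> 0 w)) (at \<tau>)"
    using theta_tau_deriv[of 1 w] theta_tau_deriv[of 0 w] theta_nonzero[OF w]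
    by (intro DERIV_divide) (simp_all add: eval_nat_numeral One_nat_def)
  also have "(\<theta> 3 w / (4 * of_real pi * \<i>) * \<theta> 0 w - \<theta> 1 w * (\<theta> 2 w / (4 * of_real pi * \<i>))) / (\<theta> 0 w * \<theta> 0 w)
     = E1_flow w"
    by (simp add: E1_flow_def power2_eq_square diff_divide_distrib)
  finally show ?thesis
  proof (rule has_field_derivative_transform_within_open[where S = "{t. Im t > 0}"])
    fix t :: complex assume "t \<in> {t. Im t > 0}"
    thus "theta_series 1 w t / theta_series 0 w t = E1 w t"
      by (simp add: E1_def theta_eq_series theta_dz_eq_series)
  qed (use Im_pos in \<open>auto simp: open_halfspace_Im_gt\<close>)
qed

lemma DERIV_dtau_ln_theta:
  assumes w: "w \<notin> \<Lambda>"
  shows "((\<lambda>z. dtau_ln_theta z \<tau>) has_field_derivative E1_flow w) (at w)"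
proof -
  have "((\<lambda>z. \<theta> 2 z / (4 * of_real pi * \<i>) / \<theta> 0 z) has_field_derivative
     (\<theta> 3 w / (4 * of_real pi * \<i>) * \<theta> 0 w - \<theta> 2 w / (4 * of_real pi * \<i>) * \<theta> 1 w) / (\<theta> 0 w * \<theta> 0 w)) (at w)"
    using DERIV_theta_series[where k = 2 and z = w] DERIV_theta_series[where k = 0 and z = w] theta_nonzero[OF w]
    by (intro DERIV_divide DERIV_cdivide) (simp_all add: One_nat_def)
  thus ?thesis
    using Im_pos
    by (simp add: dtau_ln_theta_def theta_dtau_eq_series theta_eq_series E1_flow_def power2_eq_square
        diff_divide_distrib mult_ac)
qed

end

section \<open>The Lax equation\<close>

definition pauli_comb :: "complex \<Rightarrow> (3 \<Rightarrow> complex) \<Rightarrow> complex^2^2" where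
  "pauli_comb c0 c = mscale c0 (mat 1) + (\<Sum>\<alpha>\<in>UNIV. mscale (c \<alpha>) (pauli \<alpha>))"

lemma pauli_comb_nth:
  "pauli_comb c0 c $ 1 $ 1 = c0 + c 3" "pauli_comb c0 c $ 1 $ 2 = c 1 - \<i> * c 2"
  "pauli_comb c0 c $ 2 $ 1 = c 1 + \<i> * c 2" "pauli_comb c0 c $ 2 $ 2 = c0 - c 3"
  by (simp_all add: pauli_comb_def mscale_def pauli_def mat_def sum_3)

lemma mat2_eq_iff: "A = B \<longleftrightarrow> (\<forall>i j. (A :: complex^2^2) $ i $ j = B $ i $ j)"
  by (simp add: vec_eq_iff)

text \<open>Linear independence of the identity and the Pauli matrices, seen from sums and
  differences of entries; it splits the matrix Lax equation into scalar equations.\<close>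

lemma pauli_comb_eq_0_iff: "pauli_comb c0 c = 0 \<longleftrightarrow> c0 = 0 \<and> (\<forall>\<alpha>. c \<alpha> = 0)"
proof
  assume "pauli_comb c0 c = 0"
  hence e: "c0 + c 3 = 0" "c 1 - \<i> * c 2 = 0" "c 1 + \<i> * c 2 = 0" "c0 - c 3 = 0"
    using pauli_comb_nth[of c0 c] by simp_all
  have "2 * c0 = (c0 + c 3) + (c0 - c 3)" "2 * c 3 = (c0 + c 3) - (c0 - c 3)"
    "2 * c 1 = (c 1 + \<i> * c 2) + (c 1 - \<i> * c 2)" "2 * \<i> * c 2 = (c 1 + \<i> * c 2) - (c 1 - \<i> * c 2)"
    by (simp_all add: algebra_simps)
  thus "c0 = 0 \<and> (\<forall>\<alpha>. c \<alpha> = 0)" unfolding e by (simp add: forall_3)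
next
  assume "c0 = 0 \<and> (\<forall>\<alpha>. c \<alpha> = 0)"
  thus "pauli_comb c0 c = 0" by (simp add: pauli_comb_def mscale_def vec_eq_iff)
qed

lemma pauli_comb_add: "pauli_comb a0 a + pauli_comb b0 b = pauli_comb (a0 + b0) (\<lambda>\<alpha>. a \<alpha> + b \<alpha>)"
  by (simp add: mat2_eq_iff forall_2 pauli_comb_nth algebra_simps)

lemma pauli_comb_diff: "pauli_comb a0 a - pauli_comb b0 b = pauli_comb (a0 - b0) (\<lambda>\<alpha>. a \<alpha> - b \<alpha>)"
  by (simp add: mat2_eq_iff forall_2 pauli_comb_nth algebra_simps)

lemma mscale_pauli_comb: "mscale k (pauli_comb a0 a) = pauli_comb (k * a0) (\<lambda>\<alpha>. k * a \<alpha>)"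
proof -
  have "mscale k A $ i $ j = k * A $ i $ j" for A i j by (simp add: mscale_def)
  thus ?thesis by (simp add: mat2_eq_iff forall_2 pauli_comb_nth algebra_simps)
qed

text \<open>The identity parts are central, and the Pauli matrices obey the commutation relations of
  the cross product up to the factor \<open>2 * \<i>\<close>.\<close>

lemma commutator_pauli_comb:
  "commutator (pauli_comb a0 a) (pauli_comb b0 b) =
     pauli_comb 0 (\<lambda>\<alpha>. 2 * \<i> * ccross (\<chi> \<alpha>. a \<alpha>) (\<chi> \<alpha>. b \<alpha>) $ \<alpha>)"
  by (simp add: mat2_eq_iff forall_2 pauli_comb_nth commutator_def matrix_matrix_mult_def sum_2
      ccross_def algebra_simps)

lemma mderiv_pauli_comb:
  assumes "(a0 has_field_derivative a0') (at x)"
    and "\<And>\<alpha>. ((\<lambda>t. a t \<alpha>) has_field_derivative a' \<alpha>) (at x)"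
  shows "mderiv (\<lambda>t. pauli_comb (a0 t) (a t)) x = pauli_comb a0' a'"
proof -
  have "mderiv (\<lambda>t. pauli_comb (a0 t) (a t)) x $ i $ j = deriv (\<lambda>t. pauli_comb (a0 t) (a t) $ i $ j) x" for i j
    by (simp add: mderiv_def)
  moreover have "deriv (\<lambda>t. a0 t + a t 3) x = a0' + a' 3" "deriv (\<lambda>t. a t 1 - \<i> * a t 2) x = a' 1 - \<i> * a' 2"
    "deriv (\<lambda>t. a t 1 + \<i> * a t 2) x = a' 1 + \<i> * a' 2" "deriv (\<lambda>t. a0 t - a t 3) x = a0' - a' 3"
    by (intro DERIV_imp_deriv DERIV_add DERIV_diff DERIV_cmult assms)+
  ultimately show ?thesis by (simp add: mat2_eq_iff forall_2 pauli_comb_nth)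
qed

lemma lax_L_eq:
  "lax_L \<kappa> s n \<tau> w = pauli_comb (- (\<kappa>/2) * E1 w \<tau>)
     (\<lambda>\<alpha>. s \<tau> $ \<alpha> * varphi \<alpha> w \<tau> + n $ \<alpha> * varphi \<alpha> (w - half_period \<alpha> \<tau>) \<tau>)"
  by (simp add: lax_L_def pauli_comb_def)

text \<open>The terms are regrouped into exactly the combinations whose spectral derivatives are
  \<open>varphi_flow\<close> and \<open>shifted_flow\<close>.\<close>

lemma lax_M_eq:
  "lax_M \<kappa> s n \<tau> w = pauli_comb (- (\<kappa>/2) * dtau_ln_theta w \<tau>)
     (\<lambda>\<alpha>. 1 / (2 * of_real pi * \<i>) *
        (s \<tau> $ \<alpha> * (E1 w \<tau> * varphi \<alpha> w \<tau> - varphi 1 w \<tau> * varphi 2 w \<tau> * varphi 3 w \<tau> / varphi \<alpha> w \<tau>)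
          + n $ \<alpha> * (E1 w \<tau> * varphi \<alpha> (w - half_period \<alpha> \<tau>) \<tau>)))"
proof -
  define X where "X \<alpha> = s \<tau> $ \<alpha> * (varphi 1 w \<tau> * varphi 2 w \<tau> * varphi 3 w \<tau> / varphi \<alpha> w \<tau>)" for \<alpha>
  have "lax_M \<kappa> s n \<tau> w = pauli_comb (- (\<kappa>/2) * dtau_ln_theta w \<tau>) (\<lambda>\<alpha>. 0) +
    mscale (1 / (2 * of_real pi * \<i>)) (pauli_comb 0 (\<lambda>\<alpha>. 0) - pauli_comb 0 X + mscale (E1 w \<tau>) (lax_L 0 s n \<tau> w))"
    by (simp add: lax_M_def X_def pauli_comb_def mscale_def vec_eq_iff)
  also have "\<dots> = pauli_comb (- (\<kappa>/2) * dtau_ln_theta w \<tau>)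
     (\<lambda>\<alpha>. 1 / (2 * of_real pi * \<i>) * (- X \<alpha> + E1 w \<tau> *
        (s \<tau> $ \<alpha> * varphi \<alpha> w \<tau> + n $ \<alpha> * varphi \<alpha> (w - half_period \<alpha> \<tau>) \<tau>)))"
    unfolding lax_L_eq mscale_pauli_comb pauli_comb_add pauli_comb_diff by simp
  finally show ?thesis
    by (simp add: X_def algebra_simps)
qed

section \<open>Reduction of the Lax equation to the equation of motion\<close>

context modulus
begin

text \<open>The part of \<open>b\<close> proportional to \<open>E1\<close> is parallel to
  \<open>a\<close> and drops out of the cross product. In what remains,
  \<open>varphi \<alpha>\<close> meets itself, giving its square, or its reciprocal, giving
  \<open>gyrostat_factor \<alpha>\<close>.\<close>

lemma lax_commutator_component:
  fixes s n :: "complex^3"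
  assumes w: "w \<in> regular_spectral_points \<tau>"
  defines "a \<equiv> \<lambda>\<alpha>. s $ \<alpha> * varphi \<alpha> w \<tau> + n $ \<alpha> * varphi \<alpha> (w - \<omega> \<alpha>) \<tau>"
  defines "b \<equiv> \<lambda>\<alpha>. 1 / (2 * of_real pi * \<i>) *
        (s $ \<alpha> * (E1 w \<tau> * varphi \<alpha> w \<tau> - varphi 1 w \<tau> * varphi 2 w \<tau> * varphi 3 w \<tau> / varphi \<alpha> w \<tau>)
          + n $ \<alpha> * (E1 w \<tau> * varphi \<alpha> (w - \<omega> \<alpha>) \<tau>))"
  shows "2 * \<i> * ccross (\<chi> \<alpha>. b \<alpha>) (\<chi> \<alpha>. a \<alpha>) $ \<gamma> =
     varphi \<gamma> w \<tau> / of_real pi *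
       (ccross s (inertia \<tau> s) $ \<gamma> - ccross s (\<chi> \<alpha>. n $ \<alpha> * gyrostat_factor \<alpha> \<tau>) $ \<gamma>)"
proof -
  define p where "p \<alpha> = varphi \<alpha> w \<tau>" for \<alpha>
  define k where "k \<alpha> = gyrostat_factor \<alpha> \<tau>" for \<alpha>
  define J where "J \<alpha> = wp (\<omega> \<alpha>)" for \<alpha>
  have p: "p \<alpha> \<noteq> 0" for \<alpha> unfolding p_def by (rule regular_varphi_nonzero[OF w])
  have sq: "p \<alpha> * p \<alpha> = wp w - J \<alpha>" for \<alpha>
    using varphi_square[OF regular_not_lattice[OF w], of \<alpha>] by (simp add: p_def J_def power2_eq_square)
  have a: "a \<alpha> = s $ \<alpha> * p \<alpha> + n $ \<alpha> * (k \<alpha> / p \<alpha>)" for \<alpha>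
    unfolding a_def p_def k_def varphi_shift[OF regular_theta_nonzero[OF w]] by simp
  define X where "X \<alpha> = p 1 * p 2 * p 3 / p \<alpha>" for \<alpha>
  have b: "b \<alpha> = (E1 w \<tau> * a \<alpha> - s $ \<alpha> * X \<alpha>) / (2 * of_real pi * \<i>)" for \<alpha>
  proof -
    have "E1 w \<tau> * a \<alpha> - s $ \<alpha> * X \<alpha> = s $ \<alpha> * (E1 w \<tau> * varphi \<alpha> w \<tau> - X \<alpha>)
        + n $ \<alpha> * (E1 w \<tau> * varphi \<alpha> (w - \<omega> \<alpha>) \<tau>)"
      unfolding a_def by (simp add: algebra_simps)
    thus ?thesis by (simp add: b_def X_def p_def)
  qed
  have cross: "2 * \<i> * (b \<alpha> * a \<beta> - b \<beta> * a \<alpha>) =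
      p \<gamma> / of_real pi * ((s $ \<alpha> * (J \<beta> * s $ \<beta>) - s $ \<beta> * (J \<alpha> * s $ \<alpha>))
        - (s $ \<alpha> * (n $ \<beta> * k \<beta>) - s $ \<beta> * (n $ \<alpha> * k \<alpha>)))"
    if X: "X \<alpha> = p \<beta> * p \<gamma>" "X \<beta> = p \<alpha> * p \<gamma>" for \<alpha> \<beta> \<gamma>
  proof -
    have "2 * \<i> * (b \<alpha> * a \<beta> - b \<beta> * a \<alpha>) = (s $ \<beta> * (X \<beta> * a \<alpha>) - s $ \<alpha> * (X \<alpha> * a \<beta>)) / of_real pi"
      unfolding b by (simp add: divide_simps) (simp add: algebra_simps)
    also have "X \<beta> * a \<alpha> = p \<gamma> * (s $ \<alpha> * (p \<alpha> * p \<alpha>) + n $ \<alpha> * k \<alpha>)"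
      unfolding X a using p[of \<alpha>] by (simp add: field_simps)
    also have "X \<alpha> * a \<beta> = p \<gamma> * (s $ \<beta> * (p \<beta> * p \<beta>) + n $ \<beta> * k \<beta>)"
      unfolding X a using p[of \<beta>] by (simp add: field_simps)
    \<comment> \<open>The values \<open>wp w\<close> cancel by antisymmetry, which removes the
      spectral parameter from everything but the common factor \<open>p \<gamma>\<close>.\<close>
    finally show ?thesis unfolding sq by (simp add: algebra_simps diff_divide_distrib add_divide_distrib)
  qed
  have X: "X 1 = p 2 * p 3" "X 2 = p 1 * p 3" "X 3 = p 1 * p 2"
    using p by (simp_all add: X_def)
  show ?thesis
  proof (cases \<gamma> rule: three_cases)
    case 1
    show ?thesis using cross[where \<alpha> = 2 and \<beta> = 3 and \<gamma> = 1] X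
      by (simp add: 1 ccross_def inertia_def p_def k_def J_def mult_ac)
  next
    case 2
    show ?thesis using cross[where \<alpha> = 3 and \<beta> = 1 and \<gamma> = 2] X
      by (simp add: 2 ccross_def inertia_def p_def k_def J_def mult_ac)
  next
    case 3
    show ?thesis using cross[where \<alpha> = 1 and \<beta> = 2 and \<gamma> = 3] X
      by (simp add: 3 ccross_def inertia_def p_def k_def J_def mult_ac)
  qed
qed

text \<open>The derivative of \<open>L\<close> is linear in \<open>S\<close> while the commutator is
  quadratic and carries the factor 1/(\<pi>\<kappa>) after division by \<kappa>; scaling by
  \<pi>\<kappa> puts both on the same footing. The opposite signs of the two scalings match the
  signs of the derivative term and the gyrostat term.\<close>

lemma lax_equation_iff:
  fixes S :: "complex \<Rightarrow> complex^3" and \<nu> :: "complex^3"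
  assumes \<kappa>: "\<kappa> \<noteq> 0" and S: "\<And>\<alpha>. ((\<lambda>t. S t $ \<alpha>) has_field_derivative S' \<alpha>) (at \<tau>)"
    and w: "w \<in> regular_spectral_points \<tau>"
  defines "s \<equiv> \<lambda>t. (- (of_real pi * \<kappa>)) *s S t" and "n \<equiv> (of_real pi * \<kappa>) *s \<nu>"
  shows "lax_equation \<kappa> (lax_L \<kappa> s n) (lax_M \<kappa> s n) \<tau> w \<longleftrightarrow> nazvg_eom S \<nu> \<tau>"
proof -
  define Q where "Q = 2 * of_real pi * \<i>"
  define R where "R = ccross (S \<tau>) (inertia \<tau> (S \<tau>)) + ccross (S \<tau>) (gyrostat_momentum \<nu> \<tau>)"
  have s: "((\<lambda>t. s t $ \<alpha>) has_field_derivative - (of_real pi * \<kappa>) * S' \<alpha>) (at \<tau>)" for \<alpha>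
    unfolding s_def vector_smult_component by (intro DERIV_cmult S)
  have L: "mderiv (\<lambda>t. lax_L \<kappa> s n t w) \<tau> = pauli_comb (- (\<kappa>/2) * E1_flow w)
     (\<lambda>\<alpha>. (- (of_real pi * \<kappa>) * S' \<alpha> * varphi \<alpha> w \<tau> + varphi_flow \<alpha> w / Q * s \<tau> $ \<alpha>)
        + n $ \<alpha> * (shifted_flow \<alpha> w / Q))"
    unfolding lax_L_eq Q_def using regular_not_lattice[OF w]
    by (intro mderiv_pauli_comb DERIV_cmult DERIV_add DERIV_mult s DERIV_E1_tau
        DERIV_varphi_tau DERIV_varphi_shift_tau w)
  have M: "mderiv (\<lambda>x. lax_M \<kappa> s n \<tau> x) w = pauli_comb (- (\<kappa>/2) * E1_flow w)
     (\<lambda>\<alpha>. 1 / Q * (s \<tau> $ \<alpha> * varphi_flow \<alpha> w + n $ \<alpha> * shifted_flow \<alpha> w))"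
    unfolding lax_M_eq Q_def using regular_not_lattice[OF w]
    by (intro mderiv_pauli_comb DERIV_cmult DERIV_add DERIV_E1_varphi DERIV_E1_varphi_shift
        DERIV_dtau_ln_theta w)
  have LM: "commutator (lax_M \<kappa> s n \<tau> w) (lax_L \<kappa> s n \<tau> w) = pauli_comb 0 (\<lambda>\<gamma>.
      varphi \<gamma> w \<tau> / of_real pi *
       (ccross (s \<tau>) (inertia \<tau> (s \<tau>)) $ \<gamma> - ccross (s \<tau>) (\<chi> \<alpha>. n $ \<alpha> * gyrostat_factor \<alpha> \<tau>) $ \<gamma>))"
    unfolding lax_L_eq lax_M_eq commutator_pauli_comb lax_commutator_component[OF w] by (rule refl)
  \<comment> \<open>In the quadratic term the negative scaling is squared; in the gyrostat term the
    minus sign of the commutator is offset by the opposite signs of \<open>s\<close> and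
    \<open>n\<close>.\<close>
  have R: "1 / \<kappa> * (varphi \<gamma> w \<tau> / of_real pi *
       (ccross (s \<tau>) (inertia \<tau> (s \<tau>)) $ \<gamma> - ccross (s \<tau>) (\<chi> \<alpha>. n $ \<alpha> * gyrostat_factor \<alpha> \<tau>) $ \<gamma>))
      = of_real pi * \<kappa> * varphi \<gamma> w \<tau> * R $ \<gamma>" for \<gamma>
  proof -
    have "ccross (s \<tau>) (inertia \<tau> (s \<tau>)) $ \<gamma> - ccross (s \<tau>) (\<chi> \<alpha>. n $ \<alpha> * gyrostat_factor \<alpha> \<tau>) $ \<gamma>
      = (of_real pi * \<kappa>)\<^sup>2 * R $ \<gamma>"
      by (cases \<gamma> rule: three_cases)
         (simp_all add: R_def ccross_def inertia_def gyrostat_momentum_eq s_def n_def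
           power2_eq_square algebra_simps)
    thus ?thesis using \<kappa> by (simp add: power2_eq_square)
  qed
  \<comment> \<open>The scalar parts and all flow terms agree between the two derivatives, so only
    the derivative of \<open>S\<close> and the commutator survive, with common factor
    \<open>varphi \<gamma> w \<tau>\<close>.\<close>
  have "mderiv (\<lambda>t. lax_L \<kappa> s n t w) \<tau> - mderiv (\<lambda>x. lax_M \<kappa> s n \<tau> x) w
       + mscale (1/\<kappa>) (commutator (lax_M \<kappa> s n \<tau> w) (lax_L \<kappa> s n \<tau> w))
     = pauli_comb 0 (\<lambda>\<gamma>. of_real pi * \<kappa> * varphi \<gamma> w \<tau> * (R $ \<gamma> - S' \<gamma>))"
    unfolding L M LM mscale_pauli_comb pauli_comb_add pauli_comb_diff R
    by (simp add: algebra_simps add_divide_distrib)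
  hence "lax_equation \<kappa> (lax_L \<kappa> s n) (lax_M \<kappa> s n) \<tau> w \<longleftrightarrow>
      (\<forall>\<gamma>. of_real pi * \<kappa> * varphi \<gamma> w \<tau> * (R $ \<gamma> - S' \<gamma>) = 0)"
    unfolding lax_equation_def by (simp only: pauli_comb_eq_0_iff simp_thms)
  also have "\<dots> \<longleftrightarrow> (\<forall>\<gamma>. S' \<gamma> = R $ \<gamma>)"
    using \<kappa> regular_varphi_nonzero[OF w] by auto
  also have "\<dots> \<longleftrightarrow> nazvg_eom S \<nu> \<tau>"
    unfolding nazvg_eom_def R_def[symmetric] vec_eq_iff using DERIV_imp_deriv[OF S] by simp
  finally show ?thesis .
qed

end

theorem proposition6p2:
  fixes \<kappa> :: complex and \<nu> :: "complex^3" and S :: "complex \<Rightarrow> complex^3" and U :: "complex set"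
    and L M :: "complex \<Rightarrow> complex \<Rightarrow> complex^2^2"
  assumes "\<kappa> \<noteq> 0"
    and "open U" and "U \<subseteq> {\<tau>. Im \<tau> > 0}"
    and "\<And>\<alpha>. (\<lambda>\<tau>. S \<tau> $ \<alpha>) holomorphic_on U"
    and "L = lax_L \<kappa> (\<lambda>\<tau>. (- (of_real pi * \<kappa>)) *s S \<tau>) ((of_real pi * \<kappa>) *s \<nu>)"
    and "M = lax_M \<kappa> (\<lambda>\<tau>. (- (of_real pi * \<kappa>)) *s S \<tau>) ((of_real pi * \<kappa>) *s \<nu>)"
  shows "(\<forall>\<tau>\<in>U. nazvg_eom S \<nu> \<tau>) \<longleftrightarrow>
         (\<forall>\<tau>\<in>U. \<forall>w\<in>regular_spectral_points \<tau>. lax_equation \<kappa> L M \<tau> w)"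
proof -
  have "lax_equation \<kappa> L M \<tau> w \<longleftrightarrow> nazvg_eom S \<nu> \<tau>"
    if \<tau>: "\<tau> \<in> U" and w: "w \<in> regular_spectral_points \<tau>" for \<tau> w
  proof -
    interpret modulus \<tau> using assms(3) \<tau> by unfold_locales auto
    have "((\<lambda>t. S t $ \<alpha>) has_field_derivative deriv (\<lambda>t. S t $ \<alpha>) \<tau>) (at \<tau>)" for \<alpha>
      by (rule holomorphic_derivI[OF assms(4,2) \<tau>])
    from lax_equation_iff[OF assms(1) this w] show ?thesis unfolding assms(5,6) .
  qed
  \<comment> \<open>A regular point must exist at every time, since otherwise the condition over all
    \<open>w\<close> would be vacuous there; 1/4 always is one.\<close>
  moreover have "regular_spectral_points \<tau> \<noteq> {}" if "\<tau> \<in> U" for \<tau>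
  proof -
    interpret modulus \<tau> using assms(3) that by unfold_locales auto
    show ?thesis using regular_nonempty by blast
  qed
  ultimately show ?thesis by blast
qed

end
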